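(* Let $N\geq1$, $m\in\{1,\ldots,N\}$, $\epsilon\in\{0,1\}$, $a\in(0,1]$, $q\geq0$ be given ($N,m,q$ integers). Let $k_0=+\infty$ and let $k_1,\ldots,k_{2q+1}$ be integers with $k_{2q+1}\leq k_{2q}<k_{2q-1}\leq\cdots\leq k_2<k_1$, $k_1\leq m$, $k_{2q+1}\geq m-N-\epsilon+1$ and $k_1\geq1+\sum_{l=1}^q(k_{2l}+1-k_{2l+1})$. Let $\mathcal I=\sqcup_{l=0}^q\mathcal I_l$ with $\mathcal I_l=[k_{2l+1},k_{2l}]\cap\mathbb Z$. Let $j\in\{1,\ldots,2q+1\}$. If $j$ is odd assume $k_j<k_{j-1}$, and if $j$ is even assume $k_j+1<k_{j-1}$. Let $\mathcal I^*$ be the set obtained from $\mathcal I$ by replacing $k_j$ by $k_j+1$, i.e. $\mathcal I^*=\mathcal I\setminus\{k_j\}$ if $j$ is odd and $\mathcal I^*=\mathcal I\cup\{k_j+1\}$ if $j$ is even. Then $$\frac{F_N^{m,\mathcal I^*}(a)}{F_N^{m,\mathcal I}(a)}=a_{m-k_j-\epsilon_j}+1\quad\text{if }\epsilon=1,\qquad\frac{\tilde F_N^{m,\mathcal I^*}(a)}{\tilde F_N^{m,\mathcal I}(a)}=a_{m-k_j-\epsilon_j}+1\quad\text{if }\epsilon=0,$$ where $\epsilon_l=0$ for $l$ odd and $\epsilon_l=1$ for $l$ even, and where $a_{m-k_j-\epsilon_j}$ is determined by solving the following linear system, whose unknowns are a polynomial $q_{k_1-1}$ of degree at most $k_1-1$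 and coefficients $a_0,\ldots,a_{m-k_{2q+1}}$ (the system determines $q_{k_1-1}$ and $a_0,\ldots,a_{m-k_{2q+1}}$ uniquely): $$\zeta^{m-k_1}(1-a\zeta)^{N-m+\epsilon}q_{k_1-1}(\zeta)-\sum_{i\in\mathcal I'}a_{m-i}\zeta^{m-i}+(-1)^j\zeta^{m-k_j-\epsilon_j}=O((\zeta+a)^m),\qquad\zeta\to-a,$$ $$(1-a\zeta)^{N-m+\epsilon}q_{k_1-1}(\zeta)+\sum_{i\in\mathcal J}a_{m-i}\zeta^{k_1-i}+(-1)^j\zeta^{k_1-k_j-\epsilon_j}=O(\zeta^{k_1-k_{2q+1}+1}),\qquad\zeta\to0,$$ with $\mathcal I'=\mathcal I\cap\{1,2,\ldots,m\}$ and $\mathcal J=\bigcup_{l=1}^q\{k_{2l}+1,\ldots,k_{2l-1}-1\}$.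
   Context: Notation: $a$ without index is the weight of vertical dominoes; $a_0,a_1,\ldots$ with an index are the unknown coefficients of the linear system. Aztec diamond and dominoes. The Aztec diamond $A_N$ is the union of all unit squares $[i,i+1]\times[l,l+1]$, $i,l\in\mathbb Z$, contained in $\{|x|+|y|\leq N+1\}$. A domino is a rectangle $[i,i+2]\times[l,l+1]$ (horizontal; called north if $i+l+N$ is even, south if odd) or $[i,i+1]\times[l,l+2]$ (vertical; called east if $i+l+N$ is even, west if odd), $i,l\in\mathbb Z$. A domino tiling of $A_N$ is a collection of dominoes with disjoint interiors whose union is $A_N$; $v(T)$ is the number of vertical dominoes of $T$. Paths and particles. Given a domino tiling of $A_N$, draw on each south domino $[x,x+2]\times[y,y+1]$ the segment from $(x,y+\frac12)$ to $(x+2,y+\frac12)$; on each west domino $[x,x+1]\times[y,y+2]$ the segment from $(x,y+\frac12)$ to $(x+1,y+\frac32)$; on each east domino $[x,x+1]\times[y,y+2]$ the segment from $(x,y+\frac32)$ to $(x+1,y+\frac12)$; nothing on north dominoes. These segments form $N$ non-intersecting paths, the $(l+1)$-th one ($l=0,\ldots,N-1$) going from $(-N+l,-l-\frac12)$ to $(N-l,-l-\frac12)$. Transform the $(l+1)$-th path into a path on $\{0,1,\ldots,2N\}\times\mathbb Z$ starting at $(0,-l)$ by replacing successively each ascending segment by the two steps $(\alpha,\beta)\to(\alpha+1,\beta+1)\to(\alpha+2,\beta+1)$, each horizontal segment by $(\alpha,\beta)\to(\alpha+1,\beta)\to(\alpha+2,\beta)$, and each descending segment by the down-step $(\alpha,\beta)\to(\alpha,\beta-1)$;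 this reaches $(2N-2l,-l)$, and is completed by horizontal steps to $(2N,-l)$. Mark every lattice point $(\alpha,\beta)\in\{0,\ldots,2N\}\times\mathbb Z$ on the paths except the starting points of down-steps. Each path then has exactly one marked point on each line $\{r\}\times\mathbb Z$; the second coordinates $\beta$ of the $N$ marked points $(r,\beta)$ are the particles at level $r$. Generating functions. The reduced Aztec diamonds $A_N^{m,\mathcal I}$ (for $\epsilon=1$) and $\tilde A_N^{m,\mathcal I}$ (for $\epsilon=0$) are obtained from $A_N$ by requiring that there be no particles in $\mathcal I$ at level $2m-\epsilon$; their tilings correspond to the tilings of $A_N$ with this property (the removed parts being covered by north dominoes, which do not contribute to $v(T)$). Thus $$F_N^{m,\mathcal I}(a)=\sum_Ta^{v(T)}\quad(\epsilon=1),\qquad\tilde F_N^{m,\mathcal I}(a)=\sum_Ta^{v(T)}\quad(\epsilon=0),$$ where in each case the sum runs over all domino tilings $T$ of $A_N$ for which no particle at level $2m-\epsilon$ belongs to $\mathcal I$; and similarly for $\mathcal I^*$.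
   Formalization: The set I' is taken as I∩(-∞,m] instead of I∩{1,...,m}; the two agree when k_{2q+1}≥1, and for k_{2q+1}≤0 the printed system leaves a_{m-k_{2q+1}} undetermined, so the claimed uniqueness fails. *)

theory Defs
  imports
    "HOL-Analysis.Analysis"
    "HOL-Library.Landau_Symbols"
    "HOL-Library.FuncSet"
    "HOL-Computational_Algebra.Polynomial"
begin

subsection \<open>Aztec diamond and domino tilings\<close>

definition unit_square :: "int \<Rightarrow> int \<Rightarrow> (real \<times> real) set" where
  "unit_square i l = {of_int i..of_int i + 1} \<times> {of_int l..of_int l + 1}"

definition aztec_diamond :: "nat \<Rightarrow> (real \<times> real) set" where
  "aztec_diamond N =
     \<Union>{unit_square i l | i l. unit_square i l \<subseteq> {(x, y). \<bar>x\<bar> + \<bar>y\<bar> \<le> real N + 1}}"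

datatype domino = Horizontal int int | Vertical int int

fun region :: "domino \<Rightarrow> (real \<times> real) set" where
  "region (Horizontal i l) = {of_int i..of_int i + 2} \<times> {of_int l..of_int l + 1}"
| "region (Vertical i l) = {of_int i..of_int i + 1} \<times> {of_int l..of_int l + 2}"

definition north :: "nat \<Rightarrow> domino \<Rightarrow> bool" where
  "north N d \<longleftrightarrow> (\<exists>i l. d = Horizontal i l \<and> even (i + l + int N))"

definition south :: "nat \<Rightarrow> domino \<Rightarrow> bool" where
  "south N d \<longleftrightarrow> (\<exists>i l. d = Horizontal i l \<and> odd (i + l + int N))"

definition east :: "nat \<Rightarrow> domino \<Rightarrow> bool" where
  "east N d \<longleftrightarrow> (\<exists>i l. d = Vertical i l \<and> even (i + l + int N))"

definition west :: "nat \<Rightarrow> domino \<Rightarrow> bool" where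
  "west N d \<longleftrightarrow> (\<exists>i l. d = Vertical i l \<and> odd (i + l + int N))"

definition domino_tiling :: "nat \<Rightarrow> domino set \<Rightarrow> bool" where
  "domino_tiling N T \<longleftrightarrow>
     pairwise (\<lambda>d d'. interior (region d) \<inter> interior (region d') = {}) T \<and>
     (\<Union>d\<in>T. region d) = aztec_diamond N"

definition num_vertical :: "domino set \<Rightarrow> nat" where
  "num_vertical T = card {d \<in> T. \<exists>i l. d = Vertical i l}"

subsection \<open>Paths and particles\<close>

datatype segment = Ascending | Level | Descending

text \<open>
  All segments have end points with integer abscissa and half-integer ordinate; the pair of
  integers \<open>(x, y)\<close> below stands for the point with coordinates \<open>x\<close> and \<open>y + 1/2\<close>.
  \<open>drawn_path N T p ss p'\<close> says that consecutive segments of the kinds \<open>ss\<close>, all of them drawn on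
  dominoes of \<open>T\<close>, lead from \<open>p\<close> to \<open>p'\<close>. The descending segment on \<open>Vertical x l\<close> starts at
  ordinate \<open>l + 3/2\<close>, hence the shift \<open>l = y - 1\<close>.
\<close>

fun drawn_path :: "nat \<Rightarrow> domino set \<Rightarrow> int \<times> int \<Rightarrow> segment list \<Rightarrow> int \<times> int \<Rightarrow> bool" where
  "drawn_path N T p [] p' \<longleftrightarrow> p = p'"
| "drawn_path N T (x, y) (Level # ss) p' \<longleftrightarrow>
     Horizontal x y \<in> T \<and> south N (Horizontal x y) \<and> drawn_path N T (x + 2, y) ss p'"
| "drawn_path N T (x, y) (Ascending # ss) p' \<longleftrightarrow>
     Vertical x y \<in> T \<and> west N (Vertical x y) \<and> drawn_path N T (x + 1, y + 1) ss p'"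
| "drawn_path N T (x, y) (Descending # ss) p' \<longleftrightarrow>
     Vertical x (y - 1) \<in> T \<and> east N (Vertical x (y - 1)) \<and> drawn_path N T (x + 1, y - 1) ss p'"

text \<open>The path from \<open>(- N + l, - l - 1/2)\<close> to \<open>(N - l, - l - 1/2)\<close>, for \<open>l = 0, \<dots>, N - 1\<close>.\<close>

definition tiling_path :: "nat \<Rightarrow> domino set \<Rightarrow> nat \<Rightarrow> segment list \<Rightarrow> bool" where
  "tiling_path N T l ss \<longleftrightarrow>
     drawn_path N T (- int N + int l, - int l - 1) ss (int N - int l, - int l - 1)"

text \<open>
  The marked points of the transformed path starting at a given point of \<open>\<int>\<^sup>2\<close>: every lattice point
  on it, the intermediate points of the ascending and horizontal double steps included, except
  the starting points of down-steps.
\<close>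

fun marked_points :: "int \<times> int \<Rightarrow> segment list \<Rightarrow> (int \<times> int) set" where
  "marked_points p [] = {p}"
| "marked_points (\<alpha>, \<beta>) (Ascending # ss) =
     {(\<alpha>, \<beta>), (\<alpha> + 1, \<beta> + 1)} \<union> marked_points (\<alpha> + 2, \<beta> + 1) ss"
| "marked_points (\<alpha>, \<beta>) (Level # ss) =
     {(\<alpha>, \<beta>), (\<alpha> + 1, \<beta>)} \<union> marked_points (\<alpha> + 2, \<beta>) ss"
| "marked_points (\<alpha>, \<beta>) (Descending # ss) = marked_points (\<alpha>, \<beta> - 1) ss"

text \<open>The second set is the completion by horizontal steps up to the line with abscissa \<open>2 N\<close>.\<close>

definition path_particles :: "nat \<Rightarrow> nat \<Rightarrow> segment list \<Rightarrow> (int \<times> int) set" where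
  "path_particles N l ss =
     marked_points (0, - int l) ss \<union> {2 * int N - 2 * int l..2 * int N} \<times> {- int l}"

definition particles :: "nat \<Rightarrow> domino set \<Rightarrow> int \<Rightarrow> int set" where
  "particles N T r = {\<beta>. \<exists>l<N. \<exists>ss. tiling_path N T l ss \<and> (r, \<beta>) \<in> path_particles N l ss}"

subsection \<open>Generating functions\<close>

definition F_odd :: "nat \<Rightarrow> nat \<Rightarrow> int set \<Rightarrow> real \<Rightarrow> real" where
  "F_odd N m I a =
     (\<Sum>T | domino_tiling N T \<and> particles N T (2 * int m - 1) \<inter> I = {}. a ^ num_vertical T)"

definition F_even :: "nat \<Rightarrow> nat \<Rightarrow> int set \<Rightarrow> real \<Rightarrow> real" where
  "F_even N m I a =
     (\<Sum>T | domino_tiling N T \<and> particles N T (2 * int m) \<inter> I = {}. a ^ num_vertical T)"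

subsection \<open>The index sets and the linear system\<close>

text \<open>The value \<open>k 0\<close> plays no role; the convention that it is infinite is built into \<open>segment_I k 0\<close>.\<close>

definition segment_I :: "(nat \<Rightarrow> int) \<Rightarrow> nat \<Rightarrow> int set" where
  "segment_I k l = (if l = 0 then {k 1..} else {k (2 * l + 1)..k (2 * l)})"

definition set_I :: "nat \<Rightarrow> (nat \<Rightarrow> int) \<Rightarrow> int set" where
  "set_I q k = (\<Union>l\<le>q. segment_I k l)"

definition set_J :: "nat \<Rightarrow> (nat \<Rightarrow> int) \<Rightarrow> int set" where
  "set_J q k = (\<Union>l\<in>{1..q}. {k (2 * l) + 1..k (2 * l - 1) - 1})"

text \<open>
  \<open>set_I q k \<inter> {..m}\<close> is \<open>set_I q k \<inter> {1..m}\<close> whenever \<open>k (2 * q + 1) \<ge> 1\<close>. Nonpositive elements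
  have to be kept: together with \<open>set_J q k\<close> this set partitions \<open>{k (2 * q + 1)..m}\<close>, so that each
  unknown coefficient occurs in exactly one of the two sums. Without them the system is in
  general unsolvable, e.g. for \<open>N = m = 2\<close>, \<open>\<epsilon> = 1\<close>, \<open>q = 1\<close>, \<open>(k\<^sub>1, k\<^sub>2, k\<^sub>3) = (2, 0, 0)\<close>, \<open>j = 1\<close>.
\<close>

definition set_I' :: "nat \<Rightarrow> nat \<Rightarrow> (nat \<Rightarrow> int) \<Rightarrow> int set" where
  "set_I' m q k = set_I q k \<inter> {..int m}"

definition parity_shift :: "nat \<Rightarrow> int" where
  "parity_shift l = (if odd l then 0 else 1)"

text \<open>
  All integer exponents below are nonnegative under the hypotheses of the theorem. The
  coefficients are a function on \<open>{0..m - k (2 * q + 1)}\<close>, fixed to be \<^term>\<open>undefined\<close> elsewhere.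
\<close>

definition linear_system ::
  "nat \<Rightarrow> nat \<Rightarrow> nat \<Rightarrow> real \<Rightarrow> nat \<Rightarrow> (nat \<Rightarrow> int) \<Rightarrow> nat \<Rightarrow> complex poly \<Rightarrow> (int \<Rightarrow> complex) \<Rightarrow> bool"
where
  "linear_system N m \<epsilon> a q k j p c \<longleftrightarrow>
     int (degree p) \<le> k 1 - 1 \<and>
     c \<in> {0..int m - k (2 * q + 1)} \<rightarrow>\<^sub>E UNIV \<and>
     (\<lambda>\<zeta>. \<zeta> powi (int m - k 1) * (1 - of_real a * \<zeta>) ^ (N - m + \<epsilon>) * poly p \<zeta>
         - (\<Sum>i\<in>set_I' m q k. c (int m - i) * \<zeta> powi (int m - i))
         + (- 1) ^ j * \<zeta> powi (int m - k j - parity_shift j))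
       \<in> O[at (- of_real a)](\<lambda>\<zeta>. (\<zeta> + of_real a) ^ m) \<and>
     (\<lambda>\<zeta>. (1 - of_real a * \<zeta>) ^ (N - m + \<epsilon>) * poly p \<zeta>
         + (\<Sum>i\<in>set_J q k. c (int m - i) * \<zeta> powi (k 1 - i))
         + (- 1) ^ j * \<zeta> powi (k 1 - k j - parity_shift j))
       \<in> O[at 0](\<lambda>\<zeta>. \<zeta> powi (k 1 - k (2 * q + 1) + 1))"

end

theory Submission
  imports Defs
begin

text \<open>
  Reading the cells of the diamond along antidiagonals, a tiling becomes a sequence of particle sets
  in which the even-to-odd steps move each particle by \<open>0\<close> or \<open>1\<close>, while the odd-to-even steps do the
  same for the holes. Adding one cell at a time shows that both steps are products of elementary
  two-site operators, which act on the exterior algebra; on coefficient sequences they amount to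
  multiplication by \<open>\<zeta> + a\<close> and division by \<open>1 - a \<zeta>\<close>. Hence the left part of the diamond is a
  functional of the particle set annihilated by every multiple of \<open>(\<zeta> + a)\<^sup>m\<close>, and the right part by
  every multiple of \<open>(1 - a \<zeta>) ^ (N - m + \<epsilon>)\<close>. With positions \<open>i\<close> encoded by \<open>h = m - i\<close>, a
  solution of the linear system is a polynomial of the second kind whose difference to the unknown
  sum over \<open>I\<close> is of the first kind; contracting the corresponding relations in the exterior
  algebra yields the ratio, and the same identity shows that the homogeneous (square) system has only
  the trivial solution.
\<close>

subsection \<open>Weighted sums over exact covers\<close>

text \<open>The exterior algebra fits because occupation is exclusive: for a two-site move with both
  sites occupied, the domino weight equals the determinant of the corresponding linear map.
  Many-particle sums are therefore governed by one-particle data, namely polynomials of degree at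
  most \<open>M\<close>, where \<open>M + 1\<close> is the number of sites at the cut. The
  polynomials killed on the left and on the right form spaces of dimensions \<open>n\<close> and
  \<open>m\<close> with \<open>m + n = M + 1\<close>. Forbidding one more site \<open>h\<close> is a
  rank-one change. If a polynomial of the left kind and one of the right kind agree off the
  forbidden set except at \<open>h\<close>, the quotient of the two sums can be read off from their
  values at \<open>h\<close>. Every such argument divides by the sum belonging to \<open>I\<close>,
  so its positivity gives both a meaningful ratio and unique solvability. Positivity is proved over
  the reals by exhibiting one admissible history of the particles. This is where the lower bound on
  \<open>k 1\<close> enters: it says that the forbidden sites leave enough free sites for all
  particles of the level.\<close>

fun cells :: "domino \<Rightarrow> (int \<times> int) set" where
  "cells (Horizontal i l) = {(i, l), (i + 1, l)}"
| "cells (Vertical i l) = {(i, l), (i, l + 1)}"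

fun weight :: "'a \<Rightarrow> domino \<Rightarrow> 'a::comm_ring_1" where
  "weight a (Horizontal i l) = 1"
| "weight a (Vertical i l) = a"

definition exact_cover :: "(int \<times> int) set \<Rightarrow> domino set \<Rightarrow> bool" where
  "exact_cover C T \<longleftrightarrow> \<Union>(cells ` T) = C \<and> (\<forall>d\<in>T. \<forall>d'\<in>T. d \<noteq> d' \<longrightarrow> cells d \<inter> cells d' = {})"

text \<open>The allowed dominoes \<open>D\<close> are kept apart from the region \<open>C\<close>:
  recursions add dominoes to \<open>D\<close> one at a time, and a gap condition on particles
  becomes a deletion from \<open>D\<close>.\<close>

definition cover_sum :: "'a \<Rightarrow> domino set \<Rightarrow> (int \<times> int) set \<Rightarrow> 'a::comm_ring_1" where
  "cover_sum a D C = (\<Sum>T | T \<subseteq> D \<and> exact_cover C T. a ^ num_vertical T)"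

lemma exact_cover_cells: "exact_cover C T \<Longrightarrow> d \<in> T \<Longrightarrow> cells d \<subseteq> C"
  unfolding exact_cover_def by blast

lemma exact_cover_insert:
  assumes "d \<notin> T" "cells d \<subseteq> C"
  shows "exact_cover C (insert d T) \<longleftrightarrow> exact_cover (C - cells d) T"
proof
  assume *: "exact_cover C (insert d T)"
  with assms(1) have "\<forall>d'\<in>T. cells d' \<inter> cells d = {}"
    unfolding exact_cover_def by (metis inf_commute insertCI)
  moreover have "\<Union>(cells ` T) \<union> cells d = C" using * unfolding exact_cover_def by auto
  ultimately have "\<Union>(cells ` T) = C - cells d" by blast
  with * show "exact_cover (C - cells d) T"
    unfolding exact_cover_def by simp
next
  assume "exact_cover (C - cells d) T"
  then have *: "\<Union>(cells ` T) = C - cells d"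
      "\<forall>d\<in>T. \<forall>d'\<in>T. d \<noteq> d' \<longrightarrow> cells d \<inter> cells d' = {}"
    unfolding exact_cover_def by auto
  then have "cells d' \<inter> cells d = {}" if "d' \<in> T" for d' using that by blast
  moreover have "\<Union>(cells ` insert d T) = C" using *(1) assms(2) by auto
  ultimately show "exact_cover C (insert d T)"
    using *(2) unfolding exact_cover_def by (metis inf_commute insertE)
qed

lemma num_vertical_insert:
  assumes "finite T" "d \<notin> T"
  shows "a ^ num_vertical (insert d T) = weight a d * a ^ num_vertical T"
proof (cases d)
  case (Horizontal i l)
  then have "{d' \<in> insert d T. \<exists>i l. d' = Vertical i l} = {d' \<in> T. \<exists>i l. d' = Vertical i l}"
    by auto
  with Horizontal show ?thesis by (simp add: num_vertical_def)
next
  case (Vertical i l)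
  then have "{d' \<in> insert d T. \<exists>i l. d' = Vertical i l} = insert d {d' \<in> T. \<exists>i l. d' = Vertical i l}"
    by auto
  with Vertical assms show ?thesis by (simp add: num_vertical_def)
qed

lemma cover_sum_insert:
  assumes "finite D" "d \<notin> D" "cells d \<subseteq> C"
  shows "cover_sum a (insert d D) C = cover_sum a D C + weight a d * cover_sum a D (C - cells d)"
proof -
  let ?X = "{T. T \<subseteq> D \<and> exact_cover C T}"
  let ?Y = "{T. T \<subseteq> D \<and> exact_cover (C - cells d) T}"
  have "{T. T \<subseteq> insert d D \<and> exact_cover C T} = ?X \<union> insert d ` ?Y" (is "?L = ?R")
  proof (intro equalityI subsetI)
    fix T assume T: "T \<in> ?L"
    show "T \<in> ?R"
    proof (cases "d \<in> T")
      case True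
      then have "insert d (T - {d}) = T" by auto
      moreover have "T - {d} \<in> ?Y"
        using T exact_cover_insert[of d "T - {d}" C] assms calculation by auto
      ultimately show ?thesis by (intro UnI2 image_eqI[of _ _ "T - {d}"]) simp_all
    qed (use T in auto)
  next
    fix T assume "T \<in> ?R"
    then show "T \<in> ?L"
      using exact_cover_insert[of d _ C] assms by auto
  qed
  moreover have "finite ?X" "finite ?Y"
    using assms(1) by simp_all
  moreover have "?X \<inter> insert d ` ?Y = {}" using assms(2) by blast
  moreover have "inj_on (insert d) ?Y"
  proof (rule inj_onI)
    fix T T' assume "T \<in> ?Y" "T' \<in> ?Y" and eq: "insert d T = insert d T'"
    then have "d \<notin> T" "d \<notin> T'" using assms(2) by auto
    with eq show "T = T'" by (simp add: insert_ident)
  qed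
  ultimately have "cover_sum a (insert d D) C =
      cover_sum a D C + (\<Sum>T\<in>?Y. a ^ num_vertical (insert d T))"
    by (simp add: cover_sum_def sum.union_disjoint sum.reindex)
  also have "(\<Sum>T\<in>?Y. a ^ num_vertical (insert d T)) = (\<Sum>T\<in>?Y. weight a d * a ^ num_vertical T)"
    using assms by (intro sum.cong refl num_vertical_insert) (auto intro: finite_subset)
  finally show ?thesis by (simp add: cover_sum_def sum_distrib_left)
qed

lemma cover_sum_irrelevant:
  assumes "\<not> cells d \<subseteq> C"
  shows "cover_sum a (insert d D) C = cover_sum a D C"
proof -
  have "T \<subseteq> insert d D \<longleftrightarrow> T \<subseteq> D" if "exact_cover C T" for T
    using assms exact_cover_cells[OF that] by blast
  then have "{T. T \<subseteq> insert d D \<and> exact_cover C T} = {T. T \<subseteq> D \<and> exact_cover C T}"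
    by blast
  then show ?thesis by (simp add: cover_sum_def)
qed

lemma cover_sum_uncovered:
  assumes "c \<in> C" "\<And>d. d \<in> D \<Longrightarrow> c \<notin> cells d"
  shows "cover_sum a D C = 0"
proof -
  have "\<not> (T \<subseteq> D \<and> exact_cover C T)" for T
    using assms unfolding exact_cover_def by blast
  then show ?thesis by (auto simp: cover_sum_def intro: sum.neutral)
qed

lemma cover_sum_cong:
  assumes "\<And>d. cells d \<subseteq> C \<Longrightarrow> d \<in> D \<longleftrightarrow> d \<in> D'"
  shows "cover_sum a D C = cover_sum a D' C"
proof -
  have "T \<subseteq> D \<longleftrightarrow> T \<subseteq> D'" if "exact_cover C T" for T
    using assms exact_cover_cells[OF that] by blast
  then have "{T. T \<subseteq> D \<and> exact_cover C T} = {T. T \<subseteq> D' \<and> exact_cover C T}"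
    by blast
  then show ?thesis by (simp add: cover_sum_def)
qed

lemma cover_sum_empty: "cover_sum a {} C = (if C = {} then 1 else 0)"
proof -
  have "{T. T \<subseteq> {} \<and> exact_cover C T} = (if C = {} then {{}} else {})"
    by (auto simp: exact_cover_def)
  then show ?thesis by (simp add: cover_sum_def num_vertical_def)
qed

subsection \<open>Antisymmetric calculus on functions of finite sets\<close>

text \<open>Sign of moving the basis vector of \<open>x\<close> to the front when the elements of
  \<open>S\<close> are listed increasingly.\<close>

definition inv_sign :: "nat set \<Rightarrow> nat \<Rightarrow> 'a::comm_ring_1" where
  "inv_sign S x = (- 1) ^ card {y \<in> S. y < x}"

text \<open>With \<open>f S\<close> read as the coefficient of the basis monomial of
  \<open>S\<close>, this is exterior multiplication by the vector \<open>v\<close>. On infinite sets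
  the sum is 0 by convention, which is why later identities are restricted to finite sets.\<close>

definition wedge :: "(nat \<Rightarrow> 'a) \<Rightarrow> (nat set \<Rightarrow> 'a) \<Rightarrow> nat set \<Rightarrow> 'a::comm_ring_1" where
  "wedge v f S = (\<Sum>x\<in>S. inv_sign S x * v x * f (S - {x}))"

text \<open>Interior product with the dual basis vector of \<open>h\<close>.\<close>

definition contract :: "nat \<Rightarrow> (nat set \<Rightarrow> 'a) \<Rightarrow> nat set \<Rightarrow> 'a::comm_ring_1" where
  "contract h f S = (if h \<in> S then 0 else inv_sign S h * f (insert h S))"

definition avoid :: "nat set \<Rightarrow> (nat set \<Rightarrow> 'a) \<Rightarrow> nat set \<Rightarrow> 'a::comm_ring_1" where
  "avoid E f S = (if S \<inter> E = {} then f S else 0)"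

text \<open>Exterior power of the linear map \<open>hop_vec\<close>, which sends the basis vector of
  \<open>x\<close> to \<open>s\<close> times itself plus \<open>t\<close> times that of
  \<open>Suc x\<close> and fixes the others. With both sites occupied only the determinant
  \<open>s\<close> survives, so the first branch covers that case too.\<close>

definition hop :: "'a \<Rightarrow> 'a \<Rightarrow> nat \<Rightarrow> (nat set \<Rightarrow> 'a) \<Rightarrow> nat set \<Rightarrow> 'a::comm_ring_1" where
  "hop s t x f S =
     (if x \<in> S then s * f S
      else if Suc x \<in> S then f S + t * f (insert x (S - {Suc x})) else f S)"

definition hop_vec :: "'a \<Rightarrow> 'a \<Rightarrow> nat \<Rightarrow> (nat \<Rightarrow> 'a) \<Rightarrow> nat \<Rightarrow> 'a::comm_ring_1" where
  "hop_vec s t x v = v(x := s * v x, Suc x := v (Suc x) + t * v x)"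

lemma inv_sign_square [simp]: "inv_sign S x * inv_sign S x = (1 :: 'a::comm_ring_1)"
  by (simp add: inv_sign_def flip: power_add)

lemma inv_sign_cong: "(\<And>y. y < x \<Longrightarrow> y \<in> S \<longleftrightarrow> y \<in> S') \<Longrightarrow> inv_sign S x = inv_sign S' x"
  unfolding inv_sign_def by (metis (mono_tags, lifting) Collect_cong)

lemma inv_sign_insert:
  assumes "finite S" "y \<notin> S"
  shows "inv_sign (insert y S) x = (if y < x then - inv_sign S x else (inv_sign S x :: 'a::comm_ring_1))"
proof -
  have "{z \<in> insert y S. z < x} = (if y < x then insert y {z \<in> S. z < x} else {z \<in> S. z < x})"
    by auto
  then show ?thesis using assms by (simp add: inv_sign_def)
qed

lemma inv_sign_Suc:
  assumes "finite S" "x \<notin> S"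
  shows "inv_sign S (Suc x) = (inv_sign S x :: 'a::comm_ring_1)"
proof -
  have "{y \<in> S. y < Suc x} = {y \<in> S. y < x}"
    using assms less_Suc_eq by auto
  then show ?thesis by (simp add: inv_sign_def)
qed

lemma wedge_infinite: "infinite S \<Longrightarrow> wedge v f S = 0"
  by (simp add: wedge_def)

lemma wedge_empty [simp]: "wedge v f {} = 0"
  by (simp add: wedge_def)

lemma wedge_remove:
  assumes "finite S" "x \<in> S"
  shows "wedge v f S = inv_sign S x * v x * f (S - {x}) + (\<Sum>y\<in>S - {x}. inv_sign S y * v y * f (S - {y}))"
  using assms by (simp add: wedge_def sum.remove)

text \<open>Functoriality of exterior powers, checked according to the occupation of the two sites
  involved.\<close>

lemma hop_wedge: "hop s t x (wedge v f) = wedge (hop_vec s t x v) (hop s t x f)"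
proof
  fix S
  let ?v = "hop_vec s t x v" and ?f = "hop s t x f"
  consider "infinite S" | "finite S" "x \<in> S" "Suc x \<in> S" | "finite S" "x \<in> S" "Suc x \<notin> S"
    | "finite S" "x \<notin> S" "Suc x \<in> S" | "finite S" "x \<notin> S" "Suc x \<notin> S" by blast
  then show "hop s t x (wedge v f) S = wedge ?v ?f S"
  proof cases
    case 1
    then show ?thesis by (simp add: hop_def wedge_infinite)
  next
    case 2
    define R where "R = S - {x, Suc x}"
    have R: "S = insert x (insert (Suc x) R)" "x \<notin> R" "Suc x \<notin> R" "finite R"
      using 2 by (auto simp: R_def)
    let ?g = "\<lambda>v f y. inv_sign S y * v y * f (S - {y})"
    have split: "wedge v f S = ?g v f x + ?g v f (Suc x) + (\<Sum>y\<in>R. ?g v f y)" for v f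
      using R unfolding wedge_def by (simp add: add.assoc)
    \<comment> \<open>Removing \<open>x\<close> and removing \<open>Suc x\<close> carry opposite
      signs, so the two contributions with the factor \<open>t\<close> cancel.\<close>
    have "inv_sign S (Suc x) = (- inv_sign S x :: 'a)"
      using R by (simp add: inv_sign_insert inv_sign_Suc)
    moreover have "?f (S - {x}) = f (S - {x}) + t * f (S - {Suc x})"
    proof -
      have "insert x (S - {x} - {Suc x}) = S - {Suc x}" using 2 by auto
      then show ?thesis using 2 by (simp add: hop_def)
    qed
    moreover have "?f (S - {Suc x}) = s * f (S - {Suc x})"
      using 2 by (simp add: hop_def)
    moreover have "(\<Sum>y\<in>R. ?g ?v ?f y) = s * (\<Sum>y\<in>R. ?g v f y)"
      unfolding sum_distrib_left using R
      by (intro sum.cong refl) (auto simp: hop_def hop_vec_def algebra_simps)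
    ultimately show ?thesis
      using 2 by (simp add: split hop_def[of s t x "wedge v f"]) (simp add: hop_vec_def algebra_simps)
  next
    case 3
    then have "(\<Sum>y\<in>S - {x}. inv_sign S y * ?v y * ?f (S - {y})) = s * (\<Sum>y\<in>S - {x}. inv_sign S y * v y * f (S - {y}))"
      unfolding sum_distrib_left
      by (intro sum.cong refl) (auto simp: hop_def hop_vec_def algebra_simps)
    with 3 show ?thesis
      by (simp add: wedge_remove[of S x] hop_def[of s t x "wedge v f"])
        (simp add: hop_def hop_vec_def algebra_simps)
  next
    case 4
    define R where "R = S - {Suc x}"
    have R: "S = insert (Suc x) R" "x \<notin> R" "Suc x \<notin> R" "finite R"
      using 4 by (auto simp: R_def)
    let ?S = "insert x R"
    have S': "insert x (S - {Suc x}) = ?S" "?S - {x} = R" "S - {Suc x} = R" using R by auto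
    have "inv_sign ?S x = (inv_sign S (Suc x) :: 'a)"
      using R by (simp add: inv_sign_insert inv_sign_Suc)
    moreover have "(\<Sum>y\<in>R. inv_sign S y * ?v y * ?f (S - {y})) =
       (\<Sum>y\<in>R. inv_sign S y * v y * f (S - {y})) + t * (\<Sum>y\<in>R. inv_sign ?S y * v y * f (?S - {y}))"
      unfolding sum_distrib_left sum.distrib[symmetric]
    proof (intro sum.cong refl)
      fix y assume y: "y \<in> R"
      then have "y \<noteq> x" "y \<noteq> Suc x" using R by auto
      moreover have "insert x (S - {y} - {Suc x}) = ?S - {y}" using R calculation by auto
      moreover have "inv_sign ?S y = (inv_sign S y :: 'a)"
        using R calculation by (auto simp: inv_sign_insert)
      ultimately show "inv_sign S y * ?v y * ?f (S - {y}) =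
        inv_sign S y * v y * f (S - {y}) + t * (inv_sign ?S y * v y * f (?S - {y}))"
        using 4 by (simp add: hop_def hop_vec_def algebra_simps)
    qed
    moreover have "?f R = f R" using R by (simp add: hop_def)
    moreover have "wedge ?v ?f S = inv_sign S (Suc x) * ?v (Suc x) * ?f R + (\<Sum>y\<in>R. inv_sign S y * ?v y * ?f (S - {y}))"
      "wedge v f S = inv_sign S (Suc x) * v (Suc x) * f R + (\<Sum>y\<in>R. inv_sign S y * v y * f (S - {y}))"
      using wedge_remove[of S "Suc x"] 4 unfolding S' by auto
    moreover have "wedge v f ?S = inv_sign ?S x * v x * f R + (\<Sum>y\<in>R. inv_sign ?S y * v y * f (?S - {y}))"
      using wedge_remove[of ?S x] R unfolding S' by auto
    moreover have "hop s t x (wedge v f) S = wedge v f S + t * wedge v f ?S"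
      using 4 unfolding hop_def S' by simp
    moreover have "?v (Suc x) = v (Suc x) + t * v x" by (simp add: hop_vec_def)
    ultimately show ?thesis by (simp only:) (simp add: algebra_simps)
  next
    case 5
    then show ?thesis unfolding wedge_def hop_def[of s t x "\<lambda>S. sum _ S"]
      by (auto simp: wedge_def hop_def hop_vec_def intro!: sum.cong)
  qed
qed

text \<open>\<open>avoid E\<close> is the exterior power of the coordinate projection that kills
  \<open>E\<close>.\<close>

lemma avoid_wedge: "avoid E (wedge v f) = wedge (\<lambda>x. if x \<in> E then 0 else v x) (avoid E f)"
proof
  fix S
  show "avoid E (wedge v f) S = wedge (\<lambda>x. if x \<in> E then 0 else v x) (avoid E f) S"
  proof (cases "S \<inter> E = {}")
    case True
    then show ?thesis unfolding avoid_def wedge_def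
      by (auto intro!: sum.cong)
  next
    case False
    then obtain z where z: "z \<in> S" "z \<in> E" by auto
    then have "(if x \<in> E then 0 else v x) * avoid E f (S - {x}) = 0" for x
      by (auto simp: avoid_def)
    then have "wedge (\<lambda>x. if x \<in> E then 0 else v x) (avoid E f) S = 0"
      unfolding wedge_def by (simp add: mult.assoc)
    with False show ?thesis by (simp add: avoid_def)
  qed
qed

text \<open>The canonical anticommutation relation. For \<open>h\<close> outside \<open>S\<close>
  each summand changes sign, because the presence of one of \<open>h\<close> and \<open>y\<close>
  flips the sign attached to the larger of the two.\<close>

lemma contract_wedge:
  assumes "finite S"
  shows "contract h (wedge v f) S = v h * f S - wedge v (contract h f) S"
proof (cases "h \<in> S")
  case True
  have "(\<Sum>y\<in>S - {h}. inv_sign S y * v y * contract h f (S - {y})) = 0"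
    using True by (intro sum.neutral) (auto simp: contract_def)
  moreover have "inv_sign (S - {h}) h = (inv_sign S h :: 'a)"
    by (rule inv_sign_cong) auto
  moreover have "inv_sign S h * v h * (inv_sign S h * f S) = v h * f S"
    by (metis inv_sign_square mult.assoc mult.commute mult_1)
  ultimately show ?thesis
    using True assms by (simp add: wedge_remove[of S h] contract_def insert_absorb)
next
  case False
  have *: "inv_sign S h * (inv_sign (insert h S) y * v y * f (insert h S - {y})) =
        - (inv_sign S y * v y * contract h f (S - {y}))" if y: "y \<in> S" for y
  proof -
    have ne: "y \<noteq> h" using y False by auto
    then have "insert h S - {y} = insert h (S - {y})" by auto
    moreover have "inv_sign S h = (if y < h then - 1 else 1 :: 'a) * inv_sign (S - {y}) h"
      using inv_sign_insert[of "S - {y}" y h, where 'a='a] y assms by (simp add: insert_absorb)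
    moreover have "inv_sign (insert h S) y = (if h < y then - 1 else 1 :: 'a) * inv_sign S y"
      using inv_sign_insert[of S h y, where 'a='a] False assms by simp
    ultimately show ?thesis using ne False by (auto simp: contract_def algebra_simps)
  qed
  have "contract h (wedge v f) S = inv_sign S h * (inv_sign (insert h S) h * v h * f S +
     (\<Sum>y\<in>S. inv_sign (insert h S) y * v y * f (insert h S - {y})))"
    using False assms by (simp add: contract_def wedge_def)
  also have "\<dots> = (inv_sign S h * inv_sign (insert h S) h) * v h * f S +
     (\<Sum>y\<in>S. inv_sign S h * (inv_sign (insert h S) y * v y * f (insert h S - {y})))"
    by (simp add: distrib_left sum_distrib_left mult.assoc)
  also have "inv_sign (insert h S) h = (inv_sign S h :: 'a)"
    using assms False by (simp add: inv_sign_insert)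
  also have "(\<Sum>y\<in>S. inv_sign S h * (inv_sign (insert h S) y * v y * f (insert h S - {y}))) =
      - wedge v (contract h f) S"
    unfolding wedge_def sum_negf[symmetric] using * by (intro sum.cong) auto
  finally show ?thesis by simp
qed

text \<open>Annihilating and then creating at \<open>h\<close> is the occupation number of
  \<open>h\<close>, here scaled by \<open>c\<close>.\<close>

lemma wedge_unit_contract:
  assumes "finite S"
  shows "wedge (\<lambda>x. if x = h then c else 0) (contract h f) S = (if h \<in> S then c * f S else 0)"
proof (cases "h \<in> S")
  case True
  have "inv_sign (S - {h}) h = (inv_sign S h :: 'a)"
    by (rule inv_sign_cong) auto
  moreover have "inv_sign S h * c * (inv_sign S h * f S) = c * f S"
    by (metis inv_sign_square mult.assoc mult.commute mult_1)
  ultimately show ?thesis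
    using True assms by (simp add: wedge_remove[of S h] contract_def insert_absorb)
next
  case False
  then show ?thesis unfolding wedge_def by (auto intro!: sum.neutral)
qed

subsection \<open>Transfer operators between consecutive levels\<close>

text \<open>With \<open>foldr\<close> the highest site acts first, so a particle that has just
  reached \<open>Suc x\<close> is not touched again and moves by at most one. Staying (west) costs
  \<open>a\<close>, moving (south) costs 1.\<close>

definition ustep :: "'a \<Rightarrow> nat \<Rightarrow> (nat set \<Rightarrow> 'a) \<Rightarrow> nat set \<Rightarrow> 'a::comm_ring_1" where
  "ustep a N f = foldr (hop a 1) [0..<N] f"

text \<open>Here the lowest site acts first: a particle may be carried over many sites, while a hole
  moves by at most one. Evaluating at \<open>insert N S\<close> extracts the states with a particle
  at the last site \<open>N\<close>, which then leaves the system.\<close>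

definition dstep :: "'a \<Rightarrow> nat \<Rightarrow> (nat set \<Rightarrow> 'a) \<Rightarrow> nat set \<Rightarrow> 'a::comm_ring_1" where
  "dstep a N f S = (if N \<in> S then 0 else fold (hop 1 a) [0..<N] f (insert N S))"

definition udstep :: "'a \<Rightarrow> nat \<Rightarrow> (nat set \<Rightarrow> 'a) \<Rightarrow> nat set \<Rightarrow> 'a::comm_ring_1" where
  "udstep a N f = dstep a N (ustep a N f)"

text \<open>The packed configuration of level 0. Sites above \<open>N\<close> are left free, since
  no cell of the diamond belongs to them.\<close>

definition initial_state :: "nat \<Rightarrow> nat set \<Rightarrow> 'a::comm_ring_1" where
  "initial_state N S = (if {..<N} \<subseteq> S \<and> N \<notin> S then 1 else 0)"

section \<open>Steps acting on polynomial coefficient sequences\<close>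

lemma foldr_hop_wedge:
  fixes v :: "nat \<Rightarrow> 'a::comm_ring_1"
  assumes "\<And>k. N \<le> k \<Longrightarrow> v k = 0" "i \<le> N"
  shows "foldr (hop a 1) [i..<N] (wedge v f) =
    wedge (\<lambda>k. if k < i then v k else a * v k + (if i < k then v (k - 1) else 0)) (foldr (hop a 1) [i..<N] f)"
  using assms(2)
proof (induction rule: inc_induct)
  case base
  have "(\<lambda>k. if k < N then v k else a * v k + (if N < k then v (k - 1) else 0)) = v"
    using assms(1) by auto
  then show ?case by simp
next
  case (step i)
  have *: "hop_vec a 1 i (\<lambda>k. if k < Suc i then v k else a * v k + (if Suc i < k then v (k - 1) else 0))
    = (\<lambda>k. if k < i then v k else a * v k + (if i < k then v (k - 1) else 0))"
    by (auto simp: hop_vec_def fun_eq_iff)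
  have "[i..<N] = i # [Suc i..<N]" using step.hyps by (simp add: upt_conv_Cons)
  then show ?case using step by (simp add: hop_wedge *)
qed

text \<open>Site \<open>N\<close> is not the source of any hop, so \<open>v\<close> has to vanish
  there; the product may then occupy it.\<close>

lemma ustep_wedge:
  fixes v :: "'a::comm_ring_1 poly"
  assumes "degree v < N"
  shows "ustep a N (wedge (coeff v) f) = wedge (coeff ([:a, 1:] * v)) (ustep a N f)"
proof -
  have "(\<lambda>k. if k < 0 then coeff v k else a * coeff v k + (if 0 < k then coeff v (k - 1) else 0))
     = coeff ([:a, 1:] * v)"
    by (auto simp: fun_eq_iff coeff_pCons split: nat.splits)
  then show ?thesis
    using foldr_hop_wedge[of N "coeff v" 0 a f] assms by (simp add: ustep_def coeff_eq_0)
qed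

text \<open>The upward sweep computes each new coefficient as the old one plus \<open>a\<close>
  times the new coefficient just below. This recursion is power series division by
  \<open>1 - a \<zeta>\<close>.\<close>

lemma fold_hop_wedge:
  fixes w :: "'a::comm_ring_1 poly"
  shows "fold (hop 1 a) [0..<i] (wedge (coeff ([:1, - a:] * w)) f) =
    wedge (\<lambda>k. if k \<le> i then coeff w k else coeff ([:1, - a:] * w) k) (fold (hop 1 a) [0..<i] f)"
proof (induction i)
  case 0
  have "(\<lambda>k. if k \<le> 0 then coeff w k else coeff ([:1, - a:] * w) k) = coeff ([:1, - a:] * w)"
    by (auto simp: fun_eq_iff)
  then show ?case by (simp only: upt.simps(1) fold.simps id_apply if_False less_nat_zero_code)
next
  case (Suc i)
  have *: "hop_vec 1 a i (\<lambda>k. if k \<le> i then coeff w k else coeff ([:1, - a:] * w) k)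
    = (\<lambda>k. if k \<le> Suc i then coeff w k else coeff ([:1, - a:] * w) k)"
    by (auto simp: hop_vec_def fun_eq_iff le_Suc_eq)
  show ?case
    by (simp only: upt_Suc_append[OF le0] fold_append comp_apply fold.simps id_apply Suc hop_wedge *)
qed

text \<open>Since the division is exact, the quotient has no coefficient at \<open>N\<close>, so
  wedging commutes with the extraction of site \<open>N\<close>. No sign appears, because
  \<open>N\<close> lies above every site with a nonzero coefficient.\<close>

lemma dstep_wedge:
  fixes w :: "'a::comm_ring_1 poly"
  assumes "degree w < N"
  shows "dstep a N (wedge (coeff ([:1, - a:] * w)) f) = wedge (coeff w) (dstep a N f)"
proof
  fix S
  have w0: "coeff w k = 0" if "N \<le> k" for k
    using assms that by (intro coeff_eq_0) auto
  have "(\<lambda>k. if k \<le> N then coeff w k else coeff ([:1, - a:] * w) k) = coeff w"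
    using w0 by (auto simp: fun_eq_iff coeff_pCons split: nat.splits)
  then have eq: "fold (hop 1 a) [0..<N] (wedge (coeff ([:1, - a:] * w)) f) =
     wedge (coeff w) (fold (hop 1 a) [0..<N] f)"
    using fold_hop_wedge[of a N w f] by simp
  define h where "h = fold (hop 1 a) [0..<N] f"
  show "dstep a N (wedge (coeff ([:1, - a:] * w)) f) S = wedge (coeff w) (dstep a N f) S"
  proof (cases "N \<in> S \<or> infinite S")
    case True
    have "wedge (coeff w) (dstep a N f) S = 0"
    proof (cases "infinite S")
      case False
      with True have "coeff w x * dstep a N f (S - {x}) = 0" for x
        using w0 by (cases "x = N") (auto simp: dstep_def)
      then show ?thesis by (simp add: wedge_def mult.assoc)
    qed (simp add: wedge_infinite)
    moreover have "dstep a N (wedge (coeff ([:1, - a:] * w)) f) S = 0"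
      using True unfolding dstep_def eq by (auto simp: wedge_infinite)
    ultimately show ?thesis by simp
  next
    case False
    then have "wedge (coeff w) h (insert N S) = (\<Sum>x\<in>S. inv_sign (insert N S) x * coeff w x * h (insert N S - {x}))"
      using w0 by (simp add: wedge_def)
    also have "\<dots> = (\<Sum>x\<in>S. inv_sign S x * coeff w x * dstep a N f (S - {x}))"
    proof (intro sum.cong refl)
      fix x assume "x \<in> S"
      with False have "x \<noteq> N" by auto
      then have "insert N S - {x} = insert N (S - {x})" by auto
      moreover have "inv_sign (insert N S) x * coeff w x = inv_sign S x * coeff w x"
        using False w0 by (cases "N \<le> x") (simp_all add: inv_sign_insert)
      ultimately show "inv_sign (insert N S) x * coeff w x * h (insert N S - {x}) =
          inv_sign S x * coeff w x * dstep a N f (S - {x})"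
        using False by (simp add: dstep_def h_def)
    qed
    finally show ?thesis using False unfolding dstep_def[of a N "wedge _ _"] eq h_def
      by (simp add: wedge_def)
  qed
qed

text \<open>Linearity, together with dependence on finite sets only: contraction identities are
  available just at finite \<open>S\<close>, and this clause permits applying an operator to
  them.\<close>

definition transfer :: "((nat set \<Rightarrow> 'a) \<Rightarrow> nat set \<Rightarrow> 'a::comm_ring_1) \<Rightarrow> bool" where
  "transfer F \<longleftrightarrow>
     (\<forall>c f g. F (\<lambda>S. c * f S + g S) = (\<lambda>S. c * F f S + F g S)) \<and>
     (\<forall>f g. (\<forall>S. finite S \<longrightarrow> f S = g S) \<longrightarrow> (\<forall>S. finite S \<longrightarrow> F f S = F g S))"

lemma transfer_linear: "transfer F \<Longrightarrow> F (\<lambda>S. c * f S + g S) = (\<lambda>S. c * F f S + F g S)"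
  unfolding transfer_def by blast

lemma transfer_cong: "transfer F \<Longrightarrow> (\<And>S. finite S \<Longrightarrow> f S = g S) \<Longrightarrow> finite S \<Longrightarrow> F f S = F g S"
  unfolding transfer_def by blast

lemma transfer_compose: "transfer F \<Longrightarrow> transfer G \<Longrightarrow> transfer (\<lambda>f. F (G f))"
  by (simp add: transfer_def)

lemma transfer_funpow: "transfer F \<Longrightarrow> transfer (F ^^ k)"
proof (induction k)
  case (Suc k)
  then show ?case using transfer_compose[of F "F ^^ k"] by (simp add: comp_def)
qed (simp add: transfer_def)

lemma transfer_hop: "transfer (hop s t x)"
  by (auto simp: transfer_def hop_def fun_eq_iff algebra_simps)

lemma transfer_foldr_hop: "transfer (foldr (hop s t) xs)"
proof (induction xs)
  case (Cons x xs)
  then show ?case using transfer_compose[OF transfer_hop Cons, of s t x] by (simp add: comp_def)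
qed (simp add: transfer_def)

lemma transfer_ustep: "transfer (ustep a N)"
  unfolding ustep_def by (rule transfer_foldr_hop)

lemma transfer_dstep: "transfer (dstep a N)"
proof -
  have "transfer (foldr (hop 1 a) (rev [0..<N]))" by (rule transfer_foldr_hop)
  then show ?thesis
    unfolding transfer_def foldr_conv_fold rev_rev_ident dstep_def by (auto simp: fun_eq_iff)
qed

lemma transfer_udstep: "transfer (udstep a N)"
  unfolding udstep_def by (intro transfer_compose[of "dstep a N" "ustep a N"] transfer_ustep transfer_dstep)

lemma transfer_zero: "transfer F \<Longrightarrow> F (\<lambda>_. 0) = (\<lambda>_. 0)"
  unfolding transfer_def by (drule conjunct1, drule spec[of _ "- 1"], drule spec[of _ "\<lambda>_. 0"], drule spec[of _ "\<lambda>_. 0"]) simp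

section \<open>Polynomials annihilating the left and the right part\<close>

lemma wedge_initial:
  fixes v :: "'a::comm_ring_1 poly"
  assumes "degree v < N"
  shows "wedge (coeff v) (initial_state N) = (\<lambda>_. 0)"
proof
  fix S
  have "inv_sign S x * coeff v x * initial_state N (S - {x}) = (0 :: 'a)" for x
  proof (cases "x < N")
    case False
    then show ?thesis using assms by (simp add: coeff_eq_0)
  qed (auto simp: initial_state_def)
  then show "wedge (coeff v) (initial_state N) S = 0" by (simp add: wedge_def)
qed

text \<open>One full level turns the factor \<open>1 - a \<zeta>\<close> of a relation into
  \<open>\<zeta> + a\<close>. A multiple of the higher power is thus pulled back by trading one
  factor; \<open>a \<noteq> 0\<close> keeps the degree, so the bound survives. At level 0 any
  polynomial of admissible degree works, because all sites below \<open>N\<close> are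
  filled.\<close>

lemma wedge_udstep_initial:
  fixes v :: "'a::idom poly"
  assumes "degree v < N" "[:a, 1:] ^ m dvd v" "a \<noteq> 0"
  shows "wedge (coeff v) ((udstep a N ^^ m) (initial_state N)) = (\<lambda>_. 0)"
  using assms(1,2)
proof (induction m arbitrary: v)
  case 0
  then show ?case by (simp add: wedge_initial)
next
  case (Suc m)
  show ?case
  proof (cases "v = 0")
    case True
    then show ?thesis by (simp add: wedge_def)
  next
    case False
    from Suc.prems obtain w where v: "v = [:a, 1:] * ([:a, 1:] ^ m * w)"
      by (metis dvdE mult.assoc power_Suc)
    define u where "u = [:1, - a:] * ([:a, 1:] ^ m * w)"
    have w: "[:a, 1:] ^ m * w \<noteq> 0" using False v by auto
    have "degree v = Suc (degree ([:a, 1:] ^ m * w))"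
      unfolding v using w by (subst degree_mult_eq) auto
    moreover have "degree u = Suc (degree ([:a, 1:] ^ m * w))"
      unfolding u_def using w assms(3) by (subst degree_mult_eq) auto
    ultimately have "degree u < N" using Suc.prems by simp
    moreover have "[:a, 1:] ^ m dvd u" unfolding u_def by (metis dvd_mult dvd_triv_left mult.left_commute)
    ultimately have "wedge (coeff u) ((udstep a N ^^ m) (initial_state N)) = (\<lambda>_. 0)"
      using Suc.IH by simp
    then have "wedge (coeff ([:a, 1:] * u)) (ustep a N ((udstep a N ^^ m) (initial_state N))) = (\<lambda>_. 0)"
      using ustep_wedge[OF \<open>degree u < N\<close>, of a "(udstep a N ^^ m) (initial_state N)"] transfer_zero[OF transfer_ustep] by metis
    moreover have "[:a, 1:] * u = [:1, - a:] * v"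
      unfolding u_def v by (simp only: mult.left_commute)
    ultimately show ?thesis
      using dstep_wedge[OF Suc.prems(1), of a "ustep a N ((udstep a N ^^ m) (initial_state N))"] transfer_zero[OF transfer_dstep, of a N]
      by (simp only: funpow.simps(2) comp_apply udstep_def[of a N "(udstep a N ^^ m) (initial_state N)"])
  qed
qed

text \<open>Half a level further the particles live on the sites 0 to \<open>N\<close>, which admits
  one degree more and consumes one more factor \<open>\<zeta> + a\<close>.\<close>

lemma wedge_ustep_initial:
  fixes v :: "'a::idom poly"
  assumes "degree v \<le> N" "[:a, 1:] ^ Suc m dvd v" "a \<noteq> 0" "0 < N"
  shows "wedge (coeff v) (ustep a N ((udstep a N ^^ m) (initial_state N))) = (\<lambda>_. 0)"
proof (cases "v = 0")
  case False
  from assms obtain w where v: "v = [:a, 1:] * ([:a, 1:] ^ m * w)"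
    by (metis dvdE mult.assoc power_Suc)
  with False have w: "[:a, 1:] ^ m * w \<noteq> 0" by auto
  have "degree v = Suc (degree ([:a, 1:] ^ m * w))"
    unfolding v using w by (subst degree_mult_eq) auto
  then have d: "degree ([:a, 1:] ^ m * w) < N" using assms by simp
  then have "wedge (coeff ([:a, 1:] ^ m * w)) ((udstep a N ^^ m) (initial_state N)) = (\<lambda>_. 0)"
    using assms by (intro wedge_udstep_initial) auto
  then show ?thesis
    using ustep_wedge[OF d, of a "(udstep a N ^^ m) (initial_state N)"] transfer_zero[OF transfer_ustep] v by metis
qed (simp add: wedge_def fun_eq_iff)

text \<open>The wedge is pushed forward through the levels, trading \<open>1 - a \<zeta>\<close> for
  \<open>\<zeta> + a\<close> each time so that the division stays exact. It arrives as a wedge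
  evaluated at the empty set, which is 0.\<close>

lemma udstep_wedge_final:
  fixes v :: "'a::idom poly"
  assumes "degree v < N" "[:1, - a:] ^ k dvd v" "a \<noteq> 0"
  shows "(udstep a N ^^ k) (wedge (coeff v) f) {} = 0"
  using assms(1,2)
proof (induction k arbitrary: v f)
  case (Suc k)
  show ?case
  proof (cases "v = 0")
    case True
    then have "wedge (coeff v) f = (\<lambda>_. 0)" by (simp add: wedge_def fun_eq_iff)
    then show ?thesis using transfer_zero[OF transfer_funpow[OF transfer_udstep, of "Suc k" a N]] by simp
  next
    case False
    from Suc.prems obtain w where v: "v = [:1, - a:] * ([:1, - a:] ^ k * w)"
      by (metis dvdE mult.assoc power_Suc)
    define u where "u = [:a, 1:] * ([:1, - a:] ^ k * w)"
    have w: "[:1, - a:] ^ k * w \<noteq> 0" using False v by auto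
    have "degree v = Suc (degree ([:1, - a:] ^ k * w))"
      unfolding v using w assms(3) by (subst degree_mult_eq) auto
    moreover have "degree u = Suc (degree ([:1, - a:] ^ k * w))"
      unfolding u_def using w by (subst degree_mult_eq) auto
    ultimately have u: "degree u < N" using Suc.prems by simp
    have "[:a, 1:] * v = [:1, - a:] * u"
      unfolding u_def v by (simp only: mult.left_commute)
    then have "udstep a N (wedge (coeff v) f) = wedge (coeff u) (udstep a N f)"
      using Suc.prems(1) u by (simp only: udstep_def ustep_wedge dstep_wedge)
    moreover have "[:1, - a:] ^ k dvd u" unfolding u_def by (metis dvd_mult dvd_triv_left mult.left_commute)
    ultimately show ?thesis using Suc.IH[OF u] by (simp add: funpow_swap1)
  qed
qed simp

lemma udstep_dstep_wedge_final:
  fixes v :: "'a::idom poly"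
  assumes "degree v \<le> N" "[:1, - a:] ^ Suc k dvd v" "a \<noteq> 0" "0 < N"
  shows "(udstep a N ^^ k) (dstep a N (wedge (coeff v) f)) {} = 0"
proof (cases "v = 0")
  case True
  then have "wedge (coeff v) f = (\<lambda>_. 0)" by (simp add: wedge_def fun_eq_iff)
  then show ?thesis
    by (simp add: transfer_zero[OF transfer_funpow[OF transfer_udstep]] transfer_zero[OF transfer_dstep])
next
  case False
  from assms obtain w where v: "v = [:1, - a:] * ([:1, - a:] ^ k * w)"
    by (metis dvdE mult.assoc power_Suc)
  with False have w: "[:1, - a:] ^ k * w \<noteq> 0" by auto
  have "degree v = Suc (degree ([:1, - a:] ^ k * w))"
    unfolding v using w assms(3) by (subst degree_mult_eq) auto
  then have d: "degree ([:1, - a:] ^ k * w) < N" using assms by simp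
  have "dstep a N (wedge (coeff v) f) = wedge (coeff ([:1, - a:] ^ k * w)) (dstep a N f)"
    unfolding v by (rule dstep_wedge[OF d])
  then show ?thesis using udstep_wedge_final[OF d _ assms(3)] by simp
qed

section \<open>Positivity by exhibiting admissible particle moves\<close>

lemma hop_nonneg:
  fixes s t :: real
  assumes "0 \<le> s" "0 \<le> t" "\<And>S. 0 \<le> f S"
  shows "0 \<le> hop s t x f S"
  using assms by (simp add: hop_def)

lemma hop_pos_stay:
  fixes s t :: real
  assumes "0 < s" "0 \<le> t" "\<And>S. 0 \<le> f S" "0 < f S"
  shows "0 < hop s t x f S"
  using assms by (simp add: hop_def add_pos_nonneg)

lemma hop_pos_move:
  fixes s t :: real
  assumes "0 < t" "\<And>S. 0 \<le> f S" "x \<notin> S" "Suc x \<in> S" "0 < f (insert x (S - {Suc x}))"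
  shows "0 < hop s t x f S"
  using assms by (simp add: hop_def add_nonneg_pos)

lemma foldr_hop_nonneg:
  fixes s t :: real
  assumes "0 \<le> s" "0 \<le> t" "\<And>S. 0 \<le> f S"
  shows "0 \<le> foldr (hop s t) xs f S"
proof (induction xs arbitrary: S)
  case (Cons x xs)
  then show ?case using assms by (simp add: hop_nonneg)
qed (use assms in simp)

lemma foldr_hop_pos_mono:
  fixes s t :: real
  assumes "0 < s" "0 \<le> t" "\<And>S. 0 \<le> f S" "0 < f S"
  shows "0 < foldr (hop s t) xs f S"
proof (induction xs)
  case (Cons x xs)
  then show ?case
    using assms foldr_hop_nonneg[of s t f xs] by (simp add: hop_pos_stay)
qed (use assms in simp)

lemma ustep_nonneg:
  fixes a :: real
  assumes "0 < a" "\<And>S. 0 \<le> f S"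
  shows "0 \<le> ustep a N f S"
  unfolding ustep_def using assms by (intro foldr_hop_nonneg) auto

lemma dstep_nonneg:
  fixes a :: real
  assumes "0 < a" "\<And>S. 0 \<le> f S"
  shows "0 \<le> dstep a N f S"
  using foldr_hop_nonneg[of 1 a f "rev [0..<N]"] assms
  unfolding dstep_def foldr_conv_fold rev_rev_ident by simp

lemma udstep_nonneg:
  fixes a :: real
  assumes "0 < a" "\<And>S. 0 \<le> f S"
  shows "0 \<le> (udstep a N ^^ k) f S"
proof (induction k arbitrary: S)
  case (Suc k)
  then show ?case using assms(1) by (simp add: udstep_def dstep_nonneg ustep_nonneg)
qed (use assms in simp)

text \<open>At most \<open>N\<close> particles leave a hole among \<open>N + 1\<close> sites. The
  history used lets the particles above the highest hole move up by one and all others stay.\<close>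

lemma ustep_full_support:
  fixes a :: real
  assumes "0 < a" "\<And>S. 0 \<le> f S" "n \<le> N"
    and pos: "\<And>S. S \<subseteq> {..<N} \<Longrightarrow> card S = n \<Longrightarrow> 0 < f S"
    and S: "S \<subseteq> {..N}" "card S = n"
  shows "0 < ustep a N f S"
proof -
  have "0 < foldr (hop a 1) [i..<N] f S"
    if "i \<le> N" "S \<subseteq> {..N}" "card S = n" "\<exists>x\<in>{i..N}. x \<notin> S" for i S
    using that
  proof (induction arbitrary: S rule: inc_induct)
    case base
    have "{..N} = insert N {..<N}" by auto
    moreover have "N \<notin> S" using base.prems(3) by simp
    ultimately have "S \<subseteq> {..<N}" using base.prems(1) by (simp add: subset_insert)
    then show ?case using pos base.prems(2) by simp
  next
    case (step i)
    let ?g = "foldr (hop a 1) [Suc i..<N] f"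
    have g: "0 \<le> ?g S" for S by (rule foldr_hop_nonneg) (use assms(1,2) in simp_all)
    have "[i..<N] = i # [Suc i..<N]" using step.hyps by (simp add: upt_conv_Cons)
    then have eq: "foldr (hop a 1) [i..<N] f = hop a 1 i ?g" by simp
    show ?case
    proof (cases "\<exists>x\<in>{Suc i..N}. x \<notin> S")
      case True
      then have "0 < ?g S" using step.IH step.prems(1,2) by simp
      then show ?thesis unfolding eq by (rule hop_pos_stay[rotated 3]) (use assms(1) g in simp_all)
    next
      case False
      from step.prems(3) obtain x where "x \<in> {i..N}" "x \<notin> S" by auto
      with False have "x = i" by (metis Suc_leI atLeastAtMost_iff le_neq_implies_less)
      with \<open>x \<notin> S\<close> False step.hyps have i: "i \<notin> S" "Suc i \<in> S" by auto
      \<comment> \<open>The only hole left is \<open>i\<close>, so the particle at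
        \<open>Suc i\<close> is taken to come from \<open>i\<close>. Its previous state has the hole
        at \<open>Suc i\<close>, as the induction hypothesis requires.\<close>
      let ?S = "insert i (S - {Suc i})"
      have "finite S" using step.prems(1) by (rule finite_subset) simp
      then have "card (insert i S - {Suc i}) = card (insert i S) - 1" "card (insert i S) = Suc (card S)"
        using i by simp_all
      moreover have "insert i S - {Suc i} = ?S" by auto
      ultimately have "card ?S = n" using step.prems(2) by simp
      moreover have "?S \<subseteq> {..N}" using step.prems(1) step.hyps by auto
      moreover have "\<exists>x\<in>{Suc i..N}. x \<notin> ?S" using step.hyps by (intro bexI[of _ "Suc i"]) auto
      ultimately have "0 < ?g ?S" by (intro step.IH)
      then show ?thesis unfolding eq by (rule hop_pos_move[rotated 4]) (use i g in simp_all)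
    qed
  qed
  moreover have "\<exists>x\<in>{0..N}. x \<notin> S"
  proof (rule ccontr)
    assume "\<not> ?thesis"
    with S have "S = {..N}" by auto
    with S assms(3) show False by simp
  qed
  ultimately show ?thesis using S unfolding ustep_def by simp
qed

lemma dstep_pos_mono:
  fixes a :: real
  assumes "0 < a" "\<And>S. 0 \<le> f S" "N \<notin> S" "0 < f (insert N S)"
  shows "0 < dstep a N f S"
  using foldr_hop_pos_mono[of 1 a f "insert N S" "rev [0..<N]"] assms
  unfolding dstep_def foldr_conv_fold rev_rev_ident by simp

text \<open>Every set of the right size is reached: let nothing move in the down step, so that
  \<open>insert N S\<close> precedes \<open>S\<close>, and use the full support of the up step for
  \<open>insert N S\<close>.\<close>

lemma udstep_initial_full_support:
  fixes a :: real
  assumes "0 < a" "m \<le> N" "S \<subseteq> {..<N}" "card S = N - m"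
  shows "0 < (udstep a N ^^ m) (initial_state N) S"
  using assms(2-)
proof (induction m arbitrary: S)
  case 0
  then have "S = {..<N}" by (intro card_subset_eq) auto
  then show ?case by (simp add: initial_state_def)
next
  case (Suc m)
  let ?f = "(udstep a N ^^ m) (initial_state N)"
  have f: "0 \<le> ?f S" for S using assms(1) by (intro udstep_nonneg) (auto simp: initial_state_def)
  have "finite S" using Suc.prems(2) by (rule finite_subset) simp
  moreover have N: "N \<notin> S" using Suc.prems(2) by auto
  ultimately have "card (insert N S) = N - m" using Suc.prems by simp
  moreover have "insert N S \<subseteq> {..N}" using Suc.prems(2) by auto
  moreover have "0 < ?f S'" if "S' \<subseteq> {..<N}" "card S' = N - m" for S'
    using Suc.IH that Suc.prems(1) by simp
  ultimately have "0 < ustep a N ?f (insert N S)"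
    by (intro ustep_full_support[OF assms(1) f, of "N - m"]) simp_all
  then have "0 < dstep a N (ustep a N ?f) S"
    by (rule dstep_pos_mono[OF assms(1) ustep_nonneg[OF assms(1) f] N])
  then show ?case by (simp only: funpow.simps comp_apply udstep_def[of a N ?f])
qed

text \<open>The topmost particle can be carried up to \<open>N\<close>, where it leaves, while all
  others rest.\<close>

lemma dstep_push_max:
  fixes a :: real
  assumes "0 < a" "\<And>S. 0 \<le> f S" "S \<subseteq> {..N}" "S \<noteq> {}" "0 < f S"
  shows "0 < dstep a N f (S - {Max S})"
proof -
  define y where "y = Max S"
  define R where "R = S - {y}"
  have fin: "finite S" using assms(3) by (rule finite_subset) simp
  then have y: "y \<in> S" "y \<le> N" and R: "\<And>x. x \<in> R \<Longrightarrow> x < y"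
    using assms Max_in[of S] Max_ge[of S] unfolding y_def R_def by (auto simp: le_neq_implies_less)
  \<comment> \<open>The top particle waits at \<open>y\<close> until the sweep reaches it and is
    carried along from then on; \<open>max y i\<close> is its site after \<open>i\<close>
    hops.\<close>
  have "0 < fold (hop 1 a) [0..<i] f (insert (max y i) R)" for i
  proof (induction i)
    case 0
    then show ?case using assms y by (simp add: R_def insert_absorb)
  next
    case (Suc i)
    let ?g = "fold (hop 1 a) [0..<i] f"
    have g: "0 \<le> ?g S" for S
      using foldr_hop_nonneg[of 1 a f "rev [0..<i]"] assms
      unfolding foldr_conv_fold rev_rev_ident by simp
    show ?case
    proof (cases "i < y")
      case True
      then have "max y i = y" "max y (Suc i) = y" by auto
      then show ?thesis using Suc g assms(1) by (simp add: hop_pos_stay)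
    next
      case False
      then have m: "max y i = i" "max y (Suc i) = Suc i" by auto
      have "i \<notin> R" "Suc i \<notin> R" using R False by fastforce+
      then have "insert i (insert (Suc i) R - {Suc i}) = insert i R" by auto
      then show ?thesis
        using Suc g assms(1) \<open>i \<notin> R\<close> False R by (simp add: m hop_pos_move)
    qed
  qed
  from this[of N] show ?thesis
    using y R unfolding dstep_def y_def[symmetric] R_def[symmetric] by (force simp: max_def)
qed

text \<open>Nobody moves in the up steps and each down step expels the topmost particle, so
  \<open>k\<close> particles are gone after \<open>k\<close> levels.\<close>

lemma udstep_final_pos:
  fixes a :: real
  assumes "0 < a" "\<And>S. 0 \<le> f S" "S \<subseteq> {..<N}" "card S = k" "0 < f S"
  shows "0 < (udstep a N ^^ k) f {}"
  using assms(2-)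
proof (induction k arbitrary: f S)
  case 0
  then have "S = {}" using finite_subset[of S "{..<N}"] by auto
  with 0 show ?case by simp
next
  case (Suc k)
  have fin: "finite S" and ne: "S \<noteq> {}" using Suc finite_subset[of S "{..<N}"] by auto
  have u: "0 < ustep a N f S" "0 \<le> ustep a N f S'" for S'
    using Suc assms(1) foldr_hop_pos_mono[of a 1 f S "[0..<N]"] ustep_nonneg[of a f]
    by (auto simp: ustep_def)
  have "S \<subseteq> {..N}" using Suc by auto
  then have "0 < udstep a N f (S - {Max S})"
    unfolding udstep_def using dstep_push_max[of a "ustep a N f" S N] assms(1) u ne by simp
  moreover have "0 \<le> udstep a N f S" for S
    using Suc udstep_nonneg[OF assms(1), of f 1 N] by simp
  moreover have "card (S - {Max S}) = k" using Suc fin ne Max_in by simp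
  moreover have "S - {Max S} \<subseteq> {..<N}" using Suc by auto
  ultimately show ?case using Suc.IH[of "udstep a N f" "S - {Max S}"] by (simp add: funpow_swap1)
qed

lemma udstep_dstep_final_pos:
  fixes a :: real
  assumes "0 < a" "\<And>S. 0 \<le> f S" "S \<subseteq> {..N}" "card S = Suc k" "0 < f S"
  shows "0 < (udstep a N ^^ k) (dstep a N f) {}"
proof -
  have fin: "finite S" and ne: "S \<noteq> {}" using assms finite_subset[of S "{..N}"] by auto
  have "S - {Max S} \<subseteq> {..<N}"
  proof
    fix x assume x: "x \<in> S - {Max S}"
    then have "x < Max S" using fin Max_ge[of S x] by (auto simp: le_neq_implies_less)
    also have "Max S \<le> N" using Max_in[OF fin ne] assms by auto
    finally show "x \<in> {..<N}" by simp
  qed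
  moreover have "card (S - {Max S}) = k" using assms fin ne Max_in by simp
  ultimately show ?thesis
    using assms ne by (intro udstep_final_pos[of a _ "S - {Max S}"] dstep_nonneg dstep_push_max)
qed

subsection \<open>Dominoes of the Aztec diamond indexed by levels\<close>

text \<open>
  The odd cells with first index \<open>m\<close> form level \<open>2 m\<close>, the even cells level \<open>2 m - 1\<close>; in both
  cases the cell with second index \<open>h\<close> belongs to the particle position \<open>m - h\<close>. Dominoes carry the
  indices of their odd cell. An odd cell is occupied by a particle iff its domino is south or west,
  an even cell iff its domino comes from the previous level.
\<close>

definition ocell :: "nat \<Rightarrow> nat \<Rightarrow> nat \<Rightarrow> int \<times> int" where
  "ocell N m h = (int m + int h - int N, int m - int h - 1)"

definition ecell :: "nat \<Rightarrow> nat \<Rightarrow> nat \<Rightarrow> int \<times> int" where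
  "ecell N m h = (int m + int h - int N - 1, int m - int h - 1)"

definition domS :: "nat \<Rightarrow> nat \<Rightarrow> nat \<Rightarrow> domino" where
  "domS N m h = Horizontal (int m + int h - int N) (int m - int h - 1)"

definition domW :: "nat \<Rightarrow> nat \<Rightarrow> nat \<Rightarrow> domino" where
  "domW N m h = Vertical (int m + int h - int N) (int m - int h - 1)"

definition domN :: "nat \<Rightarrow> nat \<Rightarrow> nat \<Rightarrow> domino" where
  "domN N m h = Horizontal (int m + int h - int N - 1) (int m - int h - 1)"

definition domE :: "nat \<Rightarrow> nat \<Rightarrow> nat \<Rightarrow> domino" where
  "domE N m h = Vertical (int m + int h - int N) (int m - int h - 2)"

lemma ocell_eq [simp]: "ocell N m h = ocell N m' h' \<longleftrightarrow> m = m' \<and> h = h'"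
  by (auto simp: ocell_def)

lemma ecell_eq [simp]: "ecell N m h = ecell N m' h' \<longleftrightarrow> m = m' \<and> h = h'"
  by (auto simp: ecell_def)

lemma ocell_neq_ecell [simp]: "ocell N m h \<noteq> ecell N m' h'" "ecell N m' h' \<noteq> ocell N m h"
proof -
  show "ocell N m h \<noteq> ecell N m' h'" unfolding ocell_def ecell_def prod.inject by presburger
  then show "ecell N m' h' \<noteq> ocell N m h" by simp
qed

lemma cells_dom [simp]:
  "cells (domS N m h) = {ocell N m h, ecell N (Suc m) (Suc h)}"
  "cells (domW N m h) = {ocell N m h, ecell N (Suc m) h}"
  "cells (domN N m h) = {ocell N m h, ecell N m h}"
  "cells (domE N m h) = {ocell N m h, ecell N m (Suc h)}"
  by (auto simp: domS_def domW_def domN_def domE_def ocell_def ecell_def)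

lemma weight_dom [simp]:
  "weight a (domS N m h) = 1" "weight a (domW N m h) = a"
  "weight a (domN N m h) = 1" "weight a (domE N m h) = a"
  by (simp_all add: domS_def domW_def domN_def domE_def)

lemma dom_eq [simp]:
  "domS N m h = domS N m' h' \<longleftrightarrow> m = m' \<and> h = h'"
  "domW N m h = domW N m' h' \<longleftrightarrow> m = m' \<and> h = h'"
  "domN N m h = domN N m' h' \<longleftrightarrow> m = m' \<and> h = h'"
  "domE N m h = domE N m' h' \<longleftrightarrow> m = m' \<and> h = h'"
  by (auto simp: domS_def domW_def domN_def domE_def)

lemma dom_neq [simp]:
  "domS N m h \<noteq> domW N m' h'" "domW N m h \<noteq> domS N m' h'"
  "domS N m h \<noteq> domN N m' h'" "domN N m h \<noteq> domS N m' h'"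
  "domS N m h \<noteq> domE N m' h'" "domE N m h \<noteq> domS N m' h'"
  "domW N m h \<noteq> domN N m' h'" "domN N m h \<noteq> domW N m' h'"
  "domW N m h \<noteq> domE N m' h'" "domE N m h \<noteq> domW N m' h'"
  "domN N m h \<noteq> domE N m' h'" "domE N m h \<noteq> domN N m' h'"
  unfolding domS_def domW_def domN_def domE_def domino.inject by (simp_all; presburger)+

section \<open>Regions of the diamond and the effect of a single site\<close>

definition cellset :: "nat \<Rightarrow> (nat \<times> nat) set \<Rightarrow> (nat \<times> nat) set \<Rightarrow> (int \<times> int) set" where
  "cellset N A B = (\<lambda>(m, h). ocell N m h) ` A \<union> (\<lambda>(m, h). ecell N m h) ` B"

lemma in_cellset [simp]:
  "ocell N m h \<in> cellset N A B \<longleftrightarrow> (m, h) \<in> A"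
  "ecell N m h \<in> cellset N A B \<longleftrightarrow> (m, h) \<in> B"
  by (auto simp: cellset_def)

lemma cellset_Diff [simp]:
  "cellset N A B - {ocell N m h, ecell N m' h'} = cellset N (A - {(m, h)}) (B - {(m', h')})"
  by (auto simp: cellset_def)

text \<open>
  \<open>S\<close> is the particle set in an intermediate state of a step: in \<open>regU\<close> the sites from \<open>i\<close> on have
  already moved to the even cells of index \<open>Suc m\<close>, in \<open>regD\<close> the sites below \<open>i\<close> have moved on to the
  odd cells of index \<open>Suc m\<close>. The region consists of the cells to be covered by then, hence holes among
  odd cells and particles among even cells are included.
\<close>

definition regU :: "nat \<Rightarrow> nat \<Rightarrow> nat \<Rightarrow> nat set \<Rightarrow> (int \<times> int) set" where
  "regU N m i S = cellset N
     {(m', h). h < N \<and> (m' < m \<or> m' = m \<and> (i \<le> h \<or> h \<notin> S))}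
     {(m', h). h \<le> N \<and> (1 \<le> m' \<and> m' \<le> m \<or> m' = Suc m \<and> i \<le> h \<and> h \<in> S)}"

definition regD :: "nat \<Rightarrow> nat \<Rightarrow> nat \<Rightarrow> nat set \<Rightarrow> (int \<times> int) set" where
  "regD N m i S = cellset N
     {(m', h). h < N \<and> (m' \<le> m \<or> m' = Suc m \<and> h < i \<and> h \<notin> S)}
     {(m', h). h \<le> N \<and> (1 \<le> m' \<and> m' \<le> m \<or> m' = Suc m \<and> (h < i \<or> h \<in> S))}"

text \<open>No domino of \<open>D\<close> reaches the even cell at \<open>i\<close>. If
  \<open>i\<close> is occupied, that cell forces the west domino. If not, the south domino may be
  used when \<open>Suc i\<close> is occupied, and removing its two cells yields the region of the
  state with the particle still at \<open>i\<close>.\<close>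

lemma regU_step:
  assumes "finite D" "i < N" and unc: "\<And>d. d \<in> D \<Longrightarrow> ecell N (Suc m) i \<notin> cells d"
    and fresh: "domW N m i \<notin> D" "domS N m i \<notin> D"
  shows "cover_sum a (insert (domS N m i) (insert (domW N m i) D)) (regU N m i S) =
    hop a 1 i (\<lambda>S. cover_sum a D (regU N m (Suc i) S)) S"
proof (cases "i \<in> S")
  case True
  let ?D = "insert (domS N m i) D"
  have "cover_sum a (insert (domW N m i) ?D) (regU N m i S) =
      cover_sum a ?D (regU N m i S) + a * cover_sum a ?D (regU N m i S - cells (domW N m i))"
    using assms True by (subst cover_sum_insert) (auto simp: regU_def)
  also have "cover_sum a ?D (regU N m i S) = 0"
    using unc True assms(2) by (intro cover_sum_uncovered[of "ecell N (Suc m) i"]) (auto simp: regU_def)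
  also have "regU N m i S - cells (domW N m i) = regU N m (Suc i) S"
    unfolding regU_def cells_dom cellset_Diff using True by (intro arg_cong2[of _ _ _ _ "cellset N"]) auto
  also have "cover_sum a ?D (regU N m (Suc i) S) = cover_sum a D (regU N m (Suc i) S)"
    using True by (intro cover_sum_irrelevant) (auto simp: regU_def)
  finally show ?thesis using True by (simp add: hop_def insert_commute)
next
  case False
  have reg: "regU N m i S = regU N m (Suc i) S"
    unfolding regU_def using False
    by (intro arg_cong2[of _ _ _ _ "cellset N"]) (auto simp: Suc_le_eq le_less)
  have "\<not> cells (domW N m i) \<subseteq> regU N m i S" using False by (auto simp: regU_def)
  then have *: "cover_sum a (insert (domW N m i) D) (regU N m i S) = cover_sum a D (regU N m (Suc i) S)"
    by (simp add: cover_sum_irrelevant reg)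
  show ?thesis
  proof (cases "Suc i \<in> S")
    case True
    have "cover_sum a (insert (domS N m i) (insert (domW N m i) D)) (regU N m i S) =
      cover_sum a (insert (domW N m i) D) (regU N m i S) +
      cover_sum a (insert (domW N m i) D) (regU N m i S - cells (domS N m i))"
      using assms True False by (subst cover_sum_insert) (auto simp: regU_def)
    also have "regU N m i S - cells (domS N m i) = regU N m (Suc i) (insert i (S - {Suc i}))"
      unfolding reg unfolding regU_def cells_dom cellset_Diff using True False
      by (intro arg_cong2[of _ _ _ _ "cellset N"]) auto
    also have "cover_sum a (insert (domW N m i) D) (regU N m (Suc i) (insert i (S - {Suc i}))) =
        cover_sum a D (regU N m (Suc i) (insert i (S - {Suc i})))"
      by (intro cover_sum_irrelevant) (auto simp: regU_def)
    finally show ?thesis using True False * by (simp add: hop_def)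
  next
    case False': False
    then have "\<not> cells (domS N m i) \<subseteq> regU N m i S" by (auto simp: regU_def)
    then show ?thesis using False False' * by (simp add: hop_def cover_sum_irrelevant)
  qed
qed

text \<open>Without the two dominoes leaving site \<open>i\<close> both weights become 0: an
  occupied \<open>i\<close> cannot be served, and nothing arrives at \<open>Suc i\<close> from
  \<open>i\<close>.\<close>

lemma regU_step_blocked:
  assumes "i < N" and unc: "\<And>d. d \<in> D \<Longrightarrow> ecell N (Suc m) i \<notin> cells d"
  shows "cover_sum a D (regU N m i S) =
    hop 0 0 i (\<lambda>S. cover_sum a D (regU N m (Suc i) S)) S"
proof (cases "i \<in> S")
  case True
  have "cover_sum a D (regU N m i S) = 0"
    using unc True assms(1) by (intro cover_sum_uncovered[of "ecell N (Suc m) i"]) (auto simp: regU_def)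
  with True show ?thesis by (simp add: hop_def)
next
  case False
  have "regU N m i S = regU N m (Suc i) S"
    unfolding regU_def using False
    by (intro arg_cong2[of _ _ _ _ "cellset N"]) (auto simp: Suc_le_eq le_less)
  with False show ?thesis by (simp add: hop_def)
qed

text \<open>The same argument for holes: the odd cell at an empty site \<open>i\<close> can be
  covered by the new north or east domino only, and the east one shifts the particle at
  \<open>Suc i\<close> back to \<open>i\<close> in the preceding state.\<close>

lemma regD_step:
  assumes "finite D" "i < N" and unc: "\<And>d. d \<in> D \<Longrightarrow> ocell N (Suc m) i \<notin> cells d"
  shows "cover_sum a (insert (domN N (Suc m) i) (insert (domE N (Suc m) i) D)) (regD N m (Suc i) S) =
    hop 1 a i (\<lambda>S. cover_sum a D (regD N m i S)) S"
proof -
  have fresh: "domN N (Suc m) i \<notin> D" "domE N (Suc m) i \<notin> D"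
    using unc[of "domN N (Suc m) i"] unc[of "domE N (Suc m) i"] by auto
  show ?thesis
  proof (cases "i \<in> S")
    case True
    have "regD N m (Suc i) S = regD N m i S"
      unfolding regD_def using True
      by (intro arg_cong2[of _ _ _ _ "cellset N"]) (auto simp: less_Suc_eq)
    moreover have "ocell N (Suc m) i \<notin> regD N m i S" using True by (simp add: regD_def)
    ultimately show ?thesis using True by (simp add: hop_def cover_sum_irrelevant)
  next
    case False
    let ?R = "regD N m (Suc i) S"
    let ?D = "insert (domN N (Suc m) i) D"
    have "cover_sum a ?D ?R = cover_sum a D ?R + cover_sum a D (?R - cells (domN N (Suc m) i))"
      using assms False fresh by (subst cover_sum_insert) (auto simp: regD_def)
    also have "cover_sum a D ?R = 0"
      using unc False assms(2) by (intro cover_sum_uncovered[of "ocell N (Suc m) i"]) (auto simp: regD_def)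
    also have "?R - cells (domN N (Suc m) i) = regD N m i S"
      unfolding regD_def cells_dom cellset_Diff using False
      by (intro arg_cong2[of _ _ _ _ "cellset N"]) auto
    finally have *: "cover_sum a ?D ?R = cover_sum a D (regD N m i S)" by simp
    show ?thesis
    proof (cases "Suc i \<in> S")
      case True
      have "cover_sum a (insert (domE N (Suc m) i) ?D) ?R =
          cover_sum a ?D ?R + a * cover_sum a ?D (?R - cells (domE N (Suc m) i))"
        using assms True False fresh by (subst cover_sum_insert) (auto simp: regD_def)
      also have "?R - cells (domE N (Suc m) i) = regD N m i (insert i (S - {Suc i}))"
        unfolding regD_def cells_dom cellset_Diff using True False assms(2)
        by (intro arg_cong2[of _ _ _ _ "cellset N"]) auto
      also have "cover_sum a ?D (regD N m i (insert i (S - {Suc i}))) =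
          cover_sum a D (regD N m i (insert i (S - {Suc i})))"
        by (intro cover_sum_irrelevant) (auto simp: regD_def)
      finally show ?thesis using True False * by (simp add: hop_def insert_commute)
    next
      case False': False
      then have "\<not> cells (domE N (Suc m) i) \<subseteq> ?R" by (auto simp: regD_def)
      then show ?thesis using False False' * by (simp add: hop_def cover_sum_irrelevant insert_commute)
    qed
  qed
qed

definition doms_up :: "nat \<Rightarrow> nat \<Rightarrow> nat set \<Rightarrow> domino set" where
  "doms_up N m X = domS N m ` X \<union> domW N m ` X"

definition doms_down :: "nat \<Rightarrow> nat \<Rightarrow> nat set \<Rightarrow> domino set" where
  "doms_down N m X = domN N m ` X \<union> domE N m ` X"

lemma doms_insert:
  "doms_up N m (insert i X) = insert (domS N m i) (insert (domW N m i) (doms_up N m X))"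
  "doms_down N m (insert i X) = insert (domN N m i) (insert (domE N m i) (doms_down N m X))"
  by (auto simp: doms_up_def doms_down_def)

lemma doms_finite: "finite X \<Longrightarrow> finite (doms_up N m X)" "finite X \<Longrightarrow> finite (doms_down N m X)"
  by (auto simp: doms_up_def doms_down_def)

definition hops_blocked :: "'a \<Rightarrow> nat set \<Rightarrow> nat \<Rightarrow> (nat set \<Rightarrow> 'a) \<Rightarrow> nat set \<Rightarrow> 'a::comm_ring_1" where
  "hops_blocked a E i = (if i \<in> E then hop 0 0 i else hop a 1 i)"

lemma cover_sum_up:
  assumes D: "finite D" "\<And>d h. d \<in> D \<Longrightarrow> ecell N (Suc m) h \<notin> cells d"
    and i: "i \<le> N"
  shows "cover_sum a (D \<union> doms_up N m ({i..<N} - E)) (regU N m i S) =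
    foldr (hops_blocked a E) [i..<N] (\<lambda>S. cover_sum a D (regU N m N S)) S"
  using i
proof (induction arbitrary: S rule: inc_induct)
  case base
  then show ?case by (simp add: doms_up_def)
next
  case (step i)
  let ?D = "D \<union> doms_up N m ({Suc i..<N} - E)"
  have unc: "ecell N (Suc m) i \<notin> cells d" if "d \<in> ?D" for d
    using that D(2) by (auto simp: doms_up_def)
  have fresh: "domW N m i \<notin> ?D" "domS N m i \<notin> ?D"
    using D(2)[of "domW N m i" i] D(2)[of "domS N m i" "Suc i"] by (auto simp: doms_up_def)
  have fin: "finite ?D" using D(1) by (simp add: doms_finite)
  have upt: "[i..<N] = i # [Suc i..<N]" using step.hyps by (simp add: upt_conv_Cons)
  have IH: "(\<lambda>S. cover_sum a ?D (regU N m (Suc i) S)) =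
      foldr (hops_blocked a E) [Suc i..<N] (\<lambda>S. cover_sum a D (regU N m N S))"
    using step.IH by blast
  show ?case
  proof (cases "i \<in> E")
    case True
    have "{i..<N} = insert i {Suc i..<N}" using step.hyps(2) by auto
    with True have "{i..<N} - E = {Suc i..<N} - E" by simp
    then show ?thesis
      using True regU_step_blocked[OF step.hyps(2), where D="?D" and m=m and a=a and S=S] unc IH
      by (simp add: upt hops_blocked_def[of a E i])
  next
    case False
    then have "{i..<N} - E = insert i ({Suc i..<N} - E)" using step.hyps(2) by auto
    then have "D \<union> doms_up N m ({i..<N} - E) = insert (domS N m i) (insert (domW N m i) ?D)"
      by (simp only: doms_insert Un_insert_right)
    then show ?thesis
      using False regU_step[OF fin step.hyps(2) _ fresh, where a=a and S=S] unc IH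
      by (simp add: upt hops_blocked_def[of a E i])
  qed
qed

lemma cover_sum_down:
  assumes D: "finite D" "\<And>d h. d \<in> D \<Longrightarrow> ocell N (Suc m) h \<notin> cells d"
    and i: "i \<le> N"
  shows "cover_sum a (D \<union> doms_down N (Suc m) {..<i}) (regD N m i S) =
    fold (hop 1 a) [0..<i] (\<lambda>S. cover_sum a D (regD N m 0 S)) S"
  using i
proof (induction i arbitrary: S)
  case 0
  then show ?case by (simp add: doms_down_def)
next
  case (Suc i)
  let ?D = "D \<union> doms_down N (Suc m) {..<i}"
  have unc: "ocell N (Suc m) i \<notin> cells d" if "d \<in> ?D" for d
    using that D(2) by (auto simp: doms_down_def)
  have fin: "finite ?D" using D(1) by (simp add: doms_finite)
  have IH: "(\<lambda>S. cover_sum a ?D (regD N m i S)) =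
      fold (hop 1 a) [0..<i] (\<lambda>S. cover_sum a D (regD N m 0 S))"
    using Suc by (intro ext) simp
  have "D \<union> doms_down N (Suc m) {..<Suc i} =
      insert (domN N (Suc m) i) (insert (domE N (Suc m) i) ?D)"
    by (simp only: lessThan_Suc doms_insert Un_insert_right)
  then show ?case
    using regD_step[OF fin, where i=i and m=m and N=N and a=a and S=S] unc Suc.prems IH by simp
qed

text \<open>Deleting the dominoes that leave \<open>E\<close> amounts to forbidding \<open>E\<close>
  before the step. The induction moves the constraint inwards site by site: outside remain the
  constraints at sites not yet processed, and at \<open>i = 0\<close> none is left.\<close>

lemma foldr_hops_blocked:
  assumes "E \<subseteq> {..<N}" "i \<le> N"
  shows "avoid (E \<inter> {..<i}) (foldr (hops_blocked a E) [i..<N] f) = foldr (hop a 1) [i..<N] (avoid E f)"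
  using assms(2)
proof (induction rule: inc_induct)
  case base
  then show ?case using assms(1) by (simp add: Int_absorb2)
next
  case (step i)
  let ?g = "foldr (hops_blocked a E) [Suc i..<N] f"
  let ?X = "E \<inter> {..<i}"
  have upt: "[i..<N] = i # [Suc i..<N]" using step.hyps by (simp add: upt_conv_Cons)
  have "avoid ?X (hops_blocked a E i ?g) = hop a 1 i (avoid (E \<inter> {..<Suc i}) ?g)"
  proof (cases "i \<in> E")
    case True
    then have "E \<inter> {..<Suc i} = insert i ?X" by (auto simp: lessThan_Suc)
    then show ?thesis using True by (auto simp: fun_eq_iff hops_blocked_def hop_def avoid_def)
  next
    case False
    then have "E \<inter> {..<Suc i} = ?X" by (auto simp: lessThan_Suc)
    moreover have "insert i (S - {Suc i}) \<inter> ?X = S \<inter> ?X" for S by auto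
    ultimately show ?thesis using False
      by (auto simp: fun_eq_iff hops_blocked_def hop_def avoid_def)
  qed
  with step.IH upt show ?case by simp
qed

section \<open>Assembling complete levels\<close>

definition bounded_cols :: "nat \<Rightarrow> nat \<Rightarrow> nat \<Rightarrow> domino set \<Rightarrow> bool" where
  "bounded_cols N p q D \<longleftrightarrow> finite D \<and>
     (\<forall>d\<in>D. \<forall>m h. (ocell N m h \<in> cells d \<longrightarrow> m \<le> p) \<and> (ecell N m h \<in> cells d \<longrightarrow> m \<le> q))"

lemma bounded_cols_Un:
  "bounded_cols N p q (D \<union> D') \<longleftrightarrow> bounded_cols N p q D \<and> bounded_cols N p q D'"
  by (auto simp: bounded_cols_def)

lemma bounded_cols_subset: "bounded_cols N p q D \<Longrightarrow> D' \<subseteq> D \<Longrightarrow> bounded_cols N p q D'"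
  unfolding bounded_cols_def by (meson finite_subset subsetD)

lemma bounded_cols_mono: "bounded_cols N p q D \<Longrightarrow> p \<le> p' \<Longrightarrow> q \<le> q' \<Longrightarrow> bounded_cols N p' q' D"
  unfolding bounded_cols_def by (meson order_trans)

lemma bounded_cols_up: "finite X \<Longrightarrow> bounded_cols N m (Suc m) (doms_up N m X)"
  by (auto simp: bounded_cols_def doms_finite) (auto simp: doms_up_def)

lemma bounded_cols_down: "finite X \<Longrightarrow> bounded_cols N m m (doms_down N m X)"
  by (auto simp: bounded_cols_def doms_finite) (auto simp: doms_down_def)

lemma cover_sum_ustep:
  assumes "bounded_cols N m m D" "E \<subseteq> {..<N}"
  shows "cover_sum a (D \<union> doms_up N m ({..<N} - E)) (regU N m 0 S) =
    ustep a N (avoid E (\<lambda>S. cover_sum a D (regU N m N S))) S"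
proof -
  have "finite D" "\<And>d h. d \<in> D \<Longrightarrow> ecell N (Suc m) h \<notin> cells d"
    using assms(1) unfolding bounded_cols_def by (simp_all, fastforce)
  with cover_sum_up[where D=D and N=N and m=m and i=0 and a=a and E=E and S=S] foldr_hops_blocked[OF assms(2), where i=0 and a=a and f="\<lambda>S. cover_sum a D (regU N m N S)"]
  show ?thesis by (simp add: ustep_def atLeast0LessThan avoid_def[of "{}"] fun_eq_iff)
qed

lemma cover_sum_dstep:
  assumes "bounded_cols N m (Suc m) D"
  shows "cover_sum a (D \<union> doms_down N (Suc m) {..<N}) (regU N (Suc m) N S) =
    dstep a N (\<lambda>S. cover_sum a D (regU N m 0 S)) S"
proof (cases "N \<in> S")
  case True
  have "ecell N (Suc (Suc m)) N \<notin> cells d" if "d \<in> D \<union> doms_down N (Suc m) {..<N}" for d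
    using that assms unfolding bounded_cols_def by (fastforce simp: doms_down_def)
  then have "cover_sum a (D \<union> doms_down N (Suc m) {..<N}) (regU N (Suc m) N S) = 0"
    using True by (intro cover_sum_uncovered[of "ecell N (Suc (Suc m)) N"]) (auto simp: regU_def)
  with True show ?thesis by (simp add: dstep_def)
next
  case False
  have "finite D" "\<And>d h. d \<in> D \<Longrightarrow> ocell N (Suc m) h \<notin> cells d"
    using assms unfolding bounded_cols_def by (simp_all, fastforce)
  then have *: "cover_sum a (D \<union> doms_down N (Suc m) {..<N}) (regD N m N (insert N S)) =
      fold (hop 1 a) [0..<N] (\<lambda>S. cover_sum a D (regD N m 0 S)) (insert N S)"
    by (intro cover_sum_down) simp_all
  \<comment> \<open>A column of even cells has one cell more than a column of odd cells. Its last
    cell always belongs to the region, which is the origin of the inserted particle at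
    \<open>N\<close>.\<close>
  have "regU N (Suc m) N S = regD N m N (insert N S)"
    unfolding regU_def regD_def using False
    by (intro arg_cong2[of _ _ _ _ "cellset N"]) (auto simp: le_Suc_eq)
  moreover have "regD N m 0 S = regU N m 0 S" for S
    unfolding regU_def regD_def
    by (intro arg_cong2[of _ _ _ _ "cellset N"]) (auto simp: le_less)
  ultimately show ?thesis using False * by (simp add: dstep_def)
qed

definition level_doms :: "nat \<Rightarrow> nat \<Rightarrow> nat \<Rightarrow> domino set" where
  "level_doms N m m' = (\<Union>i\<in>{m..<m'}. doms_up N i {..<N} \<union> doms_down N (Suc i) {..<N})"

lemma level_doms_Suc:
  "m \<le> m' \<Longrightarrow> level_doms N m (Suc m') =
     level_doms N m m' \<union> doms_up N m' {..<N} \<union> doms_down N (Suc m') {..<N}"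
  by (auto simp: level_doms_def atLeastLessThanSuc)

lemma bounded_level_doms: "bounded_cols N m' m' (level_doms N m m')"
proof (induction m')
  case 0
  then show ?case by (simp add: level_doms_def bounded_cols_def)
next
  case (Suc m')
  show ?case
  proof (cases "m \<le> m'")
    case True
    show ?thesis
      unfolding level_doms_Suc[OF True] bounded_cols_Un
      using bounded_cols_mono[OF Suc, of "Suc m'" "Suc m'"] bounded_cols_down[of "{..<N}" N "Suc m'"]
        bounded_cols_mono[OF bounded_cols_up[of "{..<N}" N m'], of "Suc m'" "Suc m'"] by simp
  next
    case False
    then show ?thesis by (simp add: level_doms_def bounded_cols_def)
  qed
qed

lemma cover_sum_udstep:
  assumes "bounded_cols N m m D"
  shows "cover_sum a (D \<union> level_doms N m (m + k)) (regU N (m + k) N S) =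
    (udstep a N ^^ k) (\<lambda>S. cover_sum a D (regU N m N S)) S"
proof (induction k arbitrary: S)
  case 0
  then show ?case by (simp add: level_doms_def)
next
  case (Suc k)
  let ?D = "D \<union> level_doms N m (m + k)"
  have b: "bounded_cols N (m + k) (m + k) ?D"
    using bounded_level_doms bounded_cols_mono[OF assms] by (simp add: bounded_cols_Un)
  have b': "bounded_cols N (m + k) (Suc (m + k)) (?D \<union> doms_up N (m + k) {..<N})"
    using bounded_cols_up bounded_cols_mono[OF b] by (simp add: bounded_cols_Un[of _ _ _ ?D])
  have "cover_sum a (?D \<union> doms_up N (m + k) {..<N}) (regU N (m + k) 0 S) =
     ustep a N ((udstep a N ^^ k) (\<lambda>S. cover_sum a D (regU N m N S))) S" for S
  proof -
    have "(\<lambda>S. cover_sum a ?D (regU N (m + k) N S)) = (udstep a N ^^ k) (\<lambda>S. cover_sum a D (regU N m N S))"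
      using Suc by (intro ext)
    moreover have "avoid {} f = f" for f :: "nat set \<Rightarrow> 'a" by (simp add: avoid_def fun_eq_iff)
    ultimately show ?thesis using cover_sum_ustep[OF b, of "{}", where a=a and S=S] by simp
  qed
  then show ?case
    using cover_sum_dstep[OF b', where a=a and S=S]
    by (simp add: level_doms_Suc Un_assoc udstep_def[of a N "_ _"])
qed

lemma cover_sum_initial: "cover_sum a {} (regU N 0 N S) = initial_state N S"
proof -
  have "regU N 0 N S = {} \<longleftrightarrow> {..<N} \<subseteq> S \<and> N \<notin> S"
    by (auto simp: regU_def cellset_def)
  then show ?thesis by (simp add: cover_sum_empty initial_state_def)
qed

lemma cover_sum_levels:
  "(\<lambda>S. cover_sum a (level_doms N 0 m) (regU N m N S)) = (udstep a N ^^ m) (initial_state N)"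
  using cover_sum_udstep[where D="{}" and m=0 and N=N and k=m and a=a]
  by (intro ext) (simp add: bounded_cols_def cover_sum_initial)

lemma level_doms_split:
  assumes "m < m'"
  shows "level_doms N 0 m' = level_doms N 0 m \<union> doms_up N m {..<N} \<union>
    doms_down N (Suc m) {..<N} \<union> level_doms N (Suc m) m'"
proof -
  have "{0..<m'} = {0..<m} \<union> {m} \<union> {Suc m..<m'}" using assms by auto
  then show ?thesis by (auto simp: level_doms_def)
qed

lemma doms_up_disjoint:
  "doms_up N m X \<inter> level_doms N 0 m = {}" "doms_up N m X \<inter> doms_down N (Suc m) Y = {}"
  "doms_up N m X \<inter> level_doms N (Suc m) m' = {}"
  by (auto simp: doms_up_def doms_down_def level_doms_def)

lemma cover_sum_blocked_even:
  assumes "m \<le> N" "E \<subseteq> {..<N}"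
  shows "cover_sum a (level_doms N 0 N - doms_up N m E) (regU N N N {}) =
    (udstep a N ^^ (N - m)) (avoid E ((udstep a N ^^ m) (initial_state N))) {}"
proof (cases "m = N")
  case True
  \<comment> \<open>No domino leaves the last level, so nothing is deleted; correspondingly
    \<open>avoid E\<close> is evaluated at the empty set, where it is harmless.\<close>
  have "level_doms N 0 N - doms_up N N E = level_doms N 0 N" using doms_up_disjoint(1)[of N N E] by auto
  with True show ?thesis using cover_sum_levels[where a=a and N=N and m=N] by (simp add: avoid_def fun_eq_iff)
next
  case False
  then have m: "m < N" using assms by simp
  let ?D1 = "level_doms N 0 m \<union> doms_up N m ({..<N} - E)"
  let ?D2 = "?D1 \<union> doms_down N (Suc m) {..<N}"
  have b1: "bounded_cols N m (Suc m) ?D1"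
    using bounded_cols_mono[OF bounded_level_doms[of N m 0], of m "Suc m"] by (simp add: bounded_cols_Un bounded_cols_up)
  then have b2: "bounded_cols N (Suc m) (Suc m) ?D2"
    using bounded_cols_mono[OF b1] by (simp add: bounded_cols_Un[of _ _ _ ?D1] bounded_cols_down)
  have "doms_up N m {..<N} - doms_up N m E = doms_up N m ({..<N} - E)"
    by (auto simp: doms_up_def)
  then have "level_doms N 0 N - doms_up N m E = ?D2 \<union> level_doms N (Suc m) N"
    unfolding level_doms_split[OF m] using doms_up_disjoint[of N m E] by blast
  moreover have "(\<lambda>S. cover_sum a ?D2 (regU N (Suc m) N S)) =
      udstep a N (avoid E ((udstep a N ^^ m) (initial_state N)))"
    using cover_sum_dstep[OF b1, where a=a] cover_sum_ustep[OF bounded_level_doms[of N m 0] assms(2), where a=a]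
    by (simp add: fun_eq_iff udstep_def[of a N "avoid _ _"] cover_sum_levels)
  moreover have "N - m = Suc (N - Suc m)" using m by simp
  ultimately show ?thesis
    using cover_sum_udstep[OF b2, where a=a and k="N - Suc m" and S="{}"] m by (simp add: funpow_swap1)
qed

definition doms_into :: "nat \<Rightarrow> nat \<Rightarrow> nat set \<Rightarrow> domino set" where
  "doms_into N m E = {d \<in> doms_up N m {..<N}. \<exists>h\<in>E. ecell N (Suc m) h \<in> cells d}"

text \<open>On an odd level the condition concerns the dominoes arriving at a cell, so the
  projection stands between the up step and the down step. A region with a particle in
  \<open>E\<close> contains an even cell that can no longer be covered.\<close>

lemma cover_sum_blocked_odd:
  assumes "m < N" "E \<subseteq> {..N}"
  shows "cover_sum a (level_doms N 0 N - doms_into N m E) (regU N N N {}) =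
    (udstep a N ^^ (N - Suc m)) (dstep a N (avoid E (ustep a N ((udstep a N ^^ m) (initial_state N))))) {}"
proof -
  let ?D0 = "level_doms N 0 m \<union> doms_up N m {..<N}"
  let ?D1 = "?D0 - doms_into N m E"
  let ?D2 = "?D1 \<union> doms_down N (Suc m) {..<N}"
  have "bounded_cols N m (Suc m) ?D0"
    using bounded_cols_mono[OF bounded_level_doms[of N m 0], of m "Suc m"] by (simp add: bounded_cols_Un bounded_cols_up)
  then have b1: "bounded_cols N m (Suc m) ?D1" by (rule bounded_cols_subset) auto
  then have b2: "bounded_cols N (Suc m) (Suc m) ?D2"
    using bounded_cols_mono[OF b1] by (simp add: bounded_cols_Un[of _ _ _ ?D1] bounded_cols_down)
  have "doms_into N m E \<subseteq> doms_up N m {..<N}" by (auto simp: doms_into_def)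
  then have eq: "level_doms N 0 N - doms_into N m E = ?D2 \<union> level_doms N (Suc m) N"
    unfolding level_doms_split[OF assms(1)] using doms_up_disjoint[of N m "{..<N}"] by blast
  have "cover_sum a ?D1 (regU N m 0 S) = avoid E (ustep a N ((udstep a N ^^ m) (initial_state N))) S" for S
  proof (cases "S \<inter> E = {}")
    case True
    have "cover_sum a ?D1 (regU N m 0 S) = cover_sum a ?D0 (regU N m 0 S)"
    proof (rule cover_sum_cong)
      fix d assume "cells d \<subseteq> regU N m 0 S"
      then have "d \<notin> doms_into N m E"
        using True unfolding doms_into_def regU_def by fastforce
      then show "d \<in> ?D1 \<longleftrightarrow> d \<in> ?D0" by simp
    qed
    also have "\<dots> = ustep a N ((udstep a N ^^ m) (initial_state N)) S"
    proof -
      have "avoid {} f = f" for f :: "nat set \<Rightarrow> 'a" by (simp add: avoid_def fun_eq_iff)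
      then show ?thesis
        using cover_sum_ustep[OF bounded_level_doms[of N m 0], of "{}", where a=a and S=S] by (simp add: cover_sum_levels)
    qed
    finally show ?thesis using True by (simp add: avoid_def)
  next
    case False
    then obtain h where h: "h \<in> S" "h \<in> E" by auto
    have "ecell N (Suc m) h \<notin> cells d" if "d \<in> ?D1" for d
      using that h bounded_level_doms[of N m 0] unfolding doms_into_def bounded_cols_def by fastforce
    then have "cover_sum a ?D1 (regU N m 0 S) = 0"
      using h assms(2) by (intro cover_sum_uncovered[of "ecell N (Suc m) h"]) (auto simp: regU_def)
    with False show ?thesis by (simp add: avoid_def)
  qed
  then have "(\<lambda>S. cover_sum a ?D2 (regU N (Suc m) N S)) =
      dstep a N (avoid E (ustep a N ((udstep a N ^^ m) (initial_state N))))"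
    using cover_sum_dstep[OF b1, where a=a] by (simp add: fun_eq_iff)
  then show ?thesis
    using cover_sum_udstep[OF b2, where a=a and k="N - Suc m" and S="{}"] assms(1) by (simp add: eq)
qed

subsection \<open>Domino tilings as exact covers\<close>

definition az_cells :: "nat \<Rightarrow> (int \<times> int) set" where
  "az_cells N = cellset N {(m, h). m \<le> N \<and> h < N} {(m, h). 1 \<le> m \<and> m \<le> N \<and> h \<le> N}"

lemma unit_square_in_diamond:
  "unit_square i l \<subseteq> {(x, y). \<bar>x\<bar> + \<bar>y\<bar> \<le> real N + 1} \<longleftrightarrow>
     - int N - 1 \<le> i + l \<and> i + l \<le> int N - 1 \<and> - int N \<le> i - l \<and> i - l \<le> int N"
  (is "?L \<longleftrightarrow> ?R")
proof
  assume ?L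
  then have *: "\<bar>x\<bar> + \<bar>y\<bar> \<le> real N + 1"
    if "real_of_int i \<le> x" "x \<le> real_of_int i + 1" "real_of_int l \<le> y" "y \<le> real_of_int l + 1" for x y
  proof -
    have "(x, y) \<in> unit_square i l" using that by (simp add: unit_square_def)
    with \<open>?L\<close> show ?thesis by auto
  qed
  have "- real_of_int (int N) - 1 \<le> real_of_int i + real_of_int l"
    using *[of "real_of_int i" "real_of_int l"] by simp
  moreover have "real_of_int i + real_of_int l \<le> real_of_int (int N) - 1"
    using *[of "real_of_int i + 1" "real_of_int l + 1"] by simp
  moreover have "- real_of_int (int N) \<le> real_of_int i - real_of_int l"
    using *[of "real_of_int i" "real_of_int l + 1"] by simp
  moreover have "real_of_int i - real_of_int l \<le> real_of_int (int N)"
    using *[of "real_of_int i + 1" "real_of_int l"] by simp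
  ultimately show ?R by linarith
next
  assume R: ?R
  then have "- real N - 1 \<le> real_of_int i + real_of_int l" "real_of_int i + real_of_int l \<le> real N - 1"
    "- real N \<le> real_of_int i - real_of_int l" "real_of_int i - real_of_int l \<le> real N"
    by linarith+
  then show ?L
    by (auto simp: unit_square_def abs_le_iff abs_if)
qed

lemma odd_cell_cases:
  assumes "odd (i + l + int N)"
    "- int N - 1 \<le> i + l" "i + l \<le> int N - 1" "- int N \<le> i - l" "i - l \<le> int N"
  obtains m h where "(i, l) = ocell N m h" "m \<le> N" "h < N"
proof -
  obtain k where k: "i + l + int N + 1 = 2 * k" using assms(1) by (metis evenE even_plus_one_iff)
  define m where "m = nat k"
  define h where "h = nat (k - l - 1)"
  have "k \<ge> 0" "k - l - 1 \<ge> 0" using k assms by presburger+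
  then have "int m = k" "int h = k - l - 1" by (simp_all add: m_def h_def)
  then show ?thesis using that[of m h] k assms by (simp add: ocell_def)
qed

lemma even_cell_cases:
  assumes "even (i + l + int N)"
    "- int N - 1 \<le> i + l" "i + l \<le> int N - 1" "- int N \<le> i - l" "i - l \<le> int N"
  obtains m h where "(i, l) = ecell N m h" "1 \<le> m" "m \<le> N" "h \<le> N"
proof -
  obtain k where k: "i + l + int N + 2 = 2 * k" using assms(1) by (metis evenE even_add even_numeral)
  define m where "m = nat k"
  define h where "h = nat (k - l - 1)"
  have "k \<ge> 1" "k - l - 1 \<ge> 0" using k assms by presburger+
  then have "int m = k" "int h = k - l - 1" by (simp_all add: m_def h_def)
  then show ?thesis using that[of m h] k assms \<open>k \<ge> 1\<close> by (simp add: ecell_def)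
qed

lemma in_az_cells:
  "(i, l) \<in> az_cells N \<longleftrightarrow> - int N - 1 \<le> i + l \<and> i + l \<le> int N - 1 \<and> - int N \<le> i - l \<and> i - l \<le> int N"
  (is "?L \<longleftrightarrow> ?R")
proof
  assume ?L
  then show ?R by (auto simp: az_cells_def cellset_def ocell_def ecell_def)
next
  assume R: ?R
  show ?L
  proof (cases "even (i + l + int N)")
    case True
    with R obtain m h where "(i, l) = ecell N m h" "1 \<le> m" "m \<le> N" "h \<le> N"
      using even_cell_cases[of i l N] by metis
    then show ?thesis by (simp add: az_cells_def)
  next
    case False
    with R obtain m h where "(i, l) = ocell N m h" "m \<le> N" "h < N"
      using odd_cell_cases[of i l N] by metis
    then show ?thesis by (simp add: az_cells_def)
  qed
qed

lemma regU_full: "regU N N N {} = az_cells N"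
  unfolding regU_def az_cells_def by (intro arg_cong2[of _ _ _ _ "cellset N"]) (auto simp: le_less)

lemma az_cells_domino:
  assumes "cells d \<subseteq> az_cells N"
  shows "d \<in> level_doms N 0 N"
proof -
  have up: "d \<in> level_doms N 0 N" if "d = domS N m h \<or> d = domW N m h" "m < N" "h < N" for m h
    using that by (auto simp: level_doms_def doms_up_def)
  have down: "d \<in> level_doms N 0 N" if "d = domN N m h \<or> d = domE N m h" "1 \<le> m" "m \<le> N" "h < N" for m h
  proof -
    have "m - 1 \<in> {0..<N}" "Suc (m - 1) = m" using that by auto
    moreover have "d \<in> doms_down N m {..<N}" using that by (auto simp: doms_down_def)
    ultimately show ?thesis unfolding level_doms_def by (intro UN_I[of "m - 1"]) simp_all
  qed
  have az: "(i, l) \<in> cells d \<Longrightarrow> - int N - 1 \<le> i + l \<and> i + l \<le> int N - 1 \<and> - int N \<le> i - l \<and> i - l \<le> int N" for i l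
    using assms in_az_cells by blast
  show ?thesis
  proof (cases d)
    case d: (Horizontal i l)
    show ?thesis
    proof (cases "even (i + l + int N)")
      case False
      then obtain m h where mh: "(i, l) = ocell N m h" "m \<le> N" "h < N"
        using odd_cell_cases[of i l N] az[of i l] d by auto
      then have "d = domS N m h" by (simp add: d domS_def ocell_def)
      moreover have "ecell N (Suc m) (Suc h) \<in> az_cells N" using assms calculation by simp
      then have "m < N" by (simp add: az_cells_def)
      ultimately show ?thesis using up mh by blast
    next
      case True
      then obtain m h where mh: "(i + 1, l) = ocell N m h" "m \<le> N" "h < N"
        using odd_cell_cases[of "i + 1" l N] az[of "i + 1" l] d by auto
      then have "d = domN N m h" by (simp add: d domN_def ocell_def)
      moreover have "ecell N m h \<in> az_cells N" using assms calculation by simp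
      then have "1 \<le> m" by (simp add: az_cells_def)
      ultimately show ?thesis using down mh by blast
    qed
  next
    case d: (Vertical i l)
    show ?thesis
    proof (cases "even (i + l + int N)")
      case False
      then obtain m h where mh: "(i, l) = ocell N m h" "m \<le> N" "h < N"
        using odd_cell_cases[of i l N] az[of i l] d by auto
      then have "d = domW N m h" by (simp add: d domW_def ocell_def)
      moreover have "ecell N (Suc m) h \<in> az_cells N" using assms calculation by simp
      then have "m < N" by (simp add: az_cells_def)
      ultimately show ?thesis using up mh by blast
    next
      case True
      then obtain m h where mh: "(i, l + 1) = ocell N m h" "m \<le> N" "h < N"
        using odd_cell_cases[of i "l + 1" N] az[of i "l + 1"] d by auto
      then have "d = domE N m h" by (simp add: d domE_def ocell_def)
      moreover have "ecell N m (Suc h) \<in> az_cells N" using assms calculation by simp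
      then have "1 \<le> m" by (simp add: az_cells_def)
      ultimately show ?thesis using down mh by blast
    qed
  qed
qed

section \<open>Closed regions in the plane against sets of cells\<close>

definition cell_union :: "(int \<times> int) set \<Rightarrow> (real \<times> real) set" where
  "cell_union C = (\<Union>(i, l)\<in>C. unit_square i l)"

text \<open>Closed squares overlap along edges, but a centre lies in exactly one of them, so a union
  of squares determines its cells.\<close>

lemma centre_in_cell_union:
  "(real_of_int i + 1 / 2, real_of_int l + 1 / 2) \<in> cell_union C \<longleftrightarrow> (i, l) \<in> C"
proof -
  have "(real_of_int i + 1 / 2, real_of_int l + 1 / 2) \<in> unit_square i' l' \<longleftrightarrow> i = i' \<and> l = l'" for i' l'
  proof -
    have *: "real_of_int k' \<le> real_of_int k + 1 / 2 \<and> real_of_int k + 1 / 2 \<le> real_of_int k' + 1 \<longleftrightarrow> k = k'" for k k'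
      by linarith
    show ?thesis unfolding unit_square_def mem_Times_iff fst_conv snd_conv atLeastAtMost_iff * by simp
  qed
  then show ?thesis by (auto simp: cell_union_def)
qed

lemma cell_union_inject: "cell_union C = cell_union C' \<longleftrightarrow> C = C'"
proof
  assume "cell_union C = cell_union C'"
  then show "C = C'" using centre_in_cell_union by (metis set_eqI surj_pair)
qed simp

lemma region_eq_cell_union: "region d = cell_union (cells d)"
proof (cases d)
  case (Horizontal i l)
  show ?thesis unfolding Horizontal
    by (auto simp: cell_union_def unit_square_def; linarith)
next
  case (Vertical i l)
  show ?thesis unfolding Vertical
    by (auto simp: cell_union_def unit_square_def; linarith)
qed

lemma aztec_diamond_eq_cell_union: "aztec_diamond N = cell_union (az_cells N)"
proof -
  have "{unit_square i l | i l. unit_square i l \<subseteq> {(x, y). \<bar>x\<bar> + \<bar>y\<bar> \<le> real N + 1}} =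
      (\<lambda>(i, l). unit_square i l) ` az_cells N"
    unfolding unit_square_in_diamond in_az_cells[symmetric] by auto
  then show ?thesis by (simp add: aztec_diamond_def cell_union_def)
qed

text \<open>Taking floors sends an interior point of a domino to one of its cells, even on the edge
  between its two cells; conversely the centre of a common cell is a common interior point.\<close>

lemma interior_region_disjoint:
  "interior (region d) \<inter> interior (region d') = {} \<longleftrightarrow> cells d \<inter> cells d' = {}"
proof -
  have floor: "(\<lfloor>x\<rfloor>, \<lfloor>y\<rfloor>) \<in> cells d" if "(x, y) \<in> interior (region d)" for x y d
  proof (cases d)
    case (Horizontal i l)
    with that have "real_of_int i < x" "x < real_of_int i + 2" "real_of_int l < y" "y < real_of_int l + 1"
      by (auto simp: interior_Times)
    then have "\<lfloor>x\<rfloor> = i \<or> \<lfloor>x\<rfloor> = i + 1" "\<lfloor>y\<rfloor> = l" by linarith+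
    with Horizontal show ?thesis by auto
  next
    case (Vertical i l)
    with that have "real_of_int i < x" "x < real_of_int i + 1" "real_of_int l < y" "y < real_of_int l + 2"
      by (auto simp: interior_Times)
    then have "\<lfloor>x\<rfloor> = i" "\<lfloor>y\<rfloor> = l \<or> \<lfloor>y\<rfloor> = l + 1" by linarith+
    with Vertical show ?thesis by auto
  qed
  have centre: "(real_of_int i + 1 / 2, real_of_int l + 1 / 2) \<in> interior (region d)" if "(i, l) \<in> cells d" for i l d
    using that by (cases d) (auto simp: interior_Times)
  show ?thesis
  proof
    assume "interior (region d) \<inter> interior (region d') = {}"
    then show "cells d \<inter> cells d' = {}" using centre by fast
  next
    assume "cells d \<inter> cells d' = {}"
    then show "interior (region d) \<inter> interior (region d') = {}" using floor by fast
  qed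
qed

lemma domino_tiling_iff: "domino_tiling N T \<longleftrightarrow> exact_cover (az_cells N) T"
proof -
  have "(\<Union>d\<in>T. region d) = cell_union (\<Union>(cells ` T))"
    by (auto simp: region_eq_cell_union cell_union_def)
  then show ?thesis
    by (simp only: domino_tiling_def exact_cover_def aztec_diamond_eq_cell_union
        interior_region_disjoint pairwise_def cell_union_inject conj_commute)
qed

lemma domino_tiling_subset: "domino_tiling N T \<Longrightarrow> T \<subseteq> level_doms N 0 N"
  using az_cells_domino exact_cover_cells unfolding domino_tiling_iff by blast

lemma tilings_avoiding_sum:
  assumes "\<And>T. domino_tiling N T \<Longrightarrow> P T \<longleftrightarrow> T \<inter> K = {}"
  shows "(\<Sum>T | domino_tiling N T \<and> P T. a ^ num_vertical T) =
    cover_sum a (level_doms N 0 N - K) (regU N N N {})"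
proof -
  have "domino_tiling N T \<and> P T \<longleftrightarrow> T \<subseteq> level_doms N 0 N - K \<and> exact_cover (az_cells N) T" for T
  proof -
    have "T \<subseteq> level_doms N 0 N - K \<longleftrightarrow> T \<subseteq> level_doms N 0 N \<and> T \<inter> K = {}" by blast
    then show ?thesis
      using assms[of T] domino_tiling_subset[of N T] domino_tiling_iff[of N T] by argo
  qed
  then have "{T. domino_tiling N T \<and> P T} = {T. T \<subseteq> level_doms N 0 N - K \<and> exact_cover (az_cells N) T}"
    by simp
  then show ?thesis by (simp add: cover_sum_def regU_full)
qed

subsection \<open>Particles of a tiling\<close>

locale aztec_tiling =
  fixes N :: nat and T :: "domino set"
  assumes tiling: "domino_tiling N T"
begin

definition marked :: "nat \<Rightarrow> nat \<Rightarrow> bool" where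
  "marked m h \<longleftrightarrow> domS N m h \<in> T \<or> domW N m h \<in> T"

definition into :: "nat \<Rightarrow> nat \<Rightarrow> bool" where
  "into m h \<longleftrightarrow> domW N m h \<in> T \<or> (\<exists>h'. h = Suc h' \<and> domS N m h' \<in> T)"

text \<open>The rank is constant along paths, which pins down the end point of each path.\<close>

definition rank :: "nat \<Rightarrow> nat \<Rightarrow> nat" where
  "rank m k = (\<Sum>h<k. of_bool (marked m h))"

lemma dom_ranges:
  "domS N m h \<in> T \<Longrightarrow> m < N \<and> h < N"
  "domW N m h \<in> T \<Longrightarrow> m < N \<and> h < N"
  "domN N m h \<in> T \<Longrightarrow> 1 \<le> m \<and> m \<le> N \<and> h < N"
  "domE N m h \<in> T \<Longrightarrow> 1 \<le> m \<and> m \<le> N \<and> h < N"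
  using domino_tiling_subset[OF tiling]
  by (auto simp: level_doms_def doms_up_def doms_down_def dest!: subsetD)

lemma unique_cover:
  assumes "d \<in> T" "d' \<in> T" "c \<in> cells d" "c \<in> cells d'"
  shows "d = d'"
proof (rule ccontr)
  assume "d \<noteq> d'"
  with assms(1,2) tiling have "cells d \<inter> cells d' = {}"
    unfolding domino_tiling_iff exact_cover_def by simp
  with assms(3,4) show False by blast
qed

lemma covered:
  assumes "c \<in> az_cells N"
  shows "\<exists>d\<in>T. c \<in> cells d"
proof -
  have "\<Union>(cells ` T) = az_cells N" using tiling unfolding domino_tiling_iff exact_cover_def by simp
  with assms show ?thesis by blast
qed

lemma tiling_dominoes:
  assumes "d \<in> T"
  shows "\<exists>m h. d = domS N m h \<or> d = domW N m h \<or> d = domN N m h \<or> d = domE N m h"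
proof -
  have "d \<in> level_doms N 0 N" using assms domino_tiling_subset[OF tiling] by auto
  then obtain i where "d \<in> doms_up N i {..<N} \<or> d \<in> doms_down N (Suc i) {..<N}"
    unfolding level_doms_def by blast
  then show ?thesis unfolding doms_up_def doms_down_def by blast
qed

lemma ocell_cases:
  assumes "m \<le> N" "h < N"
  shows "domS N m h \<in> T \<or> domW N m h \<in> T \<or> domN N m h \<in> T \<or> domE N m h \<in> T"
proof -
  have "ocell N m h \<in> az_cells N" using assms by (simp add: az_cells_def)
  then obtain d where d: "d \<in> T" "ocell N m h \<in> cells d" using covered by blast
  with tiling_dominoes[OF d(1)] show ?thesis by auto
qed

lemma ecell_cases:
  assumes "m < N" "h \<le> N"
  obtains "domW N m h \<in> T" | h' where "h = Suc h'" "domS N m h' \<in> T"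
    | "domN N (Suc m) h \<in> T" | h' where "h = Suc h'" "domE N (Suc m) h' \<in> T"
proof -
  have "ecell N (Suc m) h \<in> az_cells N" using assms by (simp add: az_cells_def)
  then obtain d where d: "d \<in> T" "ecell N (Suc m) h \<in> cells d" using covered by blast
  with tiling_dominoes[OF d(1)] that show ?thesis by auto
qed

lemma ocell_exclusive:
  "domS N m h \<in> T \<Longrightarrow> domW N m h \<notin> T" "domS N m h \<in> T \<Longrightarrow> domN N m h \<notin> T"
  "domS N m h \<in> T \<Longrightarrow> domE N m h \<notin> T" "domW N m h \<in> T \<Longrightarrow> domN N m h \<notin> T"
  "domW N m h \<in> T \<Longrightarrow> domE N m h \<notin> T" "domN N m h \<in> T \<Longrightarrow> domE N m h \<notin> T"
  using unique_cover[of "domS N m h" "domW N m h" "ocell N m h"]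
    unique_cover[of "domS N m h" "domN N m h" "ocell N m h"]
    unique_cover[of "domS N m h" "domE N m h" "ocell N m h"]
    unique_cover[of "domW N m h" "domN N m h" "ocell N m h"]
    unique_cover[of "domW N m h" "domE N m h" "ocell N m h"]
    unique_cover[of "domN N m h" "domE N m h" "ocell N m h"]
  by auto

lemma ecell_exclusive:
  "domW N m (Suc h) \<in> T \<Longrightarrow> domS N m h \<notin> T" "domW N m h \<in> T \<Longrightarrow> domN N (Suc m) h \<notin> T"
  "domW N m (Suc h) \<in> T \<Longrightarrow> domE N (Suc m) h \<notin> T" "domS N m h \<in> T \<Longrightarrow> domN N (Suc m) (Suc h) \<notin> T"
  "domS N m h \<in> T \<Longrightarrow> domE N (Suc m) h \<notin> T" "domN N m (Suc h) \<in> T \<Longrightarrow> domE N m h \<notin> T"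
  using unique_cover[of "domW N m (Suc h)" "domS N m h" "ecell N (Suc m) (Suc h)"]
    unique_cover[of "domW N m h" "domN N (Suc m) h" "ecell N (Suc m) h"]
    unique_cover[of "domW N m (Suc h)" "domE N (Suc m) h" "ecell N (Suc m) (Suc h)"]
    unique_cover[of "domS N m h" "domN N (Suc m) (Suc h)" "ecell N (Suc m) (Suc h)"]
    unique_cover[of "domS N m h" "domE N (Suc m) h" "ecell N (Suc m) (Suc h)"]
    unique_cover[of "domN N m (Suc h)" "domE N m h" "ecell N m (Suc h)"]
  by auto

lemma marked_iff:
  assumes "m \<le> N" "h < N"
  shows "marked m h \<longleftrightarrow> domN N m h \<notin> T \<and> domE N m h \<notin> T"
  using ocell_cases[OF assms] ocell_exclusive unfolding marked_def by blast

lemma rank_Suc: "rank m (Suc k) = rank m k + of_bool (marked m k)"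
  by (simp add: rank_def)

text \<open>Count the even cells below \<open>k\<close> by the level their domino comes from. West
  and north dominoes join equal indices, so the only imbalance is a south or east domino that leads
  from site \<open>k - 1\<close> to the even cell \<open>k\<close>; there is at most one.\<close>

lemma rank_transfer:
  assumes "m < N" "k \<le> N"
  shows "rank m k = rank (Suc m) k +
    of_bool (\<exists>h. k = Suc h \<and> (domS N m h \<in> T \<or> domE N (Suc m) h \<in> T))"
  using assms(2)
proof (induction k)
  case 0
  then show ?case by (simp add: rank_def)
next
  case (Suc k)
  have k: "k \<le> N" "k < N" using Suc by auto
  from assms(1) k(1) show ?case
  proof (cases rule: ecell_cases)
    case 1
    then have "rank m k = rank (Suc m) k"
      using Suc.IH k ecell_exclusive by auto
    moreover have "domN N (Suc m) k \<notin> T" "domS N m k \<notin> T" using 1 ecell_exclusive(2)[of m k] ocell_exclusive(1)[of m k] by auto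
    ultimately show ?thesis
      using 1 marked_iff[of "Suc m" k] assms(1) k by (simp add: rank_Suc marked_def[of m k])
  next
    case (2 h')
    then have "rank m k = Suc (rank (Suc m) k)" using Suc.IH k by auto
    moreover have "domN N (Suc m) k \<notin> T" "domW N m k \<notin> T" using 2 ecell_exclusive by blast+
    ultimately show ?thesis
      using marked_iff[of "Suc m" k] ecell_exclusive(5)[of m k] assms(1) k
      by (cases "domS N m k \<in> T"; cases "domE N (Suc m) k \<in> T") (simp_all add: rank_Suc marked_def[of m k])
  next
    case 3
    then have "rank m k = rank (Suc m) k"
      using Suc.IH k ecell_exclusive by auto
    moreover have "domW N m k \<notin> T" "domE N (Suc m) k \<notin> T" using 3 ecell_exclusive(2)[of m k] ocell_exclusive(6)[of "Suc m" k] by auto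
    ultimately show ?thesis
      using 3 marked_iff[of "Suc m" k] assms(1) k by (simp add: rank_Suc marked_def[of m k])
  next
    case (4 h')
    then have "rank m k = Suc (rank (Suc m) k)" using Suc.IH k by auto
    moreover have "domN N (Suc m) k \<notin> T" "domW N m k \<notin> T" using 4 ecell_exclusive by blast+
    ultimately show ?thesis
      using marked_iff[of "Suc m" k] ecell_exclusive(5)[of m k] assms(1) k
      by (cases "domS N m k \<in> T"; cases "domE N (Suc m) k \<in> T") (simp_all add: rank_Suc marked_def[of m k])
  qed
qed

lemma rank_zero: "k \<le> N \<Longrightarrow> rank 0 k = k"
proof (induction k)
  case (Suc k)
  then show ?case using marked_iff[of 0 k] dom_ranges(3,4)[of 0 k] by (auto simp: rank_Suc)
qed (simp add: rank_def)

lemma rank_total: "m \<le> N \<Longrightarrow> rank m N = N - m"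
proof (induction m)
  case 0
  then show ?case by (simp add: rank_zero)
next
  case (Suc m)
  then have m: "m < N" by simp
  \<comment> \<open>Odd cells have second index below \<open>N\<close>, so the even cell
    \<open>N\<close> is always matched from site \<open>N - 1\<close>, and each level loses exactly
    one particle.\<close>
  from m order_refl have "\<exists>h. N = Suc h \<and> (domS N m h \<in> T \<or> domE N (Suc m) h \<in> T)"
    by (cases rule: ecell_cases) (use dom_ranges in blast)+
  then show ?case using rank_transfer[OF m order_refl] Suc by simp
qed

lemma rank_steps:
  "domS N m h \<in> T \<Longrightarrow> rank (Suc m) (Suc h) = rank m h"
  "domW N m h \<in> T \<Longrightarrow> rank (Suc m) h = rank m h"
  "domE N m h \<in> T \<Longrightarrow> rank m (Suc h) = rank m h"
proof -
  assume S: "domS N m h \<in> T"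
  then show "rank (Suc m) (Suc h) = rank m h"
    using rank_transfer[of m "Suc h"] dom_ranges(1)[OF S] by (simp add: rank_Suc marked_def)
next
  assume W: "domW N m h \<in> T"
  then have "\<not> (\<exists>h'. h = Suc h' \<and> (domS N m h' \<in> T \<or> domE N (Suc m) h' \<in> T))"
    using ecell_exclusive by blast
  then show "rank (Suc m) h = rank m h"
    using rank_transfer[of m h] dom_ranges(2)[OF W] by simp
next
  assume E: "domE N m h \<in> T"
  then show "rank m (Suc h) = rank m h"
    using ocell_exclusive by (auto simp: rank_Suc marked_def)
qed

section \<open>Paths through the odd cells and their marked points\<close>

lemma drawn_path_steps:
  "drawn_path N T (ocell N m h) (Level # ss) p \<longleftrightarrow> domS N m h \<in> T \<and> drawn_path N T (ocell N (Suc m) (Suc h)) ss p"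
  "drawn_path N T (ocell N m h) (Ascending # ss) p \<longleftrightarrow> domW N m h \<in> T \<and> drawn_path N T (ocell N (Suc m) h) ss p"
  "drawn_path N T (ocell N m h) (Descending # ss) p \<longleftrightarrow> domE N m h \<in> T \<and> drawn_path N T (ocell N m (Suc h)) ss p"
proof -
  define x y where xy: "x = int m + int h - int N" "y = int m - int h - 1"
  have eqs: "ocell N m h = (x, y)" "ocell N (Suc m) (Suc h) = (x + 2, y)" "ocell N (Suc m) h = (x + 1, y + 1)"
    "ocell N m (Suc h) = (x + 1, y - 1)" "domS N m h = Horizontal x y" "domW N m h = Vertical x y"
    "domE N m h = Vertical x (y - 1)"
    by (simp_all add: xy ocell_def domS_def domW_def domE_def)
  have "odd (x + y + int N)" "even (x + (y - 1) + int N)" unfolding xy by presburger+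
  then have "south N (Horizontal x y)" "west N (Vertical x y)" "east N (Vertical x (y - 1))"
    by (simp_all add: south_def west_def east_def)
  then show
    "drawn_path N T (ocell N m h) (Level # ss) p \<longleftrightarrow> domS N m h \<in> T \<and> drawn_path N T (ocell N (Suc m) (Suc h)) ss p"
    "drawn_path N T (ocell N m h) (Ascending # ss) p \<longleftrightarrow> domW N m h \<in> T \<and> drawn_path N T (ocell N (Suc m) h) ss p"
    "drawn_path N T (ocell N m h) (Descending # ss) p \<longleftrightarrow> domE N m h \<in> T \<and> drawn_path N T (ocell N m (Suc h)) ss p"
    by (simp_all add: eqs)
qed

lemma drawn_path_rank:
  "drawn_path N T (ocell N m h) ss (ocell N m' h') \<Longrightarrow> rank m h = rank m' h'"
proof (induction ss arbitrary: m h)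
  case Nil
  then show ?case by simp
next
  case (Cons s ss)
  then show ?case by (cases s) (auto simp: drawn_path_steps simp del: drawn_path.simps dest!: Cons.IH rank_steps)
qed

lemma drawn_path_append:
  "drawn_path N T (ocell N m h) ss (ocell N m' h') \<Longrightarrow> drawn_path N T (ocell N m' h') ss' p \<Longrightarrow>
    drawn_path N T (ocell N m h) (ss @ ss') p"
proof (induction ss arbitrary: m h)
  case Nil
  then show ?case by simp
next
  case (Cons s ss)
  then show ?case by (cases s) (auto simp: drawn_path_steps simp del: drawn_path.simps(2-4))
qed

definition level_marks :: "nat \<Rightarrow> nat \<Rightarrow> segment list \<Rightarrow> (int \<times> int) set" where
  "level_marks m h ss = marked_points (2 * int m, int m - int h) ss"

lemma level_marks_simps:
  "level_marks m h [] = {(2 * int m, int m - int h)}"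
  "level_marks m h (Level # ss) =
     {(2 * int m, int m - int h), (2 * int m + 1, int m - int h)} \<union> level_marks (Suc m) (Suc h) ss"
  "level_marks m h (Ascending # ss) =
     {(2 * int m, int m - int h), (2 * int m + 1, int m + 1 - int h)} \<union> level_marks (Suc m) h ss"
  "level_marks m h (Descending # ss) = level_marks m (Suc h) ss"
  by (simp_all add: level_marks_def algebra_simps)

lemma level_marks_append:
  "drawn_path N T (ocell N m h) ss (ocell N m' h') \<Longrightarrow> level_marks m' h' ss' \<subseteq> level_marks m h (ss @ ss')"
proof (induction ss arbitrary: m h)
  case Nil
  then show ?case by simp
next
  case (Cons s ss)
  then show ?case
    using Cons.IH[of "Suc m" "Suc h"] Cons.IH[of "Suc m" h] Cons.IH[of m "Suc h"]
    by (cases s) (simp_all add: drawn_path_steps level_marks_simps subset_insertI2 del: drawn_path.simps)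
qed

text \<open>The third alternative is the end point of the path; it is marked although no domino of
  the diamond starts there.\<close>

lemma level_marks_sound:
  assumes "drawn_path N T (ocell N m h) ss (ocell N m' N)" "(r, \<beta>) \<in> level_marks m h ss"
  shows "(\<exists>\<mu> \<eta>. r = 2 * int \<mu> \<and> \<beta> = int \<mu> - int \<eta> \<and> marked \<mu> \<eta>) \<or>
    (\<exists>\<mu> \<eta>. r = 2 * int \<mu> + 1 \<and> \<beta> = int \<mu> + 1 - int \<eta> \<and> into \<mu> \<eta>) \<or>
    (r = 2 * int m' \<and> \<beta> = int m' - int N)"
  using assms
proof (induction ss arbitrary: m h)
  case Nil
  then show ?case by (auto simp: level_marks_simps)
next
  case (Cons s ss)
  show ?case
  proof (cases s)
    case Level
    with Cons.prems have S: "domS N m h \<in> T" "drawn_path N T (ocell N (Suc m) (Suc h)) ss (ocell N m' N)"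
      by (simp_all add: drawn_path_steps del: drawn_path.simps)
    then have "marked m h" "into m (Suc h)" by (auto simp: marked_def into_def)
    moreover have "int m - int h = int m + 1 - int (Suc h)" by simp
    ultimately show ?thesis
      using Cons.prems(2) Cons.IH[OF S(2)] unfolding Level level_marks_simps by blast
  next
    case Ascending
    with Cons.prems have W: "domW N m h \<in> T" "drawn_path N T (ocell N (Suc m) h) ss (ocell N m' N)"
      by (simp_all add: drawn_path_steps del: drawn_path.simps)
    then have "marked m h" "into m h" by (auto simp: marked_def into_def)
    then show ?thesis
      using Cons.prems(2) Cons.IH[OF W(2)] unfolding Ascending level_marks_simps by blast
  next
    case Descending
    with Cons.prems show ?thesis
      using Cons.IH[of m "Suc h"] by (simp add: drawn_path_steps level_marks_simps del: drawn_path.simps)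
  qed
qed

text \<open>An odd cell whose domino is not north has a predecessor: the even cell with the same
  indices is then covered by a west, south or east domino, which supplies the last segment. Each
  segment increases \<open>m + h\<close>.\<close>

lemma path_from_start:
  assumes "m \<le> N" "h < N" "domN N m h \<notin> T"
  shows "\<exists>l<N. \<exists>ss. drawn_path N T (ocell N 0 l) ss (ocell N m h)"
  using assms
proof (induction "m + h" arbitrary: m h rule: less_induct)
  case less
  have extend: "\<exists>l<N. \<exists>ss. drawn_path N T (ocell N 0 l) ss (ocell N m h)"
    if "m' + h' < m + h" "m' \<le> N" "h' < N" "domN N m' h' \<notin> T" "drawn_path N T (ocell N m' h') [s] (ocell N m h)" for m' h' s
    using less.hyps[OF that(1-4)] drawn_path_append[OF _ that(5)] by blast
  show ?case
  proof (cases m)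
    case 0
    then show ?thesis using less.prems by (intro exI[of _ h] conjI exI[of _ "[]"]) auto
  next
    case (Suc \<mu>)
    have "\<mu> < N" "h \<le> N" using less.prems Suc by auto
    then show ?thesis
    proof (cases rule: ecell_cases)
      case 1
      show ?thesis
        by (rule extend[of \<mu> h Ascending])
          (use 1 Suc less.prems ocell_exclusive in \<open>auto simp: drawn_path_steps simp del: drawn_path.simps(2-4)\<close>)
    next
      case (2 h')
      show ?thesis
        by (rule extend[of \<mu> h' Level])
          (use 2 Suc less.prems ocell_exclusive in \<open>auto simp: drawn_path_steps simp del: drawn_path.simps(2-4)\<close>)
    next
      case 3
      then show ?thesis using less.prems Suc by simp
    next
      case (4 h')
      show ?thesis
        by (rule extend[of m h' Descending])
          (use 4 Suc less.prems ocell_exclusive in \<open>auto simp: drawn_path_steps simp del: drawn_path.simps(2-4)\<close>)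
    qed
  qed
qed

lemma path_to_end:
  assumes "m \<le> N" "h < N" "domN N m h \<notin> T"
  shows "\<exists>m'\<le>N. \<exists>ss. drawn_path N T (ocell N m h) ss (ocell N m' N)"
  using assms
proof (induction "2 * N - (m + h)" arbitrary: m h rule: less_induct)
  case less
  have extend: "\<exists>m'\<le>N. \<exists>ss. drawn_path N T (ocell N m h) ss (ocell N m' N)"
    if ext: "m + h < m' + h'" "m' \<le> N" "h' \<le> N" "domN N m' h' \<notin> T" "drawn_path N T (ocell N m h) [s] (ocell N m' h')" for m' h' s
  proof (cases "h' = N")
    case True
    then show ?thesis using ext(2,5) by blast
  next
    case False
    then have "2 * N - (m' + h') < 2 * N - (m + h)" "h' < N" using ext less.prems by auto
    then obtain m'' ss where "m'' \<le> N" "drawn_path N T (ocell N m' h') ss (ocell N m'' N)"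
      using less.hyps[OF _ ext(2) _ ext(4)] by blast
    then show ?thesis using drawn_path_append[OF ext(5)] by blast
  qed
  consider "domS N m h \<in> T" | "domW N m h \<in> T" | "domE N m h \<in> T"
    using ocell_cases[OF less.prems(1,2)] less.prems(3) by blast
  then show ?case
  proof cases
    case 1
    show ?thesis
      by (rule extend[of "Suc m" "Suc h" Level])
        (use 1 dom_ranges(1)[OF 1] ecell_exclusive in \<open>auto simp: drawn_path_steps simp del: drawn_path.simps(2-4)\<close>)
  next
    case 2
    show ?thesis
      by (rule extend[of "Suc m" h Ascending])
        (use 2 dom_ranges(2)[OF 2] ecell_exclusive in \<open>auto simp: drawn_path_steps simp del: drawn_path.simps(2-4)\<close>)
  next
    case 3
    show ?thesis
      by (rule extend[of m "Suc h" Descending])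
        (use 3 dom_ranges(4)[OF 3] ecell_exclusive in \<open>auto simp: drawn_path_steps simp del: drawn_path.simps(2-4)\<close>)
  qed
qed

lemma tiling_path_ocell: "l < N \<Longrightarrow> tiling_path N T l ss \<longleftrightarrow> drawn_path N T (ocell N 0 l) ss (ocell N (N - l) N)"
  by (simp add: tiling_path_def ocell_def of_nat_diff)

lemma path_particles_level_marks:
  "path_particles N l ss = level_marks 0 l ss \<union> {2 * int N - 2 * int l..2 * int N} \<times> {- int l}"
  by (simp add: path_particles_def level_marks_def)

lemma marked_on_path:
  assumes "domS N m h \<in> T \<or> domW N m h \<in> T"
  shows "\<exists>l<N. \<exists>ss ss'. tiling_path N T l ss \<and> level_marks m h ss' \<subseteq> path_particles N l ss \<and>
    drawn_path N T (ocell N m h) ss' (ocell N (N - l) N)"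
proof -
  have mh: "m \<le> N" "h < N" "domN N m h \<notin> T"
    using assms dom_ranges(1,2)[of m h] ocell_exclusive by auto
  obtain l ss1 where l: "l < N" and ss1: "drawn_path N T (ocell N 0 l) ss1 (ocell N m h)"
    using path_from_start[OF mh] by blast
  obtain m' ss2 where m': "m' \<le> N" and ss2: "drawn_path N T (ocell N m h) ss2 (ocell N m' N)"
    using path_to_end[OF mh] by blast
  have "rank 0 l = rank m' N"
    using drawn_path_rank[OF ss1] drawn_path_rank[OF ss2] by simp
  then have "m' = N - l" using l m' by (simp add: rank_zero rank_total)
  then show ?thesis
    using l ss1 ss2 drawn_path_append[OF ss1 ss2] level_marks_append[OF ss1, of ss2]
    unfolding path_particles_level_marks
    by (intro exI[of _ l] conjI exI[of _ "ss1 @ ss2"] exI[of _ ss2]) (auto simp: tiling_path_ocell)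
qed

lemma first_step:
  assumes "drawn_path N T (ocell N m h) ss (ocell N m' N)" "h < N"
  shows "domS N m h \<in> T \<Longrightarrow> {(2 * int m, int m - int h), (2 * int m + 1, int m - int h)} \<subseteq> level_marks m h ss"
    and "domW N m h \<in> T \<Longrightarrow> {(2 * int m, int m - int h), (2 * int m + 1, int m + 1 - int h)} \<subseteq> level_marks m h ss"
proof -
  obtain s ss' where ss: "ss = s # ss'" using assms by (cases ss) auto
  { assume "domS N m h \<in> T"
    then have "s = Level"
      using assms ocell_exclusive unfolding ss by (cases s) (auto simp: drawn_path_steps simp del: drawn_path.simps)
    then show "{(2 * int m, int m - int h), (2 * int m + 1, int m - int h)} \<subseteq> level_marks m h ss"
      by (simp add: ss level_marks_simps) }
  { assume "domW N m h \<in> T"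
    then have "s = Ascending"
      using assms ocell_exclusive unfolding ss by (cases s) (auto simp: drawn_path_steps simp del: drawn_path.simps)
    then show "{(2 * int m, int m - int h), (2 * int m + 1, int m + 1 - int h)} \<subseteq> level_marks m h ss"
      by (simp add: ss level_marks_simps) }
qed

lemma particles_complete:
  "marked m h \<Longrightarrow> int m - int h \<in> particles N T (2 * int m)"
  "into m h \<Longrightarrow> int m + 1 - int h \<in> particles N T (2 * int m + 1)"
proof -
  have *: "\<exists>l<N. \<exists>ss. tiling_path N T l ss \<and> X \<subseteq> path_particles N l ss"
    if "domS N m h \<in> T \<and> X = {(2 * int m, int m - int h), (2 * int m + 1, int m - int h)} \<or>
      domW N m h \<in> T \<and> X = {(2 * int m, int m - int h), (2 * int m + 1, int m + 1 - int h)}" for h X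
  proof -
    from that have d: "domS N m h \<in> T \<or> domW N m h \<in> T" by blast
    then have "h < N" using dom_ranges(1,2) by blast
    moreover obtain l ss ss' where "l < N" "tiling_path N T l ss"
      "level_marks m h ss' \<subseteq> path_particles N l ss" "drawn_path N T (ocell N m h) ss' (ocell N (N - l) N)"
      using marked_on_path[OF d] by blast
    ultimately show ?thesis using first_step[of m h ss' "N - l"] that by (metis subset_trans)
  qed
  { assume "marked m h"
    then show "int m - int h \<in> particles N T (2 * int m)"
      unfolding marked_def particles_def using *[of h] by blast }
  { assume "into m h"
    then consider "domW N m h \<in> T" | h' where "h = Suc h'" "domS N m h' \<in> T" unfolding into_def by blast
    then show "int m + 1 - int h \<in> particles N T (2 * int m + 1)"
    proof cases
      case 1
      then show ?thesis unfolding particles_def using *[of h] by blast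
    next
      case 2
      then have "int m + 1 - int h = int m - int h'" by simp
      then show ?thesis unfolding particles_def using *[of h'] 2 by blast
    qed }
qed

text \<open>The lower bound on \<open>\<beta>\<close> separates genuine particles from the end
  points of paths and from their horizontal completion: at level \<open>2 * m\<close> these lie at
  ordinates at most \<open>m - N\<close>.\<close>

lemma particles_even_iff:
  assumes "\<beta> \<ge> int m - int N + 1"
  shows "\<beta> \<in> particles N T (2 * int m) \<longleftrightarrow> (\<exists>h. \<beta> = int m - int h \<and> marked m h)"
proof
  assume "\<beta> \<in> particles N T (2 * int m)"
  then obtain l ss where l: "l < N" and path: "drawn_path N T (ocell N 0 l) ss (ocell N (N - l) N)"
    and mem: "(2 * int m, \<beta>) \<in> path_particles N l ss"
    by (auto simp: particles_def tiling_path_ocell)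
  have "(2 * int m, \<beta>) \<notin> {2 * int N - 2 * int l..2 * int N} \<times> {- int l}" using assms by auto
  with mem have "(2 * int m, \<beta>) \<in> level_marks 0 l ss" unfolding path_particles_level_marks by blast
  from level_marks_sound[OF path this] show "\<exists>h. \<beta> = int m - int h \<and> marked m h"
  proof (elim disjE exE conjE)
    fix \<mu> \<eta> assume "2 * int m = 2 * int \<mu> + 1"
    then show ?thesis by presburger
  qed (use assms in auto)
qed (auto simp: particles_complete)

lemma particles_odd_iff:
  assumes "\<beta> \<ge> int m + 1 - int N"
  shows "\<beta> \<in> particles N T (2 * int m + 1) \<longleftrightarrow> (\<exists>h. \<beta> = int m + 1 - int h \<and> into m h)"
proof
  assume "\<beta> \<in> particles N T (2 * int m + 1)"
  then obtain l ss where l: "l < N" and path: "drawn_path N T (ocell N 0 l) ss (ocell N (N - l) N)"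
    and mem: "(2 * int m + 1, \<beta>) \<in> path_particles N l ss"
    by (auto simp: particles_def tiling_path_ocell)
  have "(2 * int m + 1, \<beta>) \<notin> {2 * int N - 2 * int l..2 * int N} \<times> {- int l}" using assms by auto
  with mem have "(2 * int m + 1, \<beta>) \<in> level_marks 0 l ss" unfolding path_particles_level_marks by blast
  from level_marks_sound[OF path this] show "\<exists>h. \<beta> = int m + 1 - int h \<and> into m h"
  proof (elim disjE exE conjE)
    fix \<mu> \<eta> assume "2 * int m + 1 = 2 * int \<mu>"
    then show ?thesis by presburger
  next
    assume "2 * int m + 1 = 2 * int (N - l)"
    then show ?thesis by presburger
  qed auto
qed (auto simp: particles_complete)

end

lemma particles_even_disjoint:
  assumes "domino_tiling N T" "\<And>i. i \<in> I \<Longrightarrow> i \<ge> int m - int N + 1"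
  shows "particles N T (2 * int m) \<inter> I = {} \<longleftrightarrow> T \<inter> doms_up N m {h. int m - int h \<in> I} = {}"
proof -
  interpret aztec_tiling N T by unfold_locales (rule assms)
  have "particles N T (2 * int m) \<inter> I = {} \<longleftrightarrow> (\<forall>h. int m - int h \<in> I \<longrightarrow> \<not> marked m h)"
    using particles_even_iff assms(2) by blast
  also have "\<dots> \<longleftrightarrow> T \<inter> doms_up N m {h. int m - int h \<in> I} = {}"
    unfolding marked_def doms_up_def by blast
  finally show ?thesis .
qed

lemma particles_odd_disjoint:
  assumes "domino_tiling N T" "\<And>i. i \<in> I \<Longrightarrow> i \<ge> int m + 1 - int N"
  shows "particles N T (2 * int m + 1) \<inter> I = {} \<longleftrightarrow> T \<inter> doms_into N m {h. int m + 1 - int h \<in> I} = {}"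
proof -
  interpret aztec_tiling N T by unfold_locales (rule assms)
  have "into m h \<longleftrightarrow> (\<exists>d\<in>T. d \<in> doms_up N m {..<N} \<and> ecell N (Suc m) h \<in> cells d)" for h
    unfolding into_def doms_up_def using dom_ranges(1,2) by fastforce
  moreover have "particles N T (2 * int m + 1) \<inter> I = {} \<longleftrightarrow> (\<forall>h. int m + 1 - int h \<in> I \<longrightarrow> \<not> into m h)"
    using particles_odd_iff assms(2) by blast
  ultimately show ?thesis
    unfolding doms_into_def by blast
qed

subsection \<open>Square linear systems\<close>

text \<open>Elimination of the last unknown by a row in which it occurs, followed by back
  substitution.\<close>

lemma homogeneous_underdetermined:
  fixes A :: "nat \<Rightarrow> nat \<Rightarrow> 'a::field"
  shows "\<exists>x. (\<exists>j\<le>n. x j \<noteq> 0) \<and> (\<forall>i<n. (\<Sum>j\<le>n. A i j * x j) = 0)"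
proof (induction n arbitrary: A)
  case 0
  show ?case by (intro exI[of _ "\<lambda>_. 1"]) auto
next
  case (Suc n)
  show ?case
  proof (cases "\<exists>r<Suc n. A r (Suc n) \<noteq> 0")
    case False
    then have "(\<Sum>j\<le>Suc n. A i j * (if j = Suc n then 1 else 0)) = 0" if "i < Suc n" for i
      using that by (simp add: sum.delta if_distrib cong: if_cong)
    then show ?thesis by (intro exI[of _ "\<lambda>j. if j = Suc n then 1 else 0"]) auto
  next
    case True
    then obtain r where r: "r < Suc n" "A r (Suc n) \<noteq> 0" by blast
    \<comment> \<open>\<open>row\<close> enumerates the rows other than the pivot row
      \<open>r\<close>.\<close>
    define row where "row i = (if i < r then i else Suc i)" for i
    define B where "B i j = A (row i) j - A (row i) (Suc n) / A r (Suc n) * A r j" for i j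
    obtain x where x: "\<exists>j\<le>n. x j \<noteq> 0" "\<And>i. i < n \<Longrightarrow> (\<Sum>j\<le>n. B i j * x j) = 0"
      using Suc[of B] by blast
    define s where "s = (\<Sum>j\<le>n. A r j * x j)"
    define y where "y = x(Suc n := - s / A r (Suc n))"
    have y: "(\<Sum>j\<le>Suc n. A i j * y j) = (\<Sum>j\<le>n. A i j * x j) - A i (Suc n) / A r (Suc n) * s" for i
    proof -
      have "(\<Sum>j\<le>n. A i j * y j) = (\<Sum>j\<le>n. A i j * x j)"
        by (intro sum.cong) (auto simp: y_def)
      then show ?thesis by (simp add: y_def)
    qed
    have "(\<Sum>j\<le>Suc n. A i j * y j) = 0" if "i < Suc n" for i
    proof (cases "i = r")
      case True
      then show ?thesis unfolding y using r by (simp add: s_def)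
    next
      case False
      define i' where "i' = (if i < r then i else i - 1)"
      have i': "row i' = i" "i' < n" using False that r by (auto simp: row_def i'_def)
      have "(\<Sum>j\<le>n. B i' j * x j) = (\<Sum>j\<le>n. A i j * x j) - A i (Suc n) / A r (Suc n) * s"
        unfolding B_def i' s_def sum_distrib_left sum_subtractf[symmetric]
        by (intro sum.cong) (auto simp: algebra_simps)
      then show ?thesis using x(2)[OF i'(2)] y by simp
    qed
    moreover have "\<exists>j\<le>Suc n. y j \<noteq> 0"
    proof -
      from x(1) obtain j where "j \<le> n" "x j \<noteq> 0" by blast
      then show ?thesis by (intro exI[of _ j]) (auto simp: y_def)
    qed
    ultimately show ?thesis by blast
  qed
qed

text \<open>Appending \<open>- b\<close> as an extra column gives a nontrivial homogeneous solution.
  Its last entry is nonzero, for otherwise it would solve the original homogeneous system; dividing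
  by it gives the solution.\<close>

lemma square_system_solvable:
  fixes A :: "nat \<Rightarrow> nat \<Rightarrow> 'a::field"
  assumes trivial: "\<And>x. (\<And>i. i < n \<Longrightarrow> (\<Sum>j<n. A i j * x j) = 0) \<Longrightarrow> \<forall>j<n. x j = 0"
  shows "\<exists>x. \<forall>i<n. (\<Sum>j<n. A i j * x j) = b i"
proof -
  define B where "B i j = (if j < n then A i j else - b i)" for i j
  obtain x where x: "\<exists>j\<le>n. x j \<noteq> 0" "\<And>i. i < n \<Longrightarrow> (\<Sum>j\<le>n. B i j * x j) = 0"
    using homogeneous_underdetermined[of n B] by blast
  have split: "(\<Sum>j\<le>n. B i j * x j) = (\<Sum>j<n. A i j * x j) - b i * x n" for i
    by (simp add: B_def lessThan_Suc_atMost[symmetric])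
  have "x n \<noteq> 0"
  proof
    assume 0: "x n = 0"
    then have "\<forall>j<n. x j = 0" using x(2) split by (intro trivial) simp
    with 0 x(1) show False by (auto simp: le_less)
  qed
  have "(\<Sum>j<n. A i j * (x j / x n)) = b i" if "i < n" for i
  proof -
    have "(\<Sum>j<n. A i j * (x j / x n)) = (\<Sum>j<n. A i j * x j) / x n"
      by (simp add: sum_divide_distrib)
    also have "(\<Sum>j<n. A i j * x j) = b i * x n" using x(2)[OF that] split[of i] by simp
    finally show ?thesis using \<open>x n \<noteq> 0\<close> by simp
  qed
  then show ?thesis by (intro exI[of _ "\<lambda>j. x j / x n"]) simp
qed

subsection \<open>Ratios of avoidance sums\<close>

lemma wedge_add_vec: "wedge (\<lambda>x. v x + w x) f S = wedge v f S + wedge w f S"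
  by (simp add: wedge_def algebra_simps sum.distrib)

text \<open>Forbidding \<open>X\<close> removes the coordinates in \<open>X\<close>, where
  \<open>u\<close> is arbitrary and \<open>G\<close> vanishes, so wedging with \<open>G\<close> plus
  \<open>s\<close> times the unit vector of \<open>h\<close> kills \<open>avoid X \<beta>\<close>.
  Contracting with \<open>h\<close> leaves the scalar \<open>G h + s\<close>, a wedge with
  \<open>G\<close> that \<open>\<Phi>\<close> annihilates, and \<open>s\<close> times the occupation
  number of \<open>h\<close>; the terms with \<open>s\<close> combine to the sum that also avoids
  \<open>h\<close>.\<close>

lemma contraction_identity:
  fixes \<beta> :: "nat set \<Rightarrow> 'a::comm_ring_1"
  assumes \<Phi>: "\<And>c f g. \<Phi> (\<lambda>S. c * f S + g S) = c * \<Phi> f + \<Phi> g"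
      "\<And>f g. (\<And>S. finite S \<Longrightarrow> f S = g S) \<Longrightarrow> \<Phi> f = \<Phi> g"
    and A: "\<And>f. \<Phi> (wedge G f) = 0"
    and B: "wedge u \<beta> = (\<lambda>_. 0)"
    and h: "h \<notin> X" and u: "\<And>x. x \<notin> X \<Longrightarrow> u x = G x + (if x = h then s else 0)"
    and G: "\<And>x. x \<in> X \<Longrightarrow> G x = 0"
  shows "s * \<Phi> (avoid (insert h X) \<beta>) = - G h * \<Phi> (avoid X \<beta>)"
proof -
  let ?\<beta> = "avoid X \<beta>" and ?\<delta> = "\<lambda>x. if x = h then s else 0"
  have "(\<lambda>x. if x \<in> X then 0 else u x) = (\<lambda>x. G x + ?\<delta> x)" using u G h by (auto simp: fun_eq_iff)
  moreover have "avoid X (\<lambda>_. 0 :: 'a) = (\<lambda>_. 0)" by (simp add: avoid_def fun_eq_iff)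
  ultimately have 0: "wedge (\<lambda>x. G x + ?\<delta> x) ?\<beta> = (\<lambda>_. 0)"
    using avoid_wedge[of X u \<beta>] B by simp
  have "s * avoid (insert h X) \<beta> S = - G h * ?\<beta> S + wedge G (contract h ?\<beta>) S" if "finite S" for S
  proof -
    have "0 = (G h + s) * ?\<beta> S - wedge (\<lambda>x. G x + ?\<delta> x) (contract h ?\<beta>) S"
      using contract_wedge[OF that, of h "\<lambda>x. G x + ?\<delta> x" ?\<beta>] by (simp add: 0 contract_def[of h "\<lambda>_. 0"] split: if_splits)
    also have "\<dots> = (G h + s) * ?\<beta> S - wedge G (contract h ?\<beta>) S - (if h \<in> S then s * ?\<beta> S else 0)"
      using wedge_unit_contract[OF that, of h s ?\<beta>] by (simp add: wedge_add_vec)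
    finally have "wedge G (contract h ?\<beta>) S = (G h + s) * ?\<beta> S - (if h \<in> S then s * ?\<beta> S else 0)"
      by (simp add: algebra_simps)
    moreover have "avoid (insert h X) \<beta> S = (if h \<in> S then 0 else ?\<beta> S)" by (simp add: avoid_def)
    ultimately show ?thesis by (auto simp: algebra_simps)
  qed
  then have "\<Phi> (\<lambda>S. s * avoid (insert h X) \<beta> S + 0) = \<Phi> (\<lambda>S. - G h * ?\<beta> S + wedge G (contract h ?\<beta>) S)"
    by (intro \<Phi>(2)) simp
  moreover have "\<Phi> (\<lambda>S. 0) = 0" using \<Phi>(1)[of "- 1" "\<lambda>_. 0" "\<lambda>_. 0"] by simp
  ultimately show ?thesis using \<Phi>(1)[of s "avoid (insert h X) \<beta>" "\<lambda>_. 0"] \<Phi>(1)[of "- G h" ?\<beta>] A by simp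
qed

text \<open>Common frame for both parities: \<open>\<beta>\<close> is the part of the diamond left
  of the cut, \<open>\<Phi>\<close> the part right of it, and 0 to \<open>M\<close> are the sites at
  the cut. By \<open>size\<close>, the two spaces of annihilating polynomials have complementary
  dimensions.\<close>

locale hole_process =
  fixes a :: complex and m n M :: nat and \<beta> :: "nat set \<Rightarrow> complex" and \<Phi> :: "(nat set \<Rightarrow> complex) \<Rightarrow> complex"
  assumes a: "a \<noteq> 0" and size: "m + n = Suc M"
    and linear: "\<And>c f g. \<Phi> (\<lambda>S. c * f S + g S) = c * \<Phi> f + \<Phi> g"
    and finite_support: "\<And>f g. (\<And>S. finite S \<Longrightarrow> f S = g S) \<Longrightarrow> \<Phi> f = \<Phi> g"
    and left: "\<And>v. degree v \<le> M \<Longrightarrow> [:a, 1:] ^ m dvd v \<Longrightarrow> wedge (coeff v) \<beta> = (\<lambda>_. 0)"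
    and right: "\<And>v f. degree v \<le> M \<Longrightarrow> [:1, - a:] ^ n dvd v \<Longrightarrow> \<Phi> (wedge (coeff v) f) = 0"
begin

definition Z :: "nat set \<Rightarrow> complex" where "Z E = \<Phi> (avoid E \<beta>)"

lemma ratio:
  assumes "degree G \<le> M" "[:1, - a:] ^ n dvd G" "degree u \<le> M" "[:a, 1:] ^ m dvd u"
    and "h \<notin> X" "\<And>x. x \<notin> X \<Longrightarrow> coeff u x = coeff G x + (if x = h then s else 0)"
    and "\<And>x. x \<in> X \<Longrightarrow> coeff G x = 0"
  shows "s * Z (insert h X) = - coeff G h * Z X"
  unfolding Z_def
  by (rule contraction_identity[where \<Phi> = \<Phi>, OF linear finite_support right[OF assms(1,2)] left[OF assms(3,4)] assms(5-7)])

definition poly_part :: "nat \<Rightarrow> complex poly \<Rightarrow> complex poly" where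
  "poly_part d p = monom 1 d * [:1, - a:] ^ n * p"

text \<open>Both equations are brought to a common scale, the second one by multiplication with
  \<open>\<zeta> ^ d\<close>. The right-hand side \<open>r\<close> is left open so that the
  homogeneous case is included.\<close>

definition system :: "nat \<Rightarrow> nat \<Rightarrow> nat set \<Rightarrow> nat set \<Rightarrow> complex poly \<Rightarrow> complex poly \<Rightarrow> (nat \<Rightarrow> complex) \<Rightarrow> bool" where
  "system d K E J r p c \<longleftrightarrow> degree p < m - d \<and>
     [:a, 1:] ^ m dvd poly_part d p - (\<Sum>h\<in>E. monom (c h) h) + r \<and>
     (\<forall>h\<le>K. coeff (poly_part d p + (\<Sum>h\<in>J. monom (c h) h) + r) h = 0)"

end

locale hole_system = hole_process +
  fixes d K :: nat and E J :: "nat set"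
  assumes d: "d < m" "d \<le> K" and K: "K \<le> M" and E: "{..d} \<subseteq> E"
    and EJ: "E \<inter> J = {}" "E \<union> J = {..K}" and Z: "Z E \<noteq> 0"
begin

lemma finite_EJ [simp]: "finite E" "finite J"
  using EJ(2) finite_Un[of E J] by simp_all

lemma coeff_sum_monom:
  assumes "finite X"
  shows "coeff (\<Sum>h\<in>X. monom (c h) h) x = (if x \<in> X then c x else (0 :: complex))"
  using assms by (simp add: coeff_sum)

lemma poly_part_degree:
  assumes "degree p < m - d"
  shows "degree (poly_part d p) \<le> M"
proof -
  have "degree (poly_part d p) \<le> d + n * 1 + degree p"
    unfolding poly_part_def
    by (intro order_trans[OF degree_mult_le] add_mono order_trans[OF degree_power_le] degree_monom_le order_refl)
      (simp add: mult.commute)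
  then show ?thesis using assms size by linarith
qed

lemma poly_part_dvd: "[:1, - a:] ^ n dvd poly_part d p"
  unfolding poly_part_def by (metis dvd_mult dvd_mult2 dvd_refl)

lemma sum_monom_degree:
  assumes "X \<subseteq> {..K}"
  shows "degree (\<Sum>h\<in>X. monom (c h) h) \<le> M"
proof (rule degree_sum_le)
  show "finite X" using assms by (rule finite_subset) simp
  fix h assume "h \<in> X"
  with assms K have "h \<le> M" by auto
  then show "degree (monom (c h) h) \<le> M" by (rule order_trans[OF degree_monom_le])
qed

lemma E_subset: "E \<subseteq> {..K}" and J_subset: "J \<subseteq> {..K}"
  using EJ by auto

lemma E_memD: "h \<in> E \<Longrightarrow> h \<le> K \<and> h \<notin> J"
  using EJ by auto

text \<open>The ratio identity with \<open>s = 0\<close> makes the coefficients of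
  \<open>poly_part d p\<close> vanish off \<open>E\<close>, because \<open>Z E \<noteq> 0\<close>;
  on \<open>E\<close> the second equation does so. Once \<open>p = 0\<close>, the same identity with
  \<open>G = 0\<close> and \<open>X = E - {h}\<close> gives \<open>c h * Z E = 0\<close>.\<close>

lemma system_trivial:
  assumes "system d K E J 0 p c"
  shows "p = 0" "\<And>h. h \<le> K \<Longrightarrow> c h = 0"
proof -
  let ?G = "poly_part d p" and ?R = "\<Sum>h\<in>E. monom (c h) h"
  have p: "degree p < m - d" and dvd: "[:a, 1:] ^ m dvd ?G - ?R"
    and co: "\<And>h. h \<le> K \<Longrightarrow> coeff ?G h + (if h \<in> J then c h else 0) = 0"
    using assms by (auto simp: system_def coeff_sum_monom)
  have degs: "degree ?G \<le> M" "degree ?R \<le> M"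
    using poly_part_degree[OF p] sum_monom_degree[OF E_subset] by auto
  have GE: "coeff ?G h = 0" if "h \<in> E" for h using co[of h] E_memD[OF that] by simp
  have "coeff ?G h = 0" for h
  proof (cases "h \<in> E")
    case False
    have "0 * Z (insert h E) = - coeff ?G h * Z E"
    proof (rule ratio[where u = "?G - ?R"])
      show "coeff (?G - ?R) x = coeff ?G x + (if x = h then 0 else 0)" if "x \<notin> E" for x
        using that by (simp add: coeff_sum_monom)
    qed (use degs dvd False GE in \<open>simp_all add: poly_part_dvd degree_diff_le\<close>)
    with Z show ?thesis by simp
  qed (rule GE)
  then have G0: "?G = 0" by (simp add: poly_eq_iff)
  then show "p = 0" unfolding poly_part_def by (auto simp: monom_eq_0_iff)
  show "c h = 0" if "h \<le> K" for h
  proof (cases "h \<in> J")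
    case True
    then show ?thesis using co[OF that] G0 by simp
  next
    case False
    with that EJ have h: "h \<in> E" by auto
    have "- c h * Z (insert h (E - {h})) = - coeff 0 h * Z (E - {h})"
    proof (rule ratio[where u = "- ?R"])
      show "[:a, 1:] ^ m dvd - ?R" using dvd by (simp only: G0 diff_0)
      show "coeff (- ?R) x = coeff 0 x + (if x = h then - c h else 0)" if "x \<notin> E - {h}" for x
        using that h by (cases "x = h") (simp_all add: coeff_sum_monom)
      show "degree (- ?R) \<le> M" using degs(2) by (simp only: degree_minus)
    qed simp_all
    with Z h show ?thesis by (simp add: insert_absorb)
  qed
qed

lemma system_diff:
  assumes "system d K E J r p c" "system d K E J r p' c'"
  shows "system d K E J 0 (p - p') (\<lambda>h. c h - c' h)"
proof -
  have deg: "degree (p - p') < m - d"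
    using assms degree_diff_le_max[of p p'] by (auto simp: system_def)
  have pp: "poly_part d (p - p') = poly_part d p - poly_part d p'"
    by (simp add: poly_part_def algebra_simps)
  have sums: "(\<Sum>h\<in>X. monom (c h - c' h) h) = (\<Sum>h\<in>X. monom (c h) h) - (\<Sum>h\<in>X. monom (c' h) h)" for X
    by (simp add: diff_monom[symmetric] sum_subtractf)
  have "[:a, 1:] ^ m dvd (poly_part d p - (\<Sum>h\<in>E. monom (c h) h) + r) - (poly_part d p' - (\<Sum>h\<in>E. monom (c' h) h) + r)"
    using assms by (intro dvd_diff) (simp_all add: system_def)
  then have "[:a, 1:] ^ m dvd poly_part d (p - p') - (\<Sum>h\<in>E. monom (c h - c' h) h) + 0"
    unfolding pp sums by (simp add: algebra_simps)
  moreover have "coeff (poly_part d (p - p') + (\<Sum>h\<in>J. monom (c h - c' h) h) + 0) h = 0" if "h \<le> K" for h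
  proof -
    have "coeff (poly_part d p + (\<Sum>h\<in>J. monom (c h) h) + r) h = 0"
      "coeff (poly_part d p' + (\<Sum>h\<in>J. monom (c' h) h) + r) h = 0"
      using assms that by (auto simp: system_def)
    then have "coeff (poly_part d p + (\<Sum>h\<in>J. monom (c h) h) + r) h -
        coeff (poly_part d p' + (\<Sum>h\<in>J. monom (c' h) h) + r) h = 0" by simp
    then show ?thesis unfolding pp sums coeff_add coeff_diff by (simp add: algebra_simps)
  qed
  ultimately show ?thesis using deg by (simp add: system_def)
qed

lemma system_unique:
  assumes "system d K E J r p c" "system d K E J r p' c'"
  shows "p = p'" "\<And>h. h \<le> K \<Longrightarrow> c h = c' h"
  using system_trivial[OF system_diff[OF assms]] by auto

text \<open>There are \<open>(m - d) + (K + 1)\<close> unknowns and \<open>m + (K + 1 - d)\<close>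
  equations: coefficients of order below \<open>d\<close> in the second condition vanish anyway, as
  \<open>E\<close> contains these sites and \<open>J\<close> does not. A square system with trivial
  kernel is solvable.\<close>

lemma system_solvable:
  assumes r: "\<And>h. h < d \<Longrightarrow> coeff r h = 0"
  shows "\<exists>p c. system d K E J r p c"
proof -
  define D where "D = (m - d) + Suc K"
  let ?B = "[:a, 1:] ^ m"
  have degB: "degree ?B = m" by (simp add: degree_linear_power)
  have B0: "?B \<noteq> 0" by simp
  define pp where "pp x = (\<Sum>i<m - d. monom (x i) i)" for x :: "nat \<Rightarrow> complex"
  define cc where "cc x h = x (m - d + h)" for x :: "nat \<Rightarrow> complex" and h
  define P1 where "P1 x = poly_part d (pp x) - (\<Sum>h\<in>E. monom (cc x h) h)" for x
  define P2 where "P2 x = poly_part d (pp x) + (\<Sum>h\<in>J. monom (cc x h) h)" for x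
  \<comment> \<open>\<open>U j\<close> and \<open>V j\<close> are the contributions of the
    \<open>j\<close>-th unknown to the two equations; the first \<open>m - d\<close> unknowns are
    the coefficients of \<open>p\<close>.\<close>
  define U where "U j = (if j < m - d then monom 1 (d + j) * [:1, - a:] ^ n
      else if j - (m - d) \<in> E then - monom 1 (j - (m - d)) else 0)" for j
  define V where "V j = (if j < m - d then monom 1 (d + j) * [:1, - a:] ^ n
      else if j - (m - d) \<in> J then monom 1 (j - (m - d)) else 0)" for j
  have split: "(\<Sum>j<D. f j) = (\<Sum>j<m - d. f j) + (\<Sum>h\<le>K. f (m - d + h))" for f :: "nat \<Rightarrow> complex poly"
  proof -
    have "(\<Sum>j<m - d + q. f j) = (\<Sum>j<m - d. f j) + (\<Sum>h<q. f (m - d + h))" for q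
      by (induction q) (simp_all add: add.assoc)
    then show ?thesis unfolding D_def lessThan_Suc_atMost[symmetric] .
  qed
  have pps: "poly_part d (pp x) = (\<Sum>j<m - d. smult (x j) (monom 1 (d + j) * [:1, - a:] ^ n))" for x
    unfolding poly_part_def pp_def sum_distrib_left
  proof (intro sum.cong refl)
    fix j
    have "monom 1 d * [:1, - a:] ^ n * monom (x j) j = (monom 1 d * monom (x j) j) * [:1, - a:] ^ n"
      by (simp only: ac_simps)
    also have "\<dots> = smult (x j) (monom 1 (d + j)) * [:1, - a:] ^ n"
      by (simp only: mult_monom smult_monom mult_1 mult_1_right)
    finally show "monom 1 d * [:1, - a:] ^ n * monom (x j) j = smult (x j) (monom 1 (d + j) * [:1, - a:] ^ n)"
      by (simp only: mult_smult_left)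
  qed
  have restrict: "(\<Sum>h\<le>K. if h \<in> X then f h else 0) = (\<Sum>h\<in>X. f h)" if "X \<subseteq> {..K}" for X and f :: "nat \<Rightarrow> complex poly"
    using that by (simp add: sum.inter_restrict[symmetric] Int_absorb1)
  have P1: "P1 x = (\<Sum>j<D. smult (x j) (U j))" for x
  proof -
    have "(\<Sum>h\<le>K. smult (x (m - d + h)) (U (m - d + h))) = (\<Sum>h\<le>K. if h \<in> E then - monom (cc x h) h else 0)"
      by (intro sum.cong) (auto simp: U_def cc_def smult_monom)
    then show ?thesis
      unfolding P1_def split pps restrict[OF E_subset] by (simp add: U_def sum_negf)
  qed
  have P2: "P2 x = (\<Sum>j<D. smult (x j) (V j))" for x
  proof -
    have "(\<Sum>h\<le>K. smult (x (m - d + h)) (V (m - d + h))) = (\<Sum>h\<le>K. if h \<in> J then monom (cc x h) h else 0)"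
      by (intro sum.cong) (auto simp: V_def cc_def smult_monom)
    then show ?thesis
      unfolding P2_def split pps restrict[OF J_subset] by (simp add: V_def)
  qed
  \<comment> \<open>The first \<open>m\<close> rows express divisibility through the remainder
    modulo \<open>?B\<close>, the others the coefficients of orders \<open>d\<close> to
    \<open>K\<close>.\<close>
  define A where "A i j = (if i < m then coeff (U j mod ?B) i else coeff (V j) (d + (i - m)))" for i j
  have mod_sum: "(\<Sum>j\<in>X. smult (x j) (U j)) mod ?B = (\<Sum>j\<in>X. smult (x j) (U j mod ?B))" if "finite X" for x X
    using that by induction (simp_all add: poly_mod_add_left mod_smult_left)
  have A1: "(\<Sum>j<D. A i j * x j) = coeff (P1 x mod ?B) i" if "i < m" for i x
    unfolding P1 mod_sum[OF finite_lessThan] using that by (simp add: coeff_sum A_def mult.commute)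
  have A2: "(\<Sum>j<D. A i j * x j) = coeff (P2 x) (d + (i - m))" if "\<not> i < m" for i x
    unfolding P2 using that by (simp add: coeff_sum A_def mult.commute)
  have Dm: "D = m + (Suc K - d)" using d by (simp add: D_def)
  have low: "coeff (poly_part d p) h = 0" if "h < d" for p h
    unfolding poly_part_def mult.assoc using that by (simp add: coeff_monom_mult)
  have lowJ: "coeff (\<Sum>h\<in>J. monom (c h) h) h = 0" if "h < d" for h and c :: "nat \<Rightarrow> complex"
  proof -
    have "h \<in> E" using that E by auto
    then show ?thesis using E_memD by (simp add: coeff_sum_monom)
  qed
  have degpp: "degree (pp x) < m - d" for x
  proof -
    have "degree (pp x) \<le> m - d - 1" unfolding pp_def
      by (intro degree_sum_le) (auto intro: order_trans[OF degree_monom_le])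
    then show ?thesis using d by simp
  qed
  have solved: "system d K E J r (pp x) (cc x)"
    if r: "\<And>h. h < d \<Longrightarrow> coeff r h = 0"
      and eq: "\<And>i. i < D \<Longrightarrow> (\<Sum>j<D. A i j * x j) = (if i < m then - coeff (r mod ?B) i else - coeff r (d + (i - m)))" for x r
  proof -
    have "(P1 x + r) mod ?B = 0"
    proof (rule poly_eqI)
      fix i
      show "coeff ((P1 x + r) mod ?B) i = coeff 0 i"
      proof (cases "i < m")
        case True
        then have "coeff (P1 x mod ?B) i = - coeff (r mod ?B) i" using eq[of i] A1[of i x] Dm by simp
        then show ?thesis by (simp add: poly_mod_add_left)
      next
        case False
        then show ?thesis
          using degree_mod_less[OF B0, of "P1 x + r"] degB by (auto intro: coeff_eq_0)
      qed
    qed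
    then have "?B dvd P1 x + r" by (simp add: mod_eq_0_iff_dvd)
    moreover have "coeff (P2 x + r) h = 0" if "h \<le> K" for h
    proof (cases "h < d")
      case True
      then show ?thesis using r low lowJ by (simp add: P2_def)
    next
      case False
      then have "m + (h - d) < D" "\<not> m + (h - d) < m" "d + (m + (h - d) - m) = h" using that d Dm by auto
      then have "coeff (P2 x) h = - coeff r h" using eq[of "m + (h - d)"] A2[of "m + (h - d)" x] by simp
      then show ?thesis by simp
    qed
    ultimately show ?thesis using degpp by (simp add: system_def P1_def P2_def)
  qed
  have "\<exists>x. \<forall>i<D. (\<Sum>j<D. A i j * x j) = (if i < m then - coeff (r mod ?B) i else - coeff r (d + (i - m)))"
  proof (rule square_system_solvable)
    fix x assume "\<And>i. i < D \<Longrightarrow> (\<Sum>j<D. A i j * x j) = 0"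
    then have "system d K E J 0 (pp x) (cc x)" by (intro solved) simp_all
    note triv = system_trivial[OF this]
    show "\<forall>j<D. x j = 0"
    proof (intro allI impI)
      fix j assume j: "j < D"
      show "x j = 0"
      proof (cases "j < m - d")
        case True
        then have "coeff (pp x) j = x j" unfolding pp_def by (simp add: coeff_sum_monom)
        with triv(1) show ?thesis by simp
      next
        case False
        then have "cc x (j - (m - d)) = x j" "j - (m - d) \<le> K" using j by (auto simp: cc_def D_def)
        with triv(2) show ?thesis by metis
      qed
    qed
  qed
  then show ?thesis using solved[OF r] by blast
qed

text \<open>The inhomogeneity turns the coefficient at \<open>h\<close> into \<open>c h + 1\<close>,
  and the second equation gives \<open>coeff G h = 1\<close>. The ratio identity is applied with the
  smaller set \<open>E - {h}\<close> as base.\<close>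

lemma system_ratio_remove:
  assumes "system d K E J (- monom 1 h) p c" "h \<in> E"
  shows "Z (E - {h}) = (c h + 1) * Z E"
proof -
  let ?G = "poly_part d p" and ?R = "(\<Sum>h\<in>E. monom (c h) h) + monom 1 h"
  have p: "degree p < m - d" and dvd: "[:a, 1:] ^ m dvd ?G - ?R"
    and co: "\<And>x. x \<le> K \<Longrightarrow> coeff ?G x + (if x \<in> J then c x else 0) - (if x = h then 1 else 0) = 0"
    using assms(1) by (auto simp: system_def coeff_sum_monom algebra_simps)
  have hK: "h \<le> K" using assms(2) E_subset by auto
  have "degree (monom (1 :: complex) h) \<le> M" using hK K by (intro order_trans[OF degree_monom_le]) simp
  then have degs: "degree ?G \<le> M" "degree ?R \<le> M"
    using poly_part_degree[OF p] sum_monom_degree[OF E_subset] by (auto intro: degree_add_le)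
  have GE: "coeff ?G x = (if x = h then 1 else 0)" if "x \<in> E" for x using co[of x] E_memD[OF that] by auto
  have "- (c h + 1) * Z (insert h (E - {h})) = - coeff ?G h * Z (E - {h})"
  proof (rule ratio[where u = "?G - ?R"])
    show "coeff (?G - ?R) x = coeff ?G x + (if x = h then - (c h + 1) else 0)" if "x \<notin> E - {h}" for x
      using that assms(2) by (cases "x = h") (simp_all add: coeff_sum_monom)
    show "coeff ?G x = 0" if "x \<in> E - {h}" for x using that GE[of x] by simp
    show "degree (?G - ?R) \<le> M" using degs by (rule degree_diff_le)
  qed (rule degs dvd poly_part_dvd | simp)+
  then have "- ((c h + 1) * Z E) = - Z (E - {h})"
    using GE[OF assms(2)] assms(2) by (simp only: insert_Diff mult_minus_left simp_thms if_True mult_1)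
  then show ?thesis by (simp only: neg_equal_iff_equal)
qed

text \<open>Here the inhomogeneity is the discrepancy itself, so \<open>s = 1\<close>, and the
  second equation yields \<open>coeff G h = - (c h + 1)\<close> since \<open>h\<close> lies in
  \<open>J\<close>.\<close>

lemma system_ratio_insert:
  assumes "system d K E J (monom 1 h) p c" "h \<in> J"
  shows "Z (insert h E) = (c h + 1) * Z E"
proof -
  let ?G = "poly_part d p" and ?R = "\<Sum>h\<in>E. monom (c h) h"
  have p: "degree p < m - d" and dvd: "[:a, 1:] ^ m dvd ?G - ?R + monom 1 h"
    and co: "\<And>x. x \<le> K \<Longrightarrow> coeff ?G x + (if x \<in> J then c x else 0) + (if x = h then 1 else 0) = 0"
    using assms(1) by (auto simp: system_def coeff_sum_monom)
  have hK: "h \<le> K" and hE: "h \<notin> E" using assms(2) J_subset EJ by auto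
  have "degree (monom (1 :: complex) h) \<le> M" using hK K by (intro order_trans[OF degree_monom_le]) simp
  then have degs: "degree ?G \<le> M" "degree ?R \<le> M" "degree (?G - ?R + monom 1 h) \<le> M"
    using poly_part_degree[OF p] sum_monom_degree[OF E_subset, of c]
    by (auto intro!: degree_add_le degree_diff_le)
  have GE: "coeff ?G x = 0" if "x \<in> E" for x
    using co[of x] E_memD[OF that] that hE by (cases "x = h") simp_all
  have "1 * Z (insert h E) = - coeff ?G h * Z E"
  proof (rule ratio[where u = "?G - ?R + monom 1 h"])
    show "coeff (?G - ?R + monom 1 h) x = coeff ?G x + (if x = h then 1 else 0)" if "x \<notin> E" for x
      using that by (simp add: coeff_sum_monom)
  qed (rule degs dvd poly_part_dvd hE GE; assumption?)+
  moreover have "coeff ?G h = - (c h + 1)" using co[OF hK] assms(2) by (simp add: add_eq_0_iff algebra_simps)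
  ultimately show ?thesis by simp
qed

end

subsection \<open>Real and complex transfer operators\<close>

text \<open>Positivity lives over the reals and the linear system over the complex numbers; these
  identities identify the two versions of each operator.\<close>

lemma of_real_hop:
  "(\<lambda>S. complex_of_real (hop s t x f S)) = hop (of_real s) (of_real t) x (\<lambda>S. of_real (f S))"
  by (auto simp: hop_def fun_eq_iff)

lemma of_real_foldr_hop:
  "(\<lambda>S. complex_of_real (foldr (hop s t) xs f S)) = foldr (hop (of_real s) (of_real t)) xs (\<lambda>S. of_real (f S))"
  by (induction xs) (simp_all add: of_real_hop)

lemma of_real_ustep:
  "(\<lambda>S. complex_of_real (ustep a N f S)) = ustep (of_real a) N (\<lambda>S. of_real (f S))"
  using of_real_foldr_hop[of a 1 "[0..<N]" f] by (simp add: ustep_def)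

lemma of_real_dstep:
  "(\<lambda>S. complex_of_real (dstep a N f S)) = dstep (of_real a) N (\<lambda>S. of_real (f S))"
proof
  fix S
  have "complex_of_real (foldr (hop 1 a) (rev [0..<N]) f (insert N S)) =
      foldr (hop 1 (of_real a)) (rev [0..<N]) (\<lambda>S. of_real (f S)) (insert N S)"
    using fun_cong[OF of_real_foldr_hop[of 1 a "rev [0..<N]" f]] by simp
  then show "complex_of_real (dstep a N f S) = dstep (of_real a) N (\<lambda>S. of_real (f S)) S"
    unfolding foldr_conv_fold rev_rev_ident by (simp add: dstep_def)
qed

lemma of_real_udsteps:
  "(\<lambda>S. complex_of_real ((udstep a N ^^ k) f S)) = (udstep (of_real a) N ^^ k) (\<lambda>S. of_real (f S))"
  by (induction k) (simp_all add: udstep_def of_real_ustep of_real_dstep)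

lemma of_real_avoid:
  "(\<lambda>S. complex_of_real (avoid E f S)) = avoid E (\<lambda>S. of_real (f S))"
  by (auto simp: avoid_def fun_eq_iff)

lemma of_real_initial: "(\<lambda>S. complex_of_real (initial_state N S)) = initial_state N"
  by (auto simp: initial_state_def fun_eq_iff)

lemma avoid_nonneg: "(\<And>S. 0 \<le> f S) \<Longrightarrow> 0 \<le> (avoid E f S :: real)"
  by (simp add: avoid_def)

lemma subset_avoiding:
  assumes "E \<subseteq> {..<p}" "card E + n \<le> p"
  obtains S where "S \<subseteq> {..<p}" "S \<inter> E = {}" "card S = n"
proof -
  have "finite E" using assms(1) by (rule finite_subset) simp
  then have "n \<le> card ({..<p} - E)" using assms by (simp add: card_Diff_subset)
  then obtain S where "S \<subseteq> {..<p} - E" "card S = n" by (rule obtain_subset_with_card_n)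
  then show ?thesis using that by blast
qed

subsection \<open>Generating functions as transfer sums\<close>

lemma F_odd_transfer:
  assumes "Suc m \<le> N" "\<And>i. i \<in> I \<Longrightarrow> i \<ge> int (Suc m) - int N"
  shows "F_odd N (Suc m) I a = (udstep a N ^^ (N - Suc m))
    (dstep a N (avoid {h. int (Suc m) - int h \<in> I} (ustep a N ((udstep a N ^^ m) (initial_state N))))) {}"
proof -
  let ?E = "{h. int (Suc m) - int h \<in> I}"
  have lev: "2 * int (Suc m) - 1 = 2 * int m + 1" by simp
  have E: "?E = {h. int m + 1 - int h \<in> I}" by (simp add: add.commute)
  have "?E \<subseteq> {..N}" using assms(2) by fastforce
  moreover have "F_odd N (Suc m) I a = cover_sum a (level_doms N 0 N - doms_into N m ?E) (regU N N N {})"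
    unfolding F_odd_def lev E
    by (rule tilings_avoiding_sum, rule particles_odd_disjoint) (use assms(2) in \<open>auto simp: add.commute\<close>)
  ultimately show ?thesis using cover_sum_blocked_odd[of m N ?E a] assms(1) by simp
qed

lemma F_even_transfer:
  assumes "m \<le> N" "\<And>i. i \<in> I \<Longrightarrow> i \<ge> int m - int N + 1"
  shows "F_even N m I a = (udstep a N ^^ (N - m))
    (avoid {h. int m - int h \<in> I} ((udstep a N ^^ m) (initial_state N))) {}"
proof -
  let ?E = "{h. int m - int h \<in> I}"
  have "?E \<subseteq> {..<N}" using assms(2) by fastforce
  moreover have "F_even N m I a = cover_sum a (level_doms N 0 N - doms_up N m ?E) (regU N N N {})"
    unfolding F_even_def
    by (rule tilings_avoiding_sum, rule particles_even_disjoint) (use assms(2) in auto)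
  ultimately show ?thesis using cover_sum_blocked_even[of m N ?E a] assms(1) by simp
qed

text \<open>This level carries \<open>N - m\<close> particles on \<open>N + 1\<close> sites, so
  forbidding at most \<open>m + 1\<close> of them leaves room. Every configuration is reachable from
  the left and can be emptied to the right.\<close>

lemma F_odd_pos:
  fixes a :: real
  assumes "0 < a" "Suc m \<le> N" "\<And>i. i \<in> I \<Longrightarrow> i \<ge> int (Suc m) - int N"
    and card: "card {h. int (Suc m) - int h \<in> I} \<le> Suc m"
  shows "0 < F_odd N (Suc m) I a"
proof -
  let ?E = "{h. int (Suc m) - int h \<in> I}"
  let ?g = "(udstep a N ^^ m) (initial_state N)"
  let ?f = "ustep a N ?g"
  have "?E \<subseteq> {..<Suc N}" using assms(3) by fastforce
  moreover have "card ?E + (N - m) \<le> Suc N" using card assms(2) by simp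
  ultimately obtain S where S: "S \<subseteq> {..<Suc N}" "S \<inter> ?E = {}" "card S = N - m" by (rule subset_avoiding)
  have S': "S \<subseteq> {..N}" using S(1) by (simp add: lessThan_Suc_atMost)
  have g: "0 \<le> ?g S" for S using assms(1) by (intro udstep_nonneg) (auto simp: initial_state_def)
  then have f: "0 \<le> ?f S" for S using assms(1) by (intro ustep_nonneg)
  have "0 < ?f S"
  proof (rule ustep_full_support[OF assms(1) g _ _ S' S(3)])
    show "0 < ?g S'" if "S' \<subseteq> {..<N}" "card S' = N - m" for S'
      using that assms(2) by (intro udstep_initial_full_support[OF assms(1)]) auto
  qed simp
  then have "0 < avoid ?E ?f S" using S(2) by (simp add: avoid_def)
  moreover have "card S = Suc (N - Suc m)" using S(3) assms(2) by simp
  ultimately have "0 < (udstep a N ^^ (N - Suc m)) (dstep a N (avoid ?E ?f)) {}"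
    by (intro udstep_dstep_final_pos[OF assms(1) avoid_nonneg[OF f] S'])
  then show ?thesis using F_odd_transfer[of m N I a] assms(2,3) by simp
qed

lemma F_even_pos:
  fixes a :: real
  assumes "0 < a" "m \<le> N" "\<And>i. i \<in> I \<Longrightarrow> i \<ge> int m - int N + 1"
    and card: "card {h. int m - int h \<in> I} \<le> m"
  shows "0 < F_even N m I a"
proof -
  let ?E = "{h. int m - int h \<in> I}"
  let ?g = "(udstep a N ^^ m) (initial_state N)"
  have "?E \<subseteq> {..<N}" using assms(3) by fastforce
  moreover have "card ?E + (N - m) \<le> N" using card assms(2) by simp
  ultimately obtain S where S: "S \<subseteq> {..<N}" "S \<inter> ?E = {}" "card S = N - m" by (rule subset_avoiding)
  have g: "0 \<le> ?g S" for S using assms(1) by (intro udstep_nonneg) (auto simp: initial_state_def)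
  have "0 < ?g S" by (rule udstep_initial_full_support[OF assms(1,2) S(1,3)])
  then have "0 < avoid ?E ?g S" using S(2) by (simp add: avoid_def)
  then have "0 < (udstep a N ^^ (N - m)) (avoid ?E ?g) {}"
    by (intro udstep_final_pos[OF assms(1) avoid_nonneg[OF g] S(1,3)])
  then show ?thesis using F_even_transfer[of m N I a] assms(2,3) by simp
qed

subsection \<open>The index sets\<close>

text \<open>Each further pair of indices appends a block of \<open>I\<close> and a block of
  \<open>J\<close> below the previous ones. The cardinality estimate is what the hypothesis on
  \<open>k 1\<close> will be compared with.\<close>

lemma index_sets:
  assumes "\<forall>l\<in>{1..q}. k (2 * l + 1) \<le> k (2 * l) \<and> k (2 * l) < k (2 * l - 1)"
  shows "set_I q k \<union> set_J q k = {k (2 * q + 1)..}" "set_I q k \<inter> set_J q k = {}"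
    "{k 1..} \<subseteq> set_I q k" "set_J q k \<subseteq> {..<k 1}" "k (2 * q + 1) \<le> k 1"
    "int (card (set_I q k \<inter> {..<k 1})) \<le> (\<Sum>l = 1..q. k (2 * l) + 1 - k (2 * l + 1))"
proof -
  have "set_I q k \<union> set_J q k = {k (2 * q + 1)..} \<and> set_I q k \<inter> set_J q k = {} \<and>
    {k 1..} \<subseteq> set_I q k \<and> set_J q k \<subseteq> {..<k 1} \<and> k (2 * q + 1) \<le> k 1 \<and>
    int (card (set_I q k \<inter> {..<k 1})) \<le> (\<Sum>l = 1..q. k (2 * l) + 1 - k (2 * l + 1))"
    using assms
  proof (induction q)
    case 0
    have "{k (Suc 0)..} \<inter> {..<k (Suc 0)} = {}" by auto
    then show ?case by (simp add: set_I_def set_J_def segment_I_def)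
  next
    case (Suc q)
    define x y z where "x = k (2 * q + 1)" and "y = k (2 * Suc q)" and "z = k (2 * Suc q + 1)"
    have ineq: "z \<le> y" "y < x"
      using bspec[OF Suc.prems, of "Suc q"] by (simp_all add: x_def y_def z_def)
    have IH: "set_I q k \<union> set_J q k = {x..}" "set_I q k \<inter> set_J q k = {}"
      "{k 1..} \<subseteq> set_I q k" "set_J q k \<subseteq> {..<k 1}" "x \<le> k 1"
      "int (card (set_I q k \<inter> {..<k 1})) \<le> (\<Sum>l = 1..q. k (2 * l) + 1 - k (2 * l + 1))"
      using Suc unfolding x_def by auto
    have I: "set_I (Suc q) k = set_I q k \<union> {z..y}"
      by (auto simp: set_I_def segment_I_def atMost_Suc y_def z_def)
    have J: "set_J (Suc q) k = set_J q k \<union> {y + 1..x - 1}"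
      by (auto simp: set_J_def atLeastAtMostSuc_conv x_def y_def)
    have mem: "i \<in> set_I q k \<or> i \<in> set_J q k \<longleftrightarrow> x \<le> i" for i using IH(1) by auto
    have "set_I (Suc q) k \<union> set_J (Suc q) k = {z..}"
    proof (rule set_eqI)
      fix i show "i \<in> set_I (Suc q) k \<union> set_J (Suc q) k \<longleftrightarrow> i \<in> {z..}"
        using mem[of i] ineq unfolding I J by auto
    qed
    moreover have "i \<notin> set_J (Suc q) k" if "i \<in> set_I (Suc q) k" for i
      using that mem[of i] IH(2) ineq unfolding I J by auto
    moreover have "int (card (set_I (Suc q) k \<inter> {..<k 1})) \<le> (\<Sum>l = 1..Suc q. k (2 * l) + 1 - k (2 * l + 1))"
    proof -
      have "card (set_I (Suc q) k \<inter> {..<k 1}) \<le> card (set_I q k \<inter> {..<k 1}) + card ({z..y} \<inter> {..<k 1})"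
        unfolding I Int_Un_distrib2 by (rule card_Un_le)
      also have "card ({z..y} \<inter> {..<k 1}) \<le> card {z..y}" by (intro card_mono) auto
      finally show ?thesis using IH(6) ineq by (simp add: y_def z_def)
    qed
    ultimately show ?case using IH(3-5) ineq unfolding I J z_def[symmetric] by auto
  qed
  then show "set_I q k \<union> set_J q k = {k (2 * q + 1)..}" "set_I q k \<inter> set_J q k = {}"
    "{k 1..} \<subseteq> set_I q k" "set_J q k \<subseteq> {..<k 1}" "k (2 * q + 1) \<le> k 1"
    "int (card (set_I q k \<inter> {..<k 1})) \<le> (\<Sum>l = 1..q. k (2 * l) + 1 - k (2 * l + 1))"
    by auto
qed

subsection \<open>Landau symbols and divisibility of polynomials\<close>

text \<open>If the order of the zero were too small, cancelling the exact power of
  \<open>z - z0\<close> would leave a cofactor bounded by a positive power of \<open>z - z0\<close>.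
  It would then vanish at \<open>z0\<close>, contrary to the choice of the order.\<close>

lemma poly_bigo_iff_dvd:
  fixes P :: "complex poly"
  shows "(\<lambda>z. poly P z) \<in> O[at z0](\<lambda>z. (z - z0) ^ m) \<longleftrightarrow> [:- z0, 1:] ^ m dvd P"
proof
  assume "[:- z0, 1:] ^ m dvd P"
  then obtain Q where P: "P = [:- z0, 1:] ^ m * Q" by (rule dvdE)
  have ev: "eventually (\<lambda>z. (z - z0) ^ m \<noteq> 0) (at z0)"
    using eventually_neq_at_within[of z0 z0 UNIV] by eventually_elim simp
  have "((\<lambda>z. poly Q z) \<longlongrightarrow> poly Q z0) (at z0)"
    by (intro tendsto_intros)
  then have "((\<lambda>z. poly P z / (z - z0) ^ m) \<longlongrightarrow> poly Q z0) (at z0)"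
  proof (rule Lim_transform_eventually)
    show "eventually (\<lambda>z. poly Q z = poly P z / (z - z0) ^ m) (at z0)"
      using ev by eventually_elim (simp add: P)
  qed
  then show "(\<lambda>z. poly P z) \<in> O[at z0](\<lambda>z. (z - z0) ^ m)"
    using ev by (rule bigoI_tendsto)
next
  assume bigo: "(\<lambda>z. poly P z) \<in> O[at z0](\<lambda>z. (z - z0) ^ m)"
  show "[:- z0, 1:] ^ m dvd P"
  proof (rule ccontr)
    assume not: "\<not> [:- z0, 1:] ^ m dvd P"
    then have "P \<noteq> 0" and lt: "order z0 P < m" by (auto simp: order_divides)
    obtain Q where P: "P = [:- z0, 1:] ^ order z0 P * Q" and Q: "\<not> [:- z0, 1:] dvd Q"
      using order_decomp[OF \<open>P \<noteq> 0\<close>] by blast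
    define s where "s = m - order z0 P"
    have s: "s > 0" "m = order z0 P + s" using lt by (auto simp: s_def)
    from bigo obtain C where C: "eventually (\<lambda>z. norm (poly P z) \<le> C * norm ((z - z0) ^ m)) (at z0)"
      by (elim landau_o.bigE)
    have "eventually (\<lambda>z. norm (poly Q z) \<le> C * norm ((z - z0) ^ s)) (at z0)"
      using C eventually_neq_at_within[of z0 z0 UNIV]
    proof eventually_elim
      case (elim z)
      have "norm (poly P z) = norm (z - z0) ^ order z0 P * norm (poly Q z)"
        by (subst P) (simp add: norm_mult norm_power)
      moreover have "C * norm ((z - z0) ^ m) = norm (z - z0) ^ order z0 P * (C * norm ((z - z0) ^ s))"
        by (subst s(2)) (simp add: power_add norm_mult norm_power)
      ultimately have "norm (z - z0) ^ order z0 P * norm (poly Q z) \<le> norm (z - z0) ^ order z0 P * (C * norm ((z - z0) ^ s))"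
        using elim(1) by (simp only:)
      moreover have "0 < norm (z - z0) ^ order z0 P" using elim(2) by simp
      ultimately show ?case by (simp only: mult_le_cancel_left_pos)
    qed
    moreover have "((\<lambda>z. norm (poly Q z)) \<longlongrightarrow> norm (poly Q z0)) (at z0)"
      by (intro tendsto_intros)
    moreover have "((\<lambda>z. C * norm ((z - z0) ^ s)) \<longlongrightarrow> C * norm ((z0 - z0) ^ s)) (at z0)"
      by (intro tendsto_intros)
    ultimately have "norm (poly Q z0) \<le> C * norm ((z0 - z0) ^ s)"
      by (intro tendsto_le[OF at_neq_bot])
    then have "poly Q z0 = 0" using s(1) by (simp add: zero_power)
    with Q show False by (simp add: poly_eq_0_iff_dvd)
  qed
qed

text \<open>For \<open>\<epsilon> = 1\<close> the cut runs between an up step and the following down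
  step: there are \<open>N + 1\<close> sites and the right part has one more down step. For
  \<open>\<epsilon> = 0\<close> it runs between full levels with \<open>N\<close> sites. This
  explains \<open>M = N + \<epsilon> - 1\<close> and the exponent
  \<open>N - m + \<epsilon>\<close>.\<close>

lemma hole_process_exists:
  fixes a :: real
  assumes "1 \<le> m" "m \<le> N" "\<epsilon> \<in> {0, 1}" "0 < a"
  shows "\<exists>\<beta> \<Phi>. hole_process (of_real a) m (N - m + \<epsilon>) (N + \<epsilon> - 1) \<beta> \<Phi> \<and>
    (\<forall>I. (\<forall>i\<in>I. i \<ge> int m - int N - int \<epsilon> + 1) \<longrightarrow>
      complex_of_real (if \<epsilon> = 1 then F_odd N m I a else F_even N m I a) =
        \<Phi> (avoid {h. int m - int h \<in> I} \<beta>))"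
proof (cases "\<epsilon> = 1")
  case True
  obtain \<mu> where m: "m = Suc \<mu>" using assms(1) by (cases m) auto
  let ?a = "complex_of_real a"
  define \<beta> where "\<beta> = ustep ?a N ((udstep ?a N ^^ \<mu>) (initial_state N))"
  define \<Phi> where "\<Phi> f = (udstep ?a N ^^ (N - m)) (dstep ?a N f) {}" for f
  have tr: "transfer (\<lambda>f. (udstep ?a N ^^ (N - m)) (dstep ?a N f))"
    by (rule transfer_compose[OF transfer_funpow[OF transfer_udstep] transfer_dstep])
  have "hole_process ?a m (N - m + \<epsilon>) (N + \<epsilon> - 1) \<beta> \<Phi>"
  proof
    show "\<Phi> (\<lambda>S. c * f S + g S) = c * \<Phi> f + \<Phi> g" for c f g
      unfolding \<Phi>_def transfer_linear[OF tr] ..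
    show "\<Phi> f = \<Phi> g" if "\<And>S. finite S \<Longrightarrow> f S = g S" for f g
      unfolding \<Phi>_def by (rule transfer_cong[OF tr that]) simp_all
    show "wedge (coeff v) \<beta> = (\<lambda>_. 0)" if "degree v \<le> N + \<epsilon> - 1" "[:?a, 1:] ^ m dvd v" for v
      unfolding \<beta>_def using that assms True by (intro wedge_ustep_initial) (simp_all add: m)
    show "\<Phi> (wedge (coeff v) f) = 0" if "degree v \<le> N + \<epsilon> - 1" "[:1, - ?a:] ^ (N - m + \<epsilon>) dvd v" for v f
      unfolding \<Phi>_def using that assms True by (intro udstep_dstep_wedge_final) simp_all
  qed (use assms True in auto)
  moreover have "complex_of_real (F_odd N m I a) = \<Phi> (avoid {h. int m - int h \<in> I} \<beta>)"
    if "\<forall>i\<in>I. i \<ge> int m - int N - int \<epsilon> + 1" for I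
  proof -
    have "F_odd N m I a = (udstep a N ^^ (N - m)) (dstep a N (avoid {h. int m - int h \<in> I}
        (ustep a N ((udstep a N ^^ \<mu>) (initial_state N))))) {}"
      unfolding m using that assms True m by (intro F_odd_transfer) auto
    then show ?thesis
      unfolding \<Phi>_def \<beta>_def
      by (simp only: of_real_udsteps[THEN fun_cong] of_real_dstep of_real_avoid of_real_ustep of_real_udsteps of_real_initial)
  qed
  ultimately show ?thesis using True by (intro exI[of _ \<beta>] exI[of _ \<Phi>]) simp
next
  case False
  then have \<epsilon>: "\<epsilon> = 0" using assms(3) by simp
  let ?a = "complex_of_real a"
  define \<beta> where "\<beta> = (udstep ?a N ^^ m) (initial_state N)"
  define \<Phi> where "\<Phi> f = (udstep ?a N ^^ (N - m)) f {}" for f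
  have tr: "transfer (udstep ?a N ^^ (N - m))"
    by (rule transfer_funpow[OF transfer_udstep])
  have "hole_process ?a m (N - m + \<epsilon>) (N + \<epsilon> - 1) \<beta> \<Phi>"
  proof
    show "\<Phi> (\<lambda>S. c * f S + g S) = c * \<Phi> f + \<Phi> g" for c f g
      unfolding \<Phi>_def transfer_linear[OF tr] ..
    show "\<Phi> f = \<Phi> g" if "\<And>S. finite S \<Longrightarrow> f S = g S" for f g
      unfolding \<Phi>_def by (rule transfer_cong[OF tr that]) simp_all
    show "wedge (coeff v) \<beta> = (\<lambda>_. 0)" if "degree v \<le> N + \<epsilon> - 1" "[:?a, 1:] ^ m dvd v" for v
      unfolding \<beta>_def using that assms \<epsilon> by (intro wedge_udstep_initial) simp_all
    show "\<Phi> (wedge (coeff v) f) = 0" if "degree v \<le> N + \<epsilon> - 1" "[:1, - ?a:] ^ (N - m + \<epsilon>) dvd v" for v f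
      unfolding \<Phi>_def using that assms \<epsilon> by (intro udstep_wedge_final) simp_all
  qed (use assms \<epsilon> in auto)
  moreover have "complex_of_real (F_even N m I a) = \<Phi> (avoid {h. int m - int h \<in> I} \<beta>)"
    if "\<forall>i\<in>I. i \<ge> int m - int N - int \<epsilon> + 1" for I
  proof -
    have "F_even N m I a = (udstep a N ^^ (N - m)) (avoid {h. int m - int h \<in> I}
        ((udstep a N ^^ m) (initial_state N))) {}"
      using that assms \<epsilon> by (intro F_even_transfer) auto
    then show ?thesis
      unfolding \<Phi>_def \<beta>_def
      by (simp only: of_real_udsteps[THEN fun_cong] of_real_avoid of_real_udsteps of_real_initial)
  qed
  ultimately show ?thesis using \<epsilon> by (intro exI[of _ \<beta>] exI[of _ \<Phi>]) simp
qed

text \<open>With \<open>h = m - i\<close> all exponents become natural numbers. Landau conditions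
  turn into divisibility, and multiplying the second equation by \<open>\<zeta> ^ d\<close> turns
  its order \<open>K - d + 1\<close> into the vanishing of all coefficients up to
  \<open>K\<close>.\<close>

lemma linear_system_iff:
  assumes hp: "hole_process (of_real a) m (N - m + \<epsilon>) M \<beta> \<Phi>"
    and d: "int d = int m - k 1" and K: "int K = int m - k (2 * q + 1)" "d \<le> K"
    and h: "int h = int m - k j - parity_shift j" "d \<le> h"
    and E: "E = {h. int m - int h \<in> set_I q k}" and J: "J = {h. int m - int h \<in> set_J q k}"
    and fin: "finite E" "finite J" and J_less: "set_J q k \<subseteq> {..<k 1}" and dm: "d < m"
  shows "linear_system N m \<epsilon> a q k j p c \<longleftrightarrow> c \<in> {0..int K} \<rightarrow>\<^sub>E UNIV \<and>
    hole_process.system (of_real a) m (N - m + \<epsilon>) d K E J (monom ((- 1) ^ j) h) p (\<lambda>h. c (int h))"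
proof -
  interpret hole_process "of_real a" m "N - m + \<epsilon>" M \<beta> \<Phi> by (rule hp)
  let ?n = "N - m + \<epsilon>" and ?a = "complex_of_real a"
  define P where "P = poly_part d p - (\<Sum>h\<in>E. monom (c (int h)) h) + monom ((- 1) ^ j) h"
  define Q where "Q = [:1, - ?a:] ^ ?n * p + (\<Sum>h\<in>J. monom (c (int h)) (h - d)) + monom ((- 1) ^ j) (h - d)"
  have inj: "inj_on (\<lambda>h. int m - int h) X" for X by (auto simp: inj_on_def)
  have I': "set_I' m q k = (\<lambda>h. int m - int h) ` E"
  proof (intro equalityI subsetI)
    fix i assume "i \<in> set_I' m q k"
    then have "i \<in> set_I q k" "i \<le> int m" by (auto simp: set_I'_def)
    then show "i \<in> (\<lambda>h. int m - int h) ` E"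
      unfolding E by (intro image_eqI[of _ _ "nat (int m - i)"]) simp_all
  qed (auto simp: set_I'_def E)
  have J': "set_J q k = (\<lambda>h. int m - int h) ` J"
  proof (intro equalityI subsetI)
    fix i assume i: "i \<in> set_J q k"
    with J_less d have "i \<le> int m" by auto
    with i show "i \<in> (\<lambda>h. int m - int h) ` J"
      unfolding J by (intro image_eqI[of _ _ "nat (int m - i)"]) simp_all
  qed (auto simp: J)
  have J_ge: "d < h" if "h \<in> J" for h
  proof -
    have "int m - int h < k 1" using that J_less unfolding J by auto
    with d show ?thesis by linarith
  qed
  have pow: "z powi (int m - k 1) = z ^ d" "z powi (int m - k j - parity_shift j) = z ^ h"
    "z powi (k 1 - k j - parity_shift j) = z ^ (h - d)" "z powi (k 1 - k (2 * q + 1) + 1) = z ^ (K - d + 1)" for z :: complex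
  proof -
    have "int m - k 1 = int d" "int m - k j - parity_shift j = int h"
      "k 1 - k j - parity_shift j = int (h - d)" "k 1 - k (2 * q + 1) + 1 = int (K - d + 1)"
      using d K h by simp_all
    then show "z powi (int m - k 1) = z ^ d" "z powi (int m - k j - parity_shift j) = z ^ h"
      "z powi (k 1 - k j - parity_shift j) = z ^ (h - d)" "z powi (k 1 - k (2 * q + 1) + 1) = z ^ (K - d + 1)"
      by (simp_all only: power_int_of_nat)
  qed
  have f1: "z powi (int m - k 1) * (1 - of_real a * z) ^ ?n * poly p z
      - (\<Sum>i\<in>set_I' m q k. c (int m - i) * z powi (int m - i))
      + (- 1) ^ j * z powi (int m - k j - parity_shift j) = poly P z" for z
  proof -
    have "(\<Sum>i\<in>set_I' m q k. c (int m - i) * z powi (int m - i)) = poly (\<Sum>h\<in>E. monom (c (int h)) h) z"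
      unfolding I' sum.reindex[OF inj] by (simp add: poly_sum poly_monom power_int_of_nat)
    then show ?thesis
      unfolding pow P_def poly_part_def by (simp add: poly_monom mult.commute)
  qed
  have f2: "(1 - of_real a * z) ^ ?n * poly p z + (\<Sum>i\<in>set_J q k. c (int m - i) * z powi (k 1 - i))
      + (- 1) ^ j * z powi (k 1 - k j - parity_shift j) = poly Q z" for z
  proof -
    have "z powi (k 1 - (int m - int h)) = z ^ (h - d)" if "h \<in> J" for h
    proof -
      have "k 1 - (int m - int h) = int (h - d)" using d J_ge[OF that] by simp
      then show ?thesis by (simp only: power_int_of_nat)
    qed
    then have "(\<Sum>i\<in>set_J q k. c (int m - i) * z powi (k 1 - i)) = poly (\<Sum>h\<in>J. monom (c (int h)) (h - d)) z"
      unfolding J' sum.reindex[OF inj] by (simp add: poly_sum poly_monom)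
    then show ?thesis
      unfolding pow Q_def by (simp add: poly_monom mult.commute)
  qed
  have 1: "(\<lambda>z. poly P z) \<in> O[at (- ?a)](\<lambda>z. (z + ?a) ^ m) \<longleftrightarrow> [:?a, 1:] ^ m dvd P"
    using poly_bigo_iff_dvd[of P "- ?a" m] by simp
  have shift: "monom 1 d * Q = poly_part d p + (\<Sum>h\<in>J. monom (c (int h)) h) + monom ((- 1) ^ j) h"
  proof -
    have "(\<Sum>h\<in>J. monom 1 d * monom (c (int h)) (h - d)) = (\<Sum>h\<in>J. monom (c (int h)) h)"
      by (intro sum.cong refl) (simp add: mult_monom J_ge less_imp_le)
    then show ?thesis
      using h(2) unfolding Q_def poly_part_def
      by (simp add: distrib_left sum_distrib_left mult_monom mult.assoc)
  qed
  have "(\<lambda>z. poly Q z) \<in> O[at 0](\<lambda>z. z ^ (K - d + 1)) \<longleftrightarrow> (\<forall>i<K - d + 1. coeff Q i = 0)"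
    using poly_bigo_iff_dvd[of Q 0 "K - d + 1"] monom_1_dvd_iff'[of "K - d + 1" Q]
    by (simp add: monom_altdef)
  also have "\<dots> \<longleftrightarrow> (\<forall>h\<le>K. coeff (monom 1 d * Q) h = 0)"
  proof
    assume *: "\<forall>i<K - d + 1. coeff Q i = 0"
    then show "\<forall>h\<le>K. coeff (monom 1 d * Q) h = 0" by (auto simp: coeff_monom_mult)
  next
    assume *: "\<forall>h\<le>K. coeff (monom 1 d * Q) h = 0"
    show "\<forall>i<K - d + 1. coeff Q i = 0"
    proof (intro allI impI)
      fix i assume "i < K - d + 1"
      then have "i + d \<le> K" using K(2) by simp
      with * have "coeff (monom 1 d * Q) (i + d) = 0" by blast
      then show "coeff Q i = 0" by (simp add: coeff_monom_mult)
    qed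
  qed
  finally have 2: "(\<lambda>z. poly Q z) \<in> O[at 0](\<lambda>z. z ^ (K - d + 1)) \<longleftrightarrow> (\<forall>h\<le>K. coeff (monom 1 d * Q) h = 0)" .
  have deg: "int (degree p) \<le> k 1 - 1 \<longleftrightarrow> degree p < m - d" using d dm by linarith
  show ?thesis
    unfolding linear_system_def f1 f2 pow(4) 1 2 deg system_def shift K(1)[symmetric] P_def[symmetric]
    by blast
qed

theorem theorem5p1:
  fixes N m \<epsilon> q j :: nat and a :: real and k :: "nat \<Rightarrow> int"
  assumes "N \<ge> 1" and "m \<in> {1..N}" and "\<epsilon> \<in> {0, 1}" and "a \<in> {0<..1}"
    and "\<forall>l\<in>{1..q}. k (2 * l + 1) \<le> k (2 * l) \<and> k (2 * l) < k (2 * l - 1)"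
    and "k 1 \<le> int m"
    and "k (2 * q + 1) \<ge> int m - int N - int \<epsilon> + 1"
    and "k 1 \<ge> 1 + (\<Sum>l = 1..q. k (2 * l) + 1 - k (2 * l + 1))"
    and "j \<in> {1..2 * q + 1}"
    and "odd j \<Longrightarrow> j \<noteq> 1 \<Longrightarrow> k j < k (j - 1)"
    and "even j \<Longrightarrow> k j + 1 < k (j - 1)"
  defines "I \<equiv> set_I q k"
    and "I_star \<equiv> (if odd j then set_I q k - {k j} else set_I q k \<union> {k j + 1})"
  shows "(\<exists>!s. linear_system N m \<epsilon> a q k j (fst s) (snd s)) \<and>
    (\<forall>p c. linear_system N m \<epsilon> a q k j p c \<longrightarrow>
      (\<epsilon> = 1 \<longrightarrow> F_odd N m I a \<noteq> 0 \<and>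
        complex_of_real (F_odd N m I_star a / F_odd N m I a)
          = c (int m - k j - parity_shift j) + 1) \<and>
      (\<epsilon> = 0 \<longrightarrow> F_even N m I a \<noteq> 0 \<and>
        complex_of_real (F_even N m I_star a / F_even N m I a)
          = c (int m - k j - parity_shift j) + 1))"
proof -
  have m_bounds: "1 \<le> m" "m \<le> N" and a_pos: "0 < a" using assms(2,4) by auto
  note idx = index_sets[OF assms(5)]
  define F where "F X = (if \<epsilon> = 1 then F_odd N m X a else F_even N m X a)" for X
  define M where "M = N + \<epsilon> - 1"
  have "\<exists>\<beta> \<Phi>. hole_process (of_real a) m (N - m + \<epsilon>) M \<beta> \<Phi> \<and>
    (\<forall>X. (\<forall>i\<in>X. i \<ge> int m - int N - int \<epsilon> + 1) \<longrightarrow>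
      complex_of_real (F X) = \<Phi> (avoid {h. int m - int h \<in> X} \<beta>))"
    unfolding F_def M_def by (rule hole_process_exists[OF m_bounds assms(3) a_pos])
  then obtain \<beta> \<Phi> where hp: "hole_process (of_real a) m (N - m + \<epsilon>) M \<beta> \<Phi>"
    and F_all: "\<forall>X. (\<forall>i\<in>X. i \<ge> int m - int N - int \<epsilon> + 1) \<longrightarrow>
      complex_of_real (F X) = \<Phi> (avoid {h. int m - int h \<in> X} \<beta>)"
    by (elim exE conjE)
  have F_eq: "complex_of_real (F X) = \<Phi> (avoid {h. int m - int h \<in> X} \<beta>)"
    if "\<And>i. i \<in> X \<Longrightarrow> i \<ge> int m - int N - int \<epsilon> + 1" for X
    using F_all that by simp
  interpret hole_process "of_real a" m "N - m + \<epsilon>" M \<beta> \<Phi> by (rule hp)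
  define d where "d = nat (int m - k 1)"
  define K where "K = nat (int m - k (2 * q + 1))"
  define E where "E = {h. int m - int h \<in> set_I q k}"
  define J where "J = {h. int m - int h \<in> set_J q k}"
  define h where "h = nat (int m - k j - parity_shift j)"
  have sum_nonneg: "(\<Sum>l = 1..q. k (2 * l) + 1 - k (2 * l + 1)) \<ge> 0"
    using assms(5) by (intro sum_nonneg) fastforce
  have d_eq: "int d = int m - k 1" using assms(6) by (simp add: d_def)
  have K_eq: "int K = int m - k (2 * q + 1)" using assms(6) idx(5) by (simp add: K_def)
  have dK: "d \<le> K" using d_eq K_eq idx(5) by linarith
  have dm: "d < m" using d_eq assms(8) sum_nonneg by linarith
  have KM: "K \<le> M" using K_eq assms(7) m_bounds unfolding M_def by linarith
  have EJ_un: "x \<in> E \<or> x \<in> J \<longleftrightarrow> x \<le> K" for x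
  proof -
    have "x \<in> E \<or> x \<in> J \<longleftrightarrow> int m - int x \<in> set_I q k \<union> set_J q k" by (simp add: E_def J_def)
    also have "\<dots> \<longleftrightarrow> x \<le> K" unfolding idx(1) using K_eq by auto
    finally show ?thesis .
  qed
  then have EJ: "E \<inter> J = {}" "E \<union> J = {..K}" using idx(2) by (auto simp: E_def J_def)
  have fin: "finite E" "finite J" using EJ(2) finite_Un[of E J] by simp_all
  have dE: "{..d} \<subseteq> E" using idx(3) d_eq unfolding E_def by auto
  \<comment> \<open>The unbounded block of \<open>I\<close> contributes \<open>m - k 1 + 1\<close>
    sites, and the hypothesis on \<open>k 1\<close> bounds all other blocks together by
    \<open>k 1 - 1\<close>.\<close>
  have cardE: "card E \<le> m"
  proof -
    have "E = {..d} \<union> {h. int m - int h \<in> set_I q k \<inter> {..<k 1}}"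
      using dE d_eq unfolding E_def by auto
    then have "card E \<le> card {..d} + card {h. int m - int h \<in> set_I q k \<inter> {..<k 1}}"
      by (metis card_Un_le)
    moreover have "card {h. int m - int h \<in> set_I q k \<inter> {..<k 1}} \<le> card (set_I q k \<inter> {..<k 1})"
    proof (rule card_inj_on_le[where f = "\<lambda>h. int m - int h"])
      have "set_I q k \<inter> {..<k 1} \<subseteq> {k (2 * q + 1)..<k 1}" using idx(1) by auto
      then show "finite (set_I q k \<inter> {..<k 1})" by (rule finite_subset) simp
    qed (auto simp: inj_on_def)
    ultimately have "int (card E) \<le> int (Suc d) + (\<Sum>l = 1..q. k (2 * l) + 1 - k (2 * l + 1))"
      using idx(6) by simp
    then show ?thesis using d_eq assms(8) by linarith
  qed
  have I_ge: "i \<ge> int m - int N - int \<epsilon> + 1" if "i \<in> set_I q k \<union> set_J q k" for i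
    using that assms(7) unfolding idx(1) by auto
  have F_I: "F I > 0"
  proof (cases "\<epsilon> = 1")
    case True
    obtain \<mu> where \<mu>: "m = Suc \<mu>" using m_bounds(1) by (cases m) auto
    have "0 < F_odd N (Suc \<mu>) I a"
    proof (rule F_odd_pos[OF a_pos])
      show "i \<ge> int (Suc \<mu>) - int N" if "i \<in> I" for i
        using I_ge[of i] that True \<mu> unfolding I_def by simp
    qed (use m_bounds(2) cardE \<mu> in \<open>simp_all add: E_def I_def\<close>)
    then show ?thesis using True by (simp add: F_def \<mu>)
  next
    case False
    have "0 < F_even N m I a"
    proof (rule F_even_pos[OF a_pos m_bounds(2)])
      show "i \<ge> int m - int N + 1" if "i \<in> I" for i
        using I_ge[of i] that False assms(3) unfolding I_def by simp
    qed (use cardE in \<open>simp add: E_def I_def\<close>)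
    then show ?thesis using False by (simp add: F_def)
  qed
  have ZE: "Z E = of_real (F I)"
    unfolding Z_def E_def I_def by (rule F_eq[symmetric]) (use I_ge in auto)
  interpret hole_system "of_real a" m "N - m + \<epsilon>" M \<beta> \<Phi> d K E J
    by unfold_locales (use dm dK KM dE EJ ZE F_I in auto)
  \<comment> \<open>The shift makes \<open>h\<close> the site that changes: for odd \<open>j\<close>
    the end point \<open>k j\<close>, which leaves \<open>I\<close>, for even \<open>j\<close> the
    position \<open>k j + 1\<close>, which the strict inequality places in \<open>J\<close>.\<close>
  have j_cases: "int h = int m - k j - parity_shift j \<and> (if odd j then h \<in> E else h \<in> J)"
  proof (cases "odd j")
    case True
    then obtain l where l: "j = 2 * l + 1" by (metis oddE)
    then have lq: "l \<le> q" using assms(9) by simp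
    have "k j \<in> set_I q k"
      using assms(5) lq unfolding l set_I_def segment_I_def by (intro UN_I[of l]) auto
    moreover have "k j \<le> k 1" using index_sets(5)[of l k] assms(5) lq unfolding l by auto
    ultimately show ?thesis using True assms(6) by (simp add: h_def E_def parity_shift_def)
  next
    case False
    then obtain l where l: "j = 2 * l" by (metis evenE)
    then have lq: "1 \<le> l" "l \<le> q" using assms(9) by auto
    have "k j + 1 < k (2 * l - 1)" using assms(11) False l by simp
    then have kj: "k j + 1 \<in> set_J q k"
      using lq unfolding l set_J_def by (intro UN_I[of l]) auto
    then have "k j + 1 \<le> int m" using idx(4) assms(6) by auto
    with kj False show ?thesis by (simp add: h_def J_def parity_shift_def)
  qed
  have h: "int h = int m - k j - parity_shift j" "d \<le> h"
  proof -
    show *: "int h = int m - k j - parity_shift j" using j_cases by simp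
    show "d \<le> h"
    proof (cases "odd j")
      case True
      then obtain l where l: "j = 2 * l + 1" by (metis oddE)
      then have "k j \<le> k 1" using index_sets(5)[of l k] assms(5,9) by auto
      then show ?thesis using * d_eq True by (simp add: parity_shift_def)
    next
      case False
      then have "int m - int h < k 1" using j_cases idx(4) unfolding J_def by auto
      then show ?thesis using d_eq by linarith
    qed
  qed
  have star: "{x. int m - int x \<in> I_star} = (if odd j then E - {h} else insert h E)"
    using h(1) unfolding I_star_def E_def parity_shift_def by auto
  have star_ge: "i \<ge> int m - int N - int \<epsilon> + 1" if "i \<in> I_star" for i
  proof (cases "odd j")
    case True
    then show ?thesis using that I_ge unfolding I_star_def by auto
  next
    case False
    then have "k j + 1 \<in> set_J q k" using j_cases unfolding J_def parity_shift_def by auto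
    with that False show ?thesis using I_ge unfolding I_star_def by auto
  qed
  let ?r = "monom ((- 1) ^ j) h :: complex poly"
  note iff = linear_system_iff[OF hp d_eq K_eq dK h E_def J_def fin idx(4) dm]
  have unique: "\<exists>!s. linear_system N m \<epsilon> a q k j (fst s) (snd s)"
  proof -
    obtain p c0 where sys: "system d K E J ?r p c0"
      using system_solvable[of ?r] h(2) by (auto simp: coeff_monom)
    \<comment> \<open>The restriction fixes the values outside the index range, so that uniqueness
      holds for the coefficient function itself.\<close>
    define c where "c = (\<lambda>i\<in>{0..int K}. c0 (nat i))"
    have c: "c (int x) = c0 x" if "x \<le> K" for x using that by (simp add: c_def)
    have "(\<Sum>x\<in>E. monom (c (int x)) x) = (\<Sum>x\<in>E. monom (c0 x) x)"
      "(\<Sum>x\<in>J. monom (c (int x)) x) = (\<Sum>x\<in>J. monom (c0 x) x)"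
      using E_subset J_subset by (auto intro!: sum.cong simp: c)
    then have "system d K E J ?r p (\<lambda>x. c (int x))" using sys by (simp add: system_def)
    then have sol: "linear_system N m \<epsilon> a q k j p c" unfolding iff by (simp add: c_def)
    moreover have "s = (p, c)" if "linear_system N m \<epsilon> a q k j (fst s) (snd s)" for s
    proof -
      obtain p' c' where s: "s = (p', c')" by (cases s)
      from that sol have sys: "system d K E J ?r p' (\<lambda>x. c' (int x))" "system d K E J ?r p (\<lambda>x. c (int x))"
        and PiE: "c' \<in> {0..int K} \<rightarrow>\<^sub>E UNIV" "c \<in> {0..int K} \<rightarrow>\<^sub>E UNIV"
        unfolding iff s by auto
      have "c' i = c i" for i
      proof (cases "i \<in> {0..int K}")
        case True
        then have "nat i \<le> K" "int (nat i) = i" by auto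
        then show ?thesis using system_unique(2)[OF sys, of "nat i"] by simp
      next
        case False
        then show ?thesis using PiE_arb[OF PiE(1)] PiE_arb[OF PiE(2)] by simp
      qed
      then have "c' = c" by (rule ext)
      then show ?thesis using system_unique(1)[OF sys] s by simp
    qed
    ultimately show ?thesis by (intro ex1I[of _ "(p, c)"]) simp_all
  qed
  have ratio_F: "complex_of_real (F I_star / F I) = c (int m - k j - parity_shift j) + 1"
    if "linear_system N m \<epsilon> a q k j p c" for p c
  proof -
    from that have sys: "system d K E J ?r p (\<lambda>x. c (int x))" unfolding iff by simp
    have "complex_of_real (F I_star) = Z (if odd j then E - {h} else insert h E)"
      unfolding Z_def star[symmetric] by (rule F_eq) (rule star_ge)
    also have "\<dots> = (c (int h) + 1) * Z E"
    proof (cases "odd j")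
      case True
      \<comment> \<open>The sign \<open>(- 1) ^ j\<close> distinguishes removal from insertion of a
        site.\<close>
      then have "?r = - monom 1 h" by (simp add: minus_monom)
      then show ?thesis using system_ratio_remove[of h p] sys j_cases True by simp
    next
      case False
      then show ?thesis using system_ratio_insert[of h p] sys j_cases by simp
    qed
    finally show ?thesis using F_I h(1) by (simp add: ZE field_simps)
  qed
  show ?thesis
    using unique ratio_F F_I unfolding F_def by (auto split: if_splits)
qed

end
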